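(* Let $(\Omega,\mathcal F,\mu)$ be a probability space and $M\ge0$ an integer. For every $n\in\mathbb N$ the couple $$\big(U^1_{\le M}(\Omega^n,L^1(\mathbb R)),\ U^1_{\le M}(\Omega^n,L^2(\mathbb R))\big)$$ is $K$-closed in $$\big(L^1(\Omega^n,L^1(\mathbb R)),\ L^1(\Omega^n,L^2(\mathbb R))\big),$$ with a constant independent of $n$ (it may depend on $M$).
   Context: $\Omega^n$ carries the product probability measure. $U^1_{\le M}(\Omega^n)$ is the closed span in $L^1(\Omega^n)$ of the functions depending on at most $M$ coordinates. For a Banach space $B$, $U^1_{\le M}(\Omega^n,B)$ is the closure of $U^1_{\le M}(\Omega^n)\otimes B$ in the Bochner space $L^1(\Omega^n,B)$. For a compatible couple $(X_0,X_1)$ of Banach spaces, $K(f,t;X_0,X_1)=\inf_{f=f_0+f_1}\|f_0\|_{X_0}+t\|f_1\|_{X_1}$ for $f\in X_0+X_1$, $t>0$. For closed subspaces $Y_0\subset X_0$, $Y_1\subset X_1$ (with inherited norms), $(Y_0,Y_1)$ is $K$-closed in $(X_0,X_1)$ with constant $C$ if $K(f,t;Y_0,Y_1)\le C\,K(f,t;X_0,X_1)$ for all $f\in Y_0+Y_1$ and $t>0$. Here all spaces are regarded inside the measurable functions on $\Omega^n\times\mathbb R$. *)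

theory Defs
  imports "HOL-Probability.Probability"
begin

text \<open>
  Elements of function spaces are represented by measurable functions; two of them are identified
  when they agree almost everywhere. The scalar type \<open>'k\<close> (a finite-dimensional real normed
  field) stands for the real or the complex numbers.
\<close>

definition Lp :: "'b measure \<Rightarrow> real \<Rightarrow> ('b \<Rightarrow> 'k::{real_normed_field,euclidean_space}) set" where
  "Lp N p = {h \<in> borel_measurable N. integrable N (\<lambda>s. norm (h s) powr p)}"

definition Lp_norm :: "'b measure \<Rightarrow> real \<Rightarrow> ('b \<Rightarrow> 'k::{real_normed_field,euclidean_space}) \<Rightarrow> real" where
  "Lp_norm N p h = (\<integral>s. norm (h s) powr p \<partial>N) powr (1 / p)"

text \<open>
  The Bochner space \<open>L\<^sup>1(P, L\<^sup>p(\<real>))\<close>, \<open>1 \<le> p < \<infinity>\<close>, regarded inside the measurable functions on the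
  product of \<open>P\<close> with the real line. As \<open>L\<^sup>p(\<real>)\<close> is separable, its elements are exactly the
  jointly measurable functions whose sections have an integrable norm. The almost-everywhere
  condition is needed because the integral of a non-integrable section is 0 by convention.
\<close>

definition L1_Lp :: "'b measure \<Rightarrow> real \<Rightarrow> ('b \<times> real \<Rightarrow> 'k::{real_normed_field,euclidean_space}) set" where
  "L1_Lp P p = {f \<in> borel_measurable (P \<Otimes>\<^sub>M lborel).
     (AE x in P. (\<lambda>s. f (x, s)) \<in> Lp lborel p) \<and>
     integrable P (\<lambda>x. Lp_norm lborel p (\<lambda>s. f (x, s)))}"

definition L1_Lp_norm :: "'b measure \<Rightarrow> real \<Rightarrow> ('b \<times> real \<Rightarrow> 'k::{real_normed_field,euclidean_space}) \<Rightarrow> real" where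
  "L1_Lp_norm P p f = (\<integral>x. Lp_norm lborel p (\<lambda>s. f (x, s)) \<partial>P)"

definition prod_pow :: "'a measure \<Rightarrow> nat \<Rightarrow> (nat \<Rightarrow> 'a) measure" where
  "prod_pow \<mu> n = (\<Pi>\<^sub>M i\<in>{..<n}. \<mu>)"

definition depends_on_at_most ::
    "'a measure \<Rightarrow> nat \<Rightarrow> nat \<Rightarrow> ((nat \<Rightarrow> 'a) \<Rightarrow> 'k) \<Rightarrow> bool" where
  "depends_on_at_most \<mu> n M g \<longleftrightarrow>
     (\<exists>S \<subseteq> {..<n}. card S \<le> M \<and>
        (\<forall>x \<in> space (prod_pow \<mu> n). \<forall>y \<in> space (prod_pow \<mu> n).
           (\<forall>i\<in>S. x i = y i) \<longrightarrow> g x = g y))"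

definition U_span :: "'a measure \<Rightarrow> nat \<Rightarrow> nat \<Rightarrow> ((nat \<Rightarrow> 'a) \<Rightarrow> 'k::{real_normed_field,euclidean_space}) set" where
  "U_span \<mu> n M = {(\<lambda>x. \<Sum>i<m. c i * g i x) | (m::nat) c g.
     \<forall>i<m. g i \<in> Lp (prod_pow \<mu> n) 1 \<and> depends_on_at_most \<mu> n M (g i)}"

definition U1 :: "'a measure \<Rightarrow> nat \<Rightarrow> nat \<Rightarrow> ((nat \<Rightarrow> 'a) \<Rightarrow> 'k::{real_normed_field,euclidean_space}) set" where
  "U1 \<mu> n M = {u \<in> Lp (prod_pow \<mu> n) 1.
     \<forall>\<epsilon>>0. \<exists>v \<in> U_span \<mu> n M. Lp_norm (prod_pow \<mu> n) 1 (\<lambda>x. u x - v x) < \<epsilon>}"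

definition U1_tensor_Lp ::
    "'a measure \<Rightarrow> nat \<Rightarrow> nat \<Rightarrow> real \<Rightarrow> ((nat \<Rightarrow> 'a) \<times> real \<Rightarrow> 'k::{real_normed_field,euclidean_space}) set" where
  "U1_tensor_Lp \<mu> n M p = {(\<lambda>(x, s). \<Sum>i<m. u i x * h i s) | (m::nat) u h.
     \<forall>i<m. u i \<in> U1 \<mu> n M \<and> h i \<in> Lp lborel p}"

definition U1_Lp ::
    "'a measure \<Rightarrow> nat \<Rightarrow> nat \<Rightarrow> real \<Rightarrow> ((nat \<Rightarrow> 'a) \<times> real \<Rightarrow> 'k::{real_normed_field,euclidean_space}) set" where
  "U1_Lp \<mu> n M p = {f \<in> L1_Lp (prod_pow \<mu> n) p.
     \<forall>\<epsilon>>0. \<exists>g \<in> U1_tensor_Lp \<mu> n M p. L1_Lp_norm (prod_pow \<mu> n) p (\<lambda>z. f z - g z) < \<epsilon>}"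

text \<open>
  Couples of spaces of measurable functions on \<open>N\<close>, each given by its carrier and its norm.
\<close>

definition decompositions ::
    "'b measure \<Rightarrow> ('b \<Rightarrow> 'k::{real_normed_field,euclidean_space}) set \<Rightarrow> ('b \<Rightarrow> 'k) set \<Rightarrow> ('b \<Rightarrow> 'k)
       \<Rightarrow> (('b \<Rightarrow> 'k) \<times> ('b \<Rightarrow> 'k)) set" where
  "decompositions N X0 X1 f =
     {(f0, f1). f0 \<in> X0 \<and> f1 \<in> X1 \<and> (AE z in N. f z = f0 z + f1 z)}"

definition sum_space ::
    "'b measure \<Rightarrow> ('b \<Rightarrow> 'k::{real_normed_field,euclidean_space}) set \<Rightarrow> ('b \<Rightarrow> 'k) set \<Rightarrow> ('b \<Rightarrow> 'k) set" where
  "sum_space N X0 X1 = {f \<in> borel_measurable N. decompositions N X0 X1 f \<noteq> {}}"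

definition K_functional ::
    "'b measure \<Rightarrow> ('b \<Rightarrow> 'k::{real_normed_field,euclidean_space}) set \<Rightarrow> (('b \<Rightarrow> 'k) \<Rightarrow> real)
       \<Rightarrow> ('b \<Rightarrow> 'k) set \<Rightarrow> (('b \<Rightarrow> 'k) \<Rightarrow> real) \<Rightarrow> ('b \<Rightarrow> 'k) \<Rightarrow> real \<Rightarrow> real" where
  "K_functional N X0 norm0 X1 norm1 f t =
     (INF (f0, f1) \<in> decompositions N X0 X1 f. norm0 f0 + t * norm1 f1)"

text \<open>
  \<open>(Y0, Y1)\<close> is \<open>K\<close>-closed with constant \<open>C\<close> in the couple \<open>(X0, X1)\<close> with norms \<open>norm0\<close>, \<open>norm1\<close>.
  It is meant for closed subspaces \<open>Y0\<close> of \<open>X0\<close> and \<open>Y1\<close> of \<open>X1\<close>, which carry the inherited norms.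
\<close>

definition K_closed ::
    "real \<Rightarrow> 'b measure \<Rightarrow> ('b \<Rightarrow> 'k::{real_normed_field,euclidean_space}) set \<Rightarrow> ('b \<Rightarrow> 'k) set
       \<Rightarrow> ('b \<Rightarrow> 'k) set \<Rightarrow> (('b \<Rightarrow> 'k) \<Rightarrow> real) \<Rightarrow> ('b \<Rightarrow> 'k) set \<Rightarrow> (('b \<Rightarrow> 'k) \<Rightarrow> real) \<Rightarrow> bool" where
  "K_closed C N Y0 Y1 X0 norm0 X1 norm1 \<longleftrightarrow>
     (\<forall>f \<in> sum_space N Y0 Y1. \<forall>t>0.
        K_functional N Y0 norm0 Y1 norm1 f t \<le> C * K_functional N X0 norm0 X1 norm1 f t)"

end

theory Submission
  imports Defs
begin

text \<open>
  The theorem is proved by duality. Suppose that \<open>f = G + H\<close> is a nearly optimal decomposition of \<open>f\<close>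
  inside the two subspaces, for the norm \<open>\<parallel>G\<parallel> + t \<parallel>H\<parallel>\<close>. Stationarity means that the supporting
  functionals \<open>\<Phi>0\<close> of \<open>\<parallel>G\<parallel>\<close> and \<open>\<Phi>1\<close> of \<open>t \<parallel>H\<parallel>\<close> agree on the subspace of functions of few coordinates,
  whence \<open>\<parallel>G\<parallel> + t \<parallel>H\<parallel>\<close> equals the pairing of \<open>\<Phi>0\<close> with \<open>f\<close>. Here \<open>\<Phi>0\<close> is bounded by \<open>1\<close>, and all sections of
  \<open>\<Phi>1\<close> have \<open>L\<^sup>2\<close> norm at most \<open>t\<close>. If some \<open>\<Phi>\<close> induces the same functional on the subspace and satisfies
  both bounds up to a constant \<open>C\<close>, then pairing it with any other decomposition \<open>f = a0 + a1\<close> gives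
  \<open>\<parallel>G\<parallel> + t \<parallel>H\<parallel> \<le> C (\<parallel>a0\<parallel> + t \<parallel>a1\<parallel>)\<close>, which is \<open>K\<close>-closedness. The lemma \<open>finite_duality\<close> carries this out.

  So everything rests on \<open>joint_extension\<close>: if each of several quadratic constraints can be satisfied
  without changing the pairings with products of at most \<open>M\<close> one-variable functions, then all of them can
  be satisfied together, up to a constant. For sums of functions of one variable, a functional
  is given by centred increments \<open>d\<^sub>j(x\<^sub>j)\<close>, each of which satisfies every constraint, as does their sum in
  square mean (Bessel). Their running sum is a martingale. Where it is about to violate a constraint it is
  stopped; a test depending on a single coordinate \<open>j\<close> notices this only through the probability of not
  having been stopped before \<open>j\<close>, and dividing by that probability, which is at least \<open>1/2\<close>, repairs the
  pairing (\<open>stopped_sum\<close>). If a test has one factor in each of \<open>M\<close> disjoint blocks of coordinates, the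
  blocks are treated in turn: the increments along the last block are first made to satisfy their own
  constraints by induction (\<open>rainbow_joint_extension\<close>). General tests are reduced to such tests by a random
  colouring of the coordinates, which separates \<open>M\<close> given coordinates with a probability that does not
  depend on their total number. This is why the constant does not depend on \<open>n\<close>.

  The duality argument takes place on finite products, where minimisers exist by compactness and all
  conditional expectations are finite sums. To get there, \<open>U1_Lp_approximable\<close> approximates the elements of
  the subspaces by elementary functions, which depend on finitely many measurable sets; replacing points
  by the cells that these sets generate leads to a finite model (\<open>cell_duality\<close>).
\<close>

section \<open>Averaging over coordinates of a finite product\<close>

locale finite_power =
  fixes n :: nat and Q :: "nat set" and p :: "nat \<Rightarrow> real"
  assumes finite_Q: "finite Q"
    and p_pos: "y \<in> Q \<Longrightarrow> p y > 0"
    and p_sum: "(\<Sum>y\<in>Q. p y) = 1"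
begin

definition X :: "(nat \<Rightarrow> nat) set" where
  "X = (\<Pi>\<^sub>E i\<in>{..<n}. Q)"

definition pw :: "(nat \<Rightarrow> nat) \<Rightarrow> real" where
  "pw \<xi> = (\<Prod>i<n. p (\<xi> i))"

definition Ex :: "((nat \<Rightarrow> nat) \<Rightarrow> 'v::real_vector) \<Rightarrow> 'v" where
  "Ex f = (\<Sum>\<xi>\<in>X. pw \<xi> *\<^sub>R f \<xi>)"

text \<open>
  The conditional expectation given the coordinates outside \<open>T\<close>: those in \<open>T\<close> are replaced by an
  independent copy. This form lets \<open>T\<close> vary freely without splitting the product.
\<close>

definition avg :: "nat set \<Rightarrow> ((nat \<Rightarrow> nat) \<Rightarrow> 'v::real_vector) \<Rightarrow> (nat \<Rightarrow> nat) \<Rightarrow> 'v" where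
  "avg T f \<xi> = Ex (\<lambda>\<eta>. f (override_on \<xi> \<eta> T))"

definition indep :: "nat set \<Rightarrow> ((nat \<Rightarrow> nat) \<Rightarrow> 'v) \<Rightarrow> bool" where
  "indep T f \<longleftrightarrow> (\<forall>\<xi>\<in>X. \<forall>\<eta>\<in>X. f (override_on \<xi> \<eta> T) = f \<xi>)"

lemma finite_X [simp]: "finite X"
  unfolding X_def by (intro finite_PiE) (auto simp: finite_Q)

lemma pw_pos: "\<xi> \<in> X \<Longrightarrow> pw \<xi> > 0"
  unfolding pw_def X_def by (intro prod_pos) (auto simp: p_pos PiE_iff)

lemma pw_nonneg: "\<xi> \<in> X \<Longrightarrow> pw \<xi> \<ge> 0"
  using pw_pos by (simp add: less_imp_le)

lemma sum_pw: "(\<Sum>\<xi>\<in>X. pw \<xi>) = 1"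
proof -
  have "(\<Sum>\<xi>\<in>X. pw \<xi>) = (\<Prod>i<n. \<Sum>y\<in>Q. p y)"
    unfolding X_def pw_def by (rule prod_sum_PiE [symmetric]) (auto simp: finite_Q)
  then show ?thesis by (simp add: p_sum)
qed

lemma override_in_X: "\<xi> \<in> X \<Longrightarrow> \<eta> \<in> X \<Longrightarrow> override_on \<xi> \<eta> T \<in> X"
  unfolding X_def override_on_def by (auto simp: PiE_iff extensional_def)

lemma Ex_cong: "(\<And>\<xi>. \<xi> \<in> X \<Longrightarrow> f \<xi> = g \<xi>) \<Longrightarrow> Ex f = Ex g"
  unfolding Ex_def by (intro sum.cong) auto

lemma Ex_const [simp]: "Ex (\<lambda>_. c) = c"
  unfolding Ex_def by (simp flip: scaleR_sum_left add: sum_pw)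

lemma Ex_add: "Ex (\<lambda>\<xi>. f \<xi> + g \<xi>) = Ex f + Ex g"
  unfolding Ex_def by (simp add: scaleR_add_right sum.distrib)

lemma Ex_diff: "Ex (\<lambda>\<xi>. f \<xi> - g \<xi>) = Ex f - Ex g"
  unfolding Ex_def by (simp add: scaleR_diff_right sum_subtractf)

lemma Ex_scaleR: "Ex (\<lambda>\<xi>. c *\<^sub>R f \<xi>) = c *\<^sub>R Ex f"
  unfolding Ex_def by (simp add: scaleR_sum_right mult.commute)

lemma Ex_scaleR_left: "Ex (\<lambda>\<xi>. f \<xi> *\<^sub>R c) = Ex f *\<^sub>R c"
  unfolding Ex_def by (simp add: scaleR_sum_left)

lemma Ex_mult_left: "Ex (\<lambda>\<xi>. c * f \<xi> :: real) = c * Ex f"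
  using Ex_scaleR [of c f] by simp

lemma Ex_sum: "Ex (\<lambda>\<xi>. \<Sum>k\<in>A. f k \<xi>) = (\<Sum>k\<in>A. Ex (f k))"
  unfolding Ex_def by (simp add: scaleR_sum_right) (rule sum.swap)

lemma Ex_inner_left: "Ex (\<lambda>\<xi>. inner c (f \<xi>)) = inner c (Ex f)"
  unfolding Ex_def by (simp add: inner_sum_right)

lemma Ex_inner_right: "Ex (\<lambda>\<xi>. inner (f \<xi>) c) = inner (Ex f) c"
  unfolding Ex_def by (simp add: inner_sum_left)

lemma Ex_mono: "(\<And>\<xi>. \<xi> \<in> X \<Longrightarrow> f \<xi> \<le> (g \<xi> :: real)) \<Longrightarrow> Ex f \<le> Ex g"
  unfolding Ex_def by (intro sum_mono) (auto intro: mult_left_mono pw_nonneg)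

lemma Ex_nonneg: "(\<And>\<xi>. \<xi> \<in> X \<Longrightarrow> 0 \<le> (f \<xi> :: real)) \<Longrightarrow> 0 \<le> Ex f"
  using Ex_mono [of "\<lambda>_. 0" f] by simp

lemma norm_Ex_square_le:
  fixes f :: "(nat \<Rightarrow> nat) \<Rightarrow> 'v::real_inner"
  shows "(norm (Ex f))\<^sup>2 \<le> Ex (\<lambda>\<xi>. (norm (f \<xi>))\<^sup>2)"
proof -
  have "0 \<le> Ex (\<lambda>\<xi>. (norm (f \<xi> - Ex f))\<^sup>2)"
    by (rule Ex_nonneg) simp
  also have "\<dots> = Ex (\<lambda>\<xi>. ((norm (f \<xi>))\<^sup>2 - 2 * inner (f \<xi>) (Ex f)) + (norm (Ex f))\<^sup>2)"
    by (rule Ex_cong) (simp add: power2_norm_eq_inner inner_diff_left inner_diff_right inner_commute)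
  also have "\<dots> = Ex (\<lambda>\<xi>. (norm (f \<xi>))\<^sup>2) - 2 * inner (Ex f) (Ex f) + (norm (Ex f))\<^sup>2"
    by (simp add: Ex_add Ex_diff Ex_mult_left Ex_inner_right)
  finally show ?thesis by (simp add: power2_norm_eq_inner)
qed

text \<open>
  Exchanging the coordinates in \<open>T\<close> between two independent copies preserves the product weights.
  This one symmetry gives the self-adjointness of averaging and its composition rule.
\<close>

lemma Ex_swap:
  fixes g :: "(nat \<Rightarrow> nat) \<Rightarrow> (nat \<Rightarrow> nat) \<Rightarrow> 'v::real_vector"
  shows "Ex (\<lambda>\<xi>. Ex (\<lambda>\<eta>. g (override_on \<xi> \<eta> T) (override_on \<eta> \<xi> T))) = Ex (\<lambda>\<xi>. Ex (\<lambda>\<eta>. g \<xi> \<eta>))"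
proof -
  define s where "s = (\<lambda>(\<xi>, \<eta>). (override_on \<xi> \<eta> T, override_on \<eta> \<xi> T :: nat \<Rightarrow> nat))"
  have ss: "s (s z) = z" for z
    by (cases z) (auto simp: s_def override_on_def fun_eq_iff)
  have sX: "s z \<in> X \<times> X" if "z \<in> X \<times> X" for z
    using that by (auto simp: s_def override_in_X)
  have w: "pw (override_on \<xi> \<eta> T) * pw (override_on \<eta> \<xi> T) = pw \<xi> * pw \<eta>" for \<xi> \<eta>
    unfolding pw_def prod.distrib [symmetric] by (intro prod.cong) (auto simp: override_on_def)
  define h where "h = (\<lambda>(\<xi>, \<eta>). (pw \<xi> * pw \<eta>) *\<^sub>R g \<xi> \<eta>)"
  have "Ex (\<lambda>\<xi>. Ex (\<lambda>\<eta>. g (override_on \<xi> \<eta> T) (override_on \<eta> \<xi> T)))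
      = (\<Sum>z\<in>X\<times>X. h (s z))"
    unfolding Ex_def scaleR_sum_right sum.cartesian_product
    by (intro sum.cong) (auto simp: h_def s_def w)
  also have "\<dots> = (\<Sum>z\<in>X\<times>X. h z)"
    by (rule sum.reindex_bij_witness [where i = s and j = s]) (use ss sX in auto)
  also have "\<dots> = Ex (\<lambda>\<xi>. Ex (\<lambda>\<eta>. g \<xi> \<eta>))"
    unfolding Ex_def scaleR_sum_right sum.cartesian_product
    by (intro sum.cong) (auto simp: h_def)
  finally show ?thesis .
qed

lemma Ex_avg_adjoint:
  "Ex (\<lambda>\<xi>. u \<xi> *\<^sub>R avg T f \<xi>) = Ex (\<lambda>\<xi>. avg T u \<xi> *\<^sub>R f \<xi>)"
proof -
  have "override_on (override_on \<xi> \<eta> T) (override_on \<eta> \<xi> T) T = \<xi>" for \<xi> \<eta> :: "nat \<Rightarrow> nat"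
    by (auto simp: override_on_def)
  then show ?thesis
    using Ex_swap [of "\<lambda>\<xi> \<eta>. u (override_on \<xi> \<eta> T) *\<^sub>R f \<xi>" T]
    by (simp add: avg_def Ex_scaleR Ex_scaleR_left)
qed

lemma avg_add: "avg T (\<lambda>\<xi>. f \<xi> + g \<xi>) \<xi> = avg T f \<xi> + avg T g \<xi>"
  and avg_diff: "avg T (\<lambda>\<xi>. f \<xi> - g \<xi>) \<xi> = avg T f \<xi> - avg T g \<xi>"
  and avg_scaleR: "avg T (\<lambda>\<xi>. c *\<^sub>R f \<xi>) \<xi> = c *\<^sub>R avg T f \<xi>"
  and avg_const [simp]: "avg T (\<lambda>\<xi>. v) \<xi> = v"
  and avg_sum: "avg T (\<lambda>\<xi>. \<Sum>k\<in>A. F k \<xi>) \<xi> = (\<Sum>k\<in>A. avg T (F k) \<xi>)"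
  unfolding avg_def by (simp_all add: Ex_add Ex_diff Ex_scaleR Ex_sum)

lemma avg_cong:
  "\<xi> \<in> X \<Longrightarrow> (\<And>\<xi>. \<xi> \<in> X \<Longrightarrow> f \<xi> = g \<xi>) \<Longrightarrow> avg T f \<xi> = avg T g \<xi>"
  unfolding avg_def by (intro Ex_cong) (simp add: override_in_X)

lemma avg_mono:
  "\<xi> \<in> X \<Longrightarrow> (\<And>\<xi>. \<xi> \<in> X \<Longrightarrow> f \<xi> \<le> (g \<xi> :: real)) \<Longrightarrow> avg T f \<xi> \<le> avg T g \<xi>"
  unfolding avg_def by (intro Ex_mono) (simp add: override_in_X)

lemma Ex_avg: "Ex (avg T f) = Ex f"
  using Ex_avg_adjoint [of "\<lambda>_. 1" T f] by simp

lemma avg_avg: "avg S (avg T f) \<xi> = avg (S \<union> T) f \<xi>"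
proof -
  have "override_on (override_on \<xi> \<eta> S) \<zeta> T = override_on \<xi> (override_on \<eta> \<zeta> T) (S \<union> T)"
    for \<eta> \<zeta> :: "nat \<Rightarrow> nat"
    by (auto simp: override_on_def)
  then have "avg S (avg T f) \<xi> = Ex (avg T (\<lambda>\<eta>. f (override_on \<xi> \<eta> (S \<union> T))))"
    by (simp add: avg_def [abs_def])
  then show ?thesis unfolding Ex_avg by (simp add: avg_def)
qed

lemma indepD: "indep T f \<Longrightarrow> \<xi> \<in> X \<Longrightarrow> \<eta> \<in> X \<Longrightarrow> f (override_on \<xi> \<eta> T) = f \<xi>"
  by (simp add: indep_def)

lemma indep_subset: "indep T f \<Longrightarrow> S \<subseteq> T \<Longrightarrow> indep S f"
  unfolding indep_def
proof (intro ballI)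
  fix \<xi> \<eta> assume *: "\<forall>\<xi>\<in>X. \<forall>\<eta>\<in>X. f (override_on \<xi> \<eta> T) = f \<xi>" "S \<subseteq> T" "\<xi> \<in> X" "\<eta> \<in> X"
  have "override_on \<xi> (override_on \<xi> \<eta> S) T = override_on \<xi> \<eta> S"
    using \<open>S \<subseteq> T\<close> by (auto simp: override_on_def fun_eq_iff)
  then show "f (override_on \<xi> \<eta> S) = f \<xi>"
    using * override_in_X by metis
qed

lemma indep_avg: "indep T (avg T f)"
  unfolding indep_def avg_def
  by (auto intro!: Ex_cong arg_cong [where f = f] simp: override_on_def)

lemma avg_indep: "indep T f \<Longrightarrow> \<xi> \<in> X \<Longrightarrow> avg T f \<xi> = f \<xi>"
  unfolding avg_def
  using Ex_cong [of "\<lambda>\<eta>. f (override_on \<xi> \<eta> T)" "\<lambda>_. f \<xi>"] by (simp add: indepD)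

lemma avg_scaleR_indep_right:
  assumes "indep T f" "\<xi> \<in> X"
  shows "avg T (\<lambda>\<xi>. c \<xi> *\<^sub>R f \<xi>) \<xi> = avg T c \<xi> *\<^sub>R f \<xi>"
  unfolding avg_def Ex_scaleR_left [symmetric] using assms by (intro Ex_cong) (simp add: indepD)

lemma avg_inner_indep:
  assumes "indep T f" "\<xi> \<in> X"
  shows "avg T (\<lambda>\<xi>. inner (f \<xi>) (g \<xi>)) \<xi> = inner (f \<xi>) (avg T g \<xi>)"
  unfolding avg_def Ex_inner_left [symmetric] using assms by (intro Ex_cong) (simp add: indepD)

lemma avg_empty [simp]: "avg {} f \<xi> = f \<xi>"
  by (simp add: avg_def)

lemma Ex_coord:
  fixes h :: "nat \<Rightarrow> 'v::real_vector"
  assumes "k < n"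
  shows "Ex (\<lambda>\<xi>. h (\<xi> k)) = (\<Sum>y\<in>Q. p y *\<^sub>R h y)"
proof -
  have m: "(\<Sum>\<xi>\<in>X. pw \<xi> * (if \<xi> k = y then 1 else 0)) = p y" if "y \<in> Q" for y
  proof -
    define g where "g = (\<lambda>i c. if i = k then (if c = y then p c else 0) else p c)"
    have "(\<Sum>\<xi>\<in>X. pw \<xi> * (if \<xi> k = y then 1 else 0)) = (\<Sum>\<xi>\<in>X. \<Prod>i<n. g i (\<xi> i))"
    proof (intro sum.cong refl)
      fix \<xi>
      have "(\<Prod>i<n. g i (\<xi> i)) = (\<Prod>i<n. p (\<xi> i) * (if i = k then (if \<xi> k = y then 1 else 0) else 1))"
        by (intro prod.cong) (auto simp: g_def)
      also have "\<dots> = pw \<xi> * (if \<xi> k = y then 1 else 0)"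
        using assms by (simp add: prod.distrib pw_def prod.delta)
      finally show "pw \<xi> * (if \<xi> k = y then 1 else 0) = (\<Prod>i<n. g i (\<xi> i))" by simp
    qed
    also have "\<dots> = (\<Prod>i<n. \<Sum>c\<in>Q. g i c)"
      unfolding X_def by (rule prod_sum_PiE [symmetric]) (auto simp: finite_Q)
    also have "\<dots> = (\<Prod>i<n. if i = k then p y else 1)"
      using that finite_Q by (intro prod.cong) (auto simp: g_def p_sum sum.delta)
    also have "\<dots> = p y" using assms by (simp add: prod.delta)
    finally show ?thesis .
  qed
  have "(\<Sum>y\<in>Q. p y *\<^sub>R h y) = (\<Sum>y\<in>Q. \<Sum>\<xi>\<in>X. (pw \<xi> * (if \<xi> k = y then 1 else 0)) *\<^sub>R h y)"
    by (intro sum.cong refl) (simp flip: scaleR_sum_left add: m)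
  also have "\<dots> = (\<Sum>\<xi>\<in>X. \<Sum>y\<in>Q. (pw \<xi> * (if \<xi> k = y then 1 else 0)) *\<^sub>R h y)"
    by (rule sum.swap)
  also have "\<dots> = (\<Sum>\<xi>\<in>X. pw \<xi> *\<^sub>R h (\<xi> k))"
  proof (intro sum.cong refl)
    fix \<xi> assume "\<xi> \<in> X"
    then have "\<xi> k \<in> Q" using assms by (auto simp: X_def PiE_iff)
    have "(\<Sum>y\<in>Q. (pw \<xi> * (if \<xi> k = y then 1 else 0)) *\<^sub>R h y)
        = (\<Sum>y\<in>Q. if y = \<xi> k then pw \<xi> *\<^sub>R h y else 0)"
      by (intro sum.cong) auto
    then show "(\<Sum>y\<in>Q. (pw \<xi> * (if \<xi> k = y then 1 else 0)) *\<^sub>R h y) = pw \<xi> *\<^sub>R h (\<xi> k)"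
      using \<open>\<xi> k \<in> Q\<close> finite_Q by simp
  qed
  finally show ?thesis by (simp add: Ex_def)
qed

lemma avg_singleton:
  assumes "k < n"
  shows "avg {k} f \<xi> = (\<Sum>y\<in>Q. p y *\<^sub>R f (\<xi>(k := y)))"
proof -
  have "override_on \<xi> \<eta> {k} = \<xi>(k := \<eta> k)" for \<eta> :: "nat \<Rightarrow> nat"
    by (auto simp: override_on_def)
  then show ?thesis using Ex_coord [OF assms, of "\<lambda>y. f (\<xi>(k := y))"]
    by (simp add: avg_def)
qed

lemma upd_in_X: "\<xi> \<in> X \<Longrightarrow> k < n \<Longrightarrow> y \<in> Q \<Longrightarrow> \<xi>(k := y) \<in> X"
  unfolding X_def by (auto simp: PiE_iff extensional_def)

lemma coord_in_Q: "\<xi> \<in> X \<Longrightarrow> k < n \<Longrightarrow> \<xi> k \<in> Q"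
  unfolding X_def by (auto simp: PiE_iff)

lemma indep_upd: 
  assumes "indep T f" "k \<in> T" "\<xi> \<in> X" "k < n" "y \<in> Q"
  shows "f (\<xi>(k := y)) = f \<xi>"
proof -
  have "override_on \<xi> (\<xi>(k := y)) T = \<xi>(k := y)"
    using assms by (auto simp: override_on_def)
  then show ?thesis using assms indepD upd_in_X by metis
qed

end

section \<open>Quadratic constraints\<close>

text \<open>
  A pointwise bound and an \<open>L\<^sup>2\<close> bound on a function of \<open>\<theta>\<close> are both of the form \<open>energy \<Theta> a u \<le> \<beta>\<close>, for
  suitable weights \<open>a\<close>. There are many pointwise constraints, but an index \<open>\<theta>\<close> takes part in boundedly
  many constraints; only this overlap \<open>K\<close> enters the constants.
\<close>

definition energy :: "nat set \<Rightarrow> (nat \<Rightarrow> real) \<Rightarrow> (nat \<Rightarrow> 'v::real_normed_vector) \<Rightarrow> real" where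
  "energy \<Theta> a u = (\<Sum>\<theta>\<in>\<Theta>. a \<theta> * (norm (u \<theta>))\<^sup>2)"

definition constraints :: "nat set \<Rightarrow> (nat \<Rightarrow> real) set \<Rightarrow> nat \<Rightarrow> bool" where
  "constraints \<Theta> A K \<longleftrightarrow> finite \<Theta> \<and> finite A \<and> (\<forall>a\<in>A. \<forall>\<theta>\<in>\<Theta>. 0 \<le> a \<theta>) \<and>
     (\<forall>\<theta>\<in>\<Theta>. card {a \<in> A. 0 < a \<theta>} \<le> K)"

lemma energy_cong: "(\<And>\<theta>. \<theta> \<in> \<Theta> \<Longrightarrow> u \<theta> = v \<theta>) \<Longrightarrow> energy \<Theta> a u = energy \<Theta> a v"
  unfolding energy_def by (intro sum.cong) auto

lemma energy_nonneg: "(\<And>\<theta>. \<theta> \<in> \<Theta> \<Longrightarrow> 0 \<le> a \<theta>) \<Longrightarrow> 0 \<le> energy \<Theta> a u"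
  unfolding energy_def by (intro sum_nonneg) auto

lemma energy_scaleR: "energy \<Theta> a (\<lambda>\<theta>. c *\<^sub>R u \<theta>) = c\<^sup>2 * energy \<Theta> a u"
  unfolding energy_def sum_distrib_left by (intro sum.cong) (auto simp: power_mult_distrib)

lemma norm_diff_square_le:
  fixes x y :: "'v::real_inner"
  shows "(norm (x + y))\<^sup>2 \<le> 2 * (norm x)\<^sup>2 + 2 * (norm y)\<^sup>2"
    and "(norm (x - y))\<^sup>2 \<le> 2 * (norm x)\<^sup>2 + 2 * (norm y)\<^sup>2"
proof -
  have *: "(norm (x + y))\<^sup>2 + (norm (x - y))\<^sup>2 = 2 * (norm x)\<^sup>2 + 2 * (norm y)\<^sup>2"
    unfolding power2_norm_eq_inner
    by (simp add: inner_add_left inner_add_right inner_diff_left inner_diff_right inner_commute)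
  show "(norm (x + y))\<^sup>2 \<le> 2 * (norm x)\<^sup>2 + 2 * (norm y)\<^sup>2"
    using * zero_le_power2 [of "norm (x - y)"] by linarith
  show "(norm (x - y))\<^sup>2 \<le> 2 * (norm x)\<^sup>2 + 2 * (norm y)\<^sup>2"
    using * zero_le_power2 [of "norm (x + y)"] by linarith
qed

lemma energy_add_le:
  fixes u v :: "nat \<Rightarrow> 'v::real_inner"
  assumes "\<And>\<theta>. \<theta> \<in> \<Theta> \<Longrightarrow> 0 \<le> a \<theta>"
  shows "energy \<Theta> a (\<lambda>\<theta>. u \<theta> + v \<theta>) \<le> 2 * energy \<Theta> a u + 2 * energy \<Theta> a v"
    and "energy \<Theta> a (\<lambda>\<theta>. u \<theta> - v \<theta>) \<le> 2 * energy \<Theta> a u + 2 * energy \<Theta> a v"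
proof -
  have "2 * energy \<Theta> a u + 2 * energy \<Theta> a v
      = (\<Sum>\<theta>\<in>\<Theta>. a \<theta> * (2 * (norm (u \<theta>))\<^sup>2 + 2 * (norm (v \<theta>))\<^sup>2))"
    unfolding energy_def sum_distrib_left sum.distrib [symmetric]
    by (intro sum.cong) (auto simp: algebra_simps)
  then show "energy \<Theta> a (\<lambda>\<theta>. u \<theta> + v \<theta>) \<le> 2 * energy \<Theta> a u + 2 * energy \<Theta> a v"
    and "energy \<Theta> a (\<lambda>\<theta>. u \<theta> - v \<theta>) \<le> 2 * energy \<Theta> a u + 2 * energy \<Theta> a v"
    unfolding energy_def
    by (auto intro!: sum_mono mult_left_mono norm_diff_square_le simp: assms)
qed

context finite_power
begin

lemma p_nonneg: "y \<in> Q \<Longrightarrow> 0 \<le> p y"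
  using p_pos by (simp add: less_imp_le)

lemma energy_Ex_le:
  fixes f :: "(nat \<Rightarrow> nat) \<Rightarrow> nat \<Rightarrow> 'v::real_inner"
  assumes "\<And>\<theta>. \<theta> \<in> \<Theta> \<Longrightarrow> 0 \<le> a \<theta>"
  shows "energy \<Theta> a (\<lambda>\<theta>. Ex (\<lambda>\<xi>. f \<xi> \<theta>)) \<le> Ex (\<lambda>\<xi>. energy \<Theta> a (f \<xi>))"
  unfolding energy_def Ex_sum Ex_mult_left
  by (intro sum_mono mult_left_mono norm_Ex_square_le assms)

lemma energy_avg_le:
  fixes f :: "(nat \<Rightarrow> nat) \<Rightarrow> nat \<Rightarrow> 'v::real_inner"
  assumes "\<And>\<theta>. \<theta> \<in> \<Theta> \<Longrightarrow> 0 \<le> a \<theta>"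
  shows "energy \<Theta> a (\<lambda>\<theta>. avg T (\<lambda>\<xi>. f \<xi> \<theta>) \<xi>) \<le> avg T (\<lambda>\<xi>. energy \<Theta> a (f \<xi>)) \<xi>"
  unfolding avg_def by (rule energy_Ex_le) (rule assms)

lemma energy_avg_le_const:
  fixes f :: "(nat \<Rightarrow> nat) \<Rightarrow> nat \<Rightarrow> 'v::real_inner"
  assumes "\<And>\<theta>. \<theta> \<in> \<Theta> \<Longrightarrow> 0 \<le> a \<theta>" "\<And>\<xi>. \<xi> \<in> X \<Longrightarrow> energy \<Theta> a (f \<xi>) \<le> b" "\<xi> \<in> X"
  shows "energy \<Theta> a (\<lambda>\<theta>. avg T (\<lambda>\<xi>. f \<xi> \<theta>) \<xi>) \<le> b"
proof -
  have "energy \<Theta> a (\<lambda>\<theta>. avg T (\<lambda>\<xi>. f \<xi> \<theta>) \<xi>) \<le> avg T (\<lambda>\<xi>. energy \<Theta> a (f \<xi>)) \<xi>"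
    by (rule energy_avg_le) (rule assms)
  also have "\<dots> \<le> avg T (\<lambda>\<xi>. b) \<xi>"
    using assms by (intro avg_mono) auto
  finally show ?thesis by simp
qed

lemma energy_convex_sum_le:
  fixes u :: "nat \<Rightarrow> nat \<Rightarrow> 'v::real_inner"
  assumes "\<And>\<theta>. \<theta> \<in> \<Theta> \<Longrightarrow> 0 \<le> a \<theta>"
  shows "energy \<Theta> a (\<lambda>\<theta>. \<Sum>y\<in>Q. p y *\<^sub>R u y \<theta>) \<le> (\<Sum>y\<in>Q. p y * energy \<Theta> a (u y))"
proof -
  have *: "(norm (\<Sum>y\<in>Q. p y *\<^sub>R x y))\<^sup>2 \<le> (\<Sum>y\<in>Q. p y * (norm (x y))\<^sup>2)" for x :: "nat \<Rightarrow> 'v"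
  proof -
    interpret one: finite_power 1 Q p
      by unfold_locales (auto simp: finite_Q p_pos p_sum)
    show ?thesis
      using one.norm_Ex_square_le [of "\<lambda>\<xi>. x (\<xi> 0)"]
        one.Ex_coord [of 0 x] one.Ex_coord [of 0 "\<lambda>y. (norm (x y))\<^sup>2"] by simp
  qed
  have "energy \<Theta> a (\<lambda>\<theta>. \<Sum>y\<in>Q. p y *\<^sub>R u y \<theta>)
      \<le> (\<Sum>\<theta>\<in>\<Theta>. a \<theta> * (\<Sum>y\<in>Q. p y * (norm (u y \<theta>))\<^sup>2))"
    unfolding energy_def by (intro sum_mono mult_left_mono * assms)
  also have "\<dots> = (\<Sum>y\<in>Q. p y * energy \<Theta> a (u y))"
    unfolding energy_def sum_distrib_left
    by (subst sum.swap) (intro sum.cong refl, auto simp: algebra_simps)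
  finally show ?thesis .
qed

section \<open>Bessel's inequality for the increments of a block\<close>

lemma avg_absorb:
  assumes "S \<subseteq> T" "\<xi> \<in> X"
  shows "avg T f \<xi> = avg T (avg S f) \<xi>"
  using assms by (simp add: avg_avg Un_absorb2)

lemma avg_eq_0:
  assumes "S \<subseteq> T" "\<xi> \<in> X" "\<And>\<zeta>. \<zeta> \<in> X \<Longrightarrow> avg S f \<zeta> = 0"
  shows "avg T f \<xi> = 0"
  using assms avg_absorb [of S T \<xi> f] avg_cong [of \<xi> "avg S f" "\<lambda>_. 0" T] by simp

lemma avg_indep_absorb:
  assumes "indep S f" "\<xi> \<in> X"
  shows "avg T f \<xi> = avg (T \<union> S) f \<xi>"
  using assms avg_avg [of T S f \<xi>] avg_cong [of \<xi> "avg S f" f T] avg_indep [of S f] by auto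

lemma indep_upd_avg: "k < n \<Longrightarrow> k \<in> T \<Longrightarrow> y \<in> Q \<Longrightarrow> \<xi> \<in> X \<Longrightarrow> avg T f (\<xi>(k := y)) = avg T f \<xi>"
  by (rule indep_upd [OF indep_avg])

text \<open>
  Given the coordinates outside \<open>I\<close>, the increments for different \<open>j\<close> are orthogonal to each other, and
  \<open>f\<close> pairs with each of them as that increment pairs with itself.
\<close>

lemma bessel_increments:
  fixes f :: "(nat \<Rightarrow> nat) \<Rightarrow> 'v::real_inner"
  assumes I: "I \<subseteq> {..<n}" and \<xi>: "\<xi> \<in> X"
  shows "(\<Sum>j\<in>I. \<Sum>y\<in>Q. p y * (norm (avg (I - {j}) f (\<xi>(j := y)) - avg I f \<xi>))\<^sup>2)
    \<le> avg I (\<lambda>\<xi>. (norm (f \<xi>))\<^sup>2) \<xi>"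
proof -
  have fI: "finite I" using I finite_subset by blast
  define d where "d = (\<lambda>j \<xi>. avg (I - {j}) f \<xi> - avg I f \<xi>)"
  have avg_j_d: "avg {j} (d j) \<zeta> = 0" if "j \<in> I" "\<zeta> \<in> X" for j \<zeta>
    using that by (simp add: d_def avg_diff avg_avg insert_absorb)
  have ind_d: "indep (I - {j}) (d j)" if "j \<in> I" for j
    unfolding indep_def d_def
    using indepD [OF indep_avg, of _ _ "I - {j}" f]
      indepD [OF indep_subset [OF indep_avg, of "I - {j}" I], of _ _ f] by auto
  have sq: "avg I (\<lambda>\<xi>. inner (d j \<xi>) (d j \<xi>)) \<xi>
      = (\<Sum>y\<in>Q. p y * (norm (avg (I - {j}) f (\<xi>(j := y)) - avg I f \<xi>))\<^sup>2)" if j: "j \<in> I" for j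
  proof -
    have "avg {j} (\<lambda>\<xi>. inner (d j \<xi>) (d j \<xi>)) \<xi>
      = (\<Sum>y\<in>Q. p y * (norm (avg (I - {j}) f (\<xi>(j := y)) - avg I f \<xi>))\<^sup>2)"
      using j I \<xi> by (subst avg_singleton) (auto simp: d_def power2_norm_eq_inner indep_upd_avg intro!: sum.cong)
    moreover have "indep (I - {j}) (\<lambda>\<xi>. inner (d j \<xi>) (d j \<xi>))"
      using ind_d [OF j] by (simp add: indep_def)
    then have "avg {j} (\<lambda>\<xi>. inner (d j \<xi>) (d j \<xi>)) \<xi> = avg I (\<lambda>\<xi>. inner (d j \<xi>) (d j \<xi>)) \<xi>"
      using avg_indep_absorb [of "I - {j}" "\<lambda>\<xi>. inner (d j \<xi>) (d j \<xi>)" \<xi> "{j}"] \<xi> j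
      by (simp add: insert_absorb)
    ultimately show ?thesis by simp
  qed
  have cross: "avg I (\<lambda>\<xi>. inner (d j \<xi>) (d k \<xi>)) \<xi> = 0" if "j \<in> I" "k \<in> I" "j \<noteq> k" for j k
  proof -
    have "indep {k} (d j)" using ind_d [of j] that indep_subset by blast
    then have "avg {k} (\<lambda>\<xi>. inner (d j \<xi>) (d k \<xi>)) \<zeta> = 0" if "\<zeta> \<in> X" for \<zeta>
      using avg_inner_indep [of "{k}" "d j" \<zeta> "d k"] avg_j_d \<open>k \<in> I\<close> that by simp
    then show ?thesis
      using avg_eq_0 [of "{k}" I] \<open>k \<in> I\<close> \<xi> by blast
  qed
  have fd: "avg I (\<lambda>\<xi>. inner (d j \<xi>) (f \<xi>)) \<xi> = avg I (\<lambda>\<xi>. inner (d j \<xi>) (d j \<xi>)) \<xi>" if j: "j \<in> I" for j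
  proof -
    have "avg I (\<lambda>\<xi>. inner (d j \<xi>) (f \<xi>)) \<xi>
        = avg I (avg (I - {j}) (\<lambda>\<xi>. inner (d j \<xi>) (f \<xi>))) \<xi>"
      using \<xi> by (intro avg_absorb) auto
    also have "\<dots> = avg I (\<lambda>\<xi>. inner (d j \<xi>) (d j \<xi>) + inner (avg I f \<xi>) (d j \<xi>)) \<xi>"
    proof (rule avg_cong [OF \<xi>])
      fix \<zeta> assume "\<zeta> \<in> X"
      then have "avg (I - {j}) (\<lambda>\<xi>. inner (d j \<xi>) (f \<xi>)) \<zeta> = inner (d j \<zeta>) (avg (I - {j}) f \<zeta>)"
        by (rule avg_inner_indep [OF ind_d [OF j]])
      also have "avg (I - {j}) f \<zeta> = d j \<zeta> + avg I f \<zeta>" by (simp add: d_def)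
      finally show "avg (I - {j}) (\<lambda>\<xi>. inner (d j \<xi>) (f \<xi>)) \<zeta>
          = inner (d j \<zeta>) (d j \<zeta>) + inner (avg I f \<zeta>) (d j \<zeta>)"
        by (simp add: inner_add_right inner_commute)
    qed
    also have "\<dots> = avg I (\<lambda>\<xi>. inner (d j \<xi>) (d j \<xi>)) \<xi> + inner (avg I f \<xi>) (avg I (d j) \<xi>)"
      using \<xi> by (simp add: avg_add avg_inner_indep indep_avg)
    also have "avg I (d j) \<xi> = 0"
      using avg_eq_0 [of "{j}" I] avg_j_d j \<xi> by blast
    finally show ?thesis by simp
  qed
  have "0 \<le> avg I (\<lambda>\<xi>. (norm (f \<xi> - (\<Sum>j\<in>I. d j \<xi>)))\<^sup>2) \<xi>"
    using avg_mono [of \<xi> "\<lambda>_. 0" "\<lambda>\<xi>. (norm (f \<xi> - (\<Sum>j\<in>I. d j \<xi>)))\<^sup>2" I] \<xi> by simp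
  also have "\<dots> = avg I (\<lambda>\<xi>. ((norm (f \<xi>))\<^sup>2 - (2::real) *\<^sub>R (\<Sum>j\<in>I. inner (d j \<xi>) (f \<xi>)))
      + (\<Sum>j\<in>I. \<Sum>k\<in>I. inner (d j \<xi>) (d k \<xi>))) \<xi>"
    using \<xi> by (intro avg_cong) (auto simp: power2_norm_eq_inner inner_diff_left inner_diff_right
        inner_sum_left inner_sum_right inner_commute algebra_simps)
  also have "\<dots> = avg I (\<lambda>\<xi>. (norm (f \<xi>))\<^sup>2) \<xi> - 2 * (\<Sum>j\<in>I. avg I (\<lambda>\<xi>. inner (d j \<xi>) (f \<xi>)) \<xi>)
      + (\<Sum>j\<in>I. \<Sum>k\<in>I. avg I (\<lambda>\<xi>. inner (d j \<xi>) (d k \<xi>)) \<xi>)"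
    unfolding avg_add avg_diff avg_scaleR avg_sum by simp
  also have "(\<Sum>j\<in>I. \<Sum>k\<in>I. avg I (\<lambda>\<xi>. inner (d j \<xi>) (d k \<xi>)) \<xi>)
      = (\<Sum>j\<in>I. \<Sum>k\<in>I. if k = j then avg I (\<lambda>\<xi>. inner (d j \<xi>) (d j \<xi>)) \<xi> else 0)"
    using cross by (intro sum.cong) auto
  also have "\<dots> = (\<Sum>j\<in>I. avg I (\<lambda>\<xi>. inner (d j \<xi>) (d j \<xi>)) \<xi>)"
    using fI by (intro sum.cong) auto
  finally show ?thesis using fd sq by simp
qed

section \<open>The stopped sum\<close>

text \<open>
  The heart of the proof. The sum over \<open>j\<close> of the increments \<open>D j (\<xi> j) \<xi>\<close> has the required averages,
  but it is bounded in square mean only. It is therefore formed coordinate by coordinate, and at an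
  index \<open>\<theta>\<close> nothing more is added once some constraint containing \<open>\<theta>\<close> has been exceeded. This costs
  in the average over the other coordinates only the factor \<open>W\<close>, the probability of not having stopped,
  and the increment is divided by \<open>W\<close> in advance. Chebyshev and the bounded overlap give \<open>W \<ge> 1/2\<close>.
  
  An exceeded constraint freezes on all its indices. So it overshoots by at most one increment, and as
  it stays exceeded, the current value of the sum shows whether \<open>\<theta>\<close> has been stopped.
\<close>

lemma stopped_sum:
  fixes D :: "nat \<Rightarrow> nat \<Rightarrow> (nat \<Rightarrow> nat) \<Rightarrow> nat \<Rightarrow> 'v::real_inner"
  assumes A: "constraints \<Theta> A K" and K: "K \<ge> 1" and \<gamma>: "\<gamma> > 0" and I: "I \<subseteq> {..<n}"
    and ind: "\<And>j y \<theta>. \<lbrakk>j \<in> I; y \<in> Q; \<theta> \<in> \<Theta>\<rbrakk> \<Longrightarrow> indep I (\<lambda>\<xi>. D j y \<xi> \<theta>)"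
    and cent: "\<And>j \<xi> \<theta>. \<lbrakk>j \<in> I; \<xi> \<in> X; \<theta> \<in> \<Theta>\<rbrakk> \<Longrightarrow> (\<Sum>y\<in>Q. p y *\<^sub>R D j y \<xi> \<theta>) = 0"
    and bound_sup: "\<And>a j y \<xi>. \<lbrakk>a \<in> A; j \<in> I; y \<in> Q; \<xi> \<in> X\<rbrakk> \<Longrightarrow> energy \<Theta> a (D j y \<xi>) \<le> \<gamma>"
    and bound_l2: "\<And>a \<xi>. \<lbrakk>a \<in> A; \<xi> \<in> X\<rbrakk> \<Longrightarrow> (\<Sum>j\<in>I. \<Sum>y\<in>Q. p y * energy \<Theta> a (D j y \<xi>)) \<le> \<gamma>"
  shows "\<exists>\<Phi>. (\<forall>k\<in>I. \<forall>\<xi>\<in>X. \<forall>\<theta>\<in>\<Theta>. avg (I - {k}) (\<lambda>\<xi>. \<Phi> \<xi> \<theta>) \<xi> = D k (\<xi> k) \<xi> \<theta>) \<and>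
    (\<forall>a\<in>A. \<forall>\<xi>\<in>X. energy \<Theta> a (\<Phi> \<xi>) \<le> (16 * real K + 8) * \<gamma>)"
proof -
  have fI: "finite I" using I finite_subset by blast
  have a0: "\<And>a \<theta>. a \<in> A \<Longrightarrow> \<theta> \<in> \<Theta> \<Longrightarrow> 0 \<le> a \<theta>" and fA: "finite A" and f\<Theta>: "finite \<Theta>"
    and card_a: "\<And>\<theta>. \<theta> \<in> \<Theta> \<Longrightarrow> card {a \<in> A. 0 < a \<theta>} \<le> K"
    using A by (auto simp: constraints_def)
  have E0: "0 \<le> energy \<Theta> a u" if "a \<in> A" for a and u :: "nat \<Rightarrow> 'v"
    using that a0 energy_nonneg by blast
  \<comment> \<open>Each running constraint has square mean at most \<open>4 * \<gamma>\<close>, as \<open>1 / W \<le> 2\<close>; so this threshold keeps the probability of stopping below \<open>K * (4 * \<gamma>) / R = 1/2\<close>.\<close>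
  define R where "R = 8 * real K * \<gamma>"
  have R: "R > 0" using K \<gamma> by (simp add: R_def)
  define inv where "inv = (\<lambda>j S.
    (\<forall>\<theta>\<in>\<Theta>. indep {i\<in>I. j \<le> i} (\<lambda>\<xi>. S \<xi> \<theta>)) \<and>
    (\<forall>a\<in>A. \<forall>\<xi>\<in>X. energy \<Theta> a (S \<xi>) \<le> (16 * real K + 8) * \<gamma>) \<and>
    (\<forall>a\<in>A. \<forall>\<xi>\<in>X. avg I (\<lambda>\<xi>. energy \<Theta> a (S \<xi>)) \<xi>
        \<le> 4 * (\<Sum>k | k \<in> I \<and> k < j. \<Sum>y\<in>Q. p y * energy \<Theta> a (D k y \<xi>))) \<and>
    (\<forall>k\<in>I. k < j \<longrightarrow> (\<forall>\<xi>\<in>X. \<forall>\<theta>\<in>\<Theta>. avg (I - {k}) (\<lambda>\<xi>. S \<xi> \<theta>) \<xi> = D k (\<xi> k) \<xi> \<theta>)) \<and>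
    (\<forall>\<xi>\<in>X. \<forall>\<theta>\<in>\<Theta>. avg I (\<lambda>\<xi>. S \<xi> \<theta>) \<xi> = 0))"
  have "\<exists>S :: (nat \<Rightarrow> nat) \<Rightarrow> nat \<Rightarrow> 'v. inv j S" for j
  proof (induction j)
    case 0
    have "inv 0 (\<lambda>_ _. 0 :: 'v)"
      unfolding inv_def using \<gamma> by (auto simp: indep_def energy_def)
    then show ?case by blast
  next
    case (Suc j)
    then obtain S :: "(nat \<Rightarrow> nat) \<Rightarrow> nat \<Rightarrow> 'v" where S: "inv j S" by blast
    show ?case
    proof (cases "j \<in> I")
      case False
      then have "k < Suc j \<longleftrightarrow> k < j" if "k \<in> I" for k
        using that by (auto simp: less_Suc_eq)
      moreover from this have "{i\<in>I. Suc j \<le> i} = {i\<in>I. j \<le> i}"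
        "{k. k \<in> I \<and> k < Suc j} = {k. k \<in> I \<and> k < j}"
        by (auto simp: not_less [symmetric])
      ultimately have "inv (Suc j) S" using S unfolding inv_def by simp
      then show ?thesis by blast
    next
      case jI: True
      then have jn: "j < n" using I by auto
      have S_ind: "indep {i\<in>I. j \<le> i} (\<lambda>\<xi>. S \<xi> \<theta>)" if "\<theta> \<in> \<Theta>" for \<theta>
        using S that by (simp add: inv_def)
      have S_bound: "energy \<Theta> a (S \<xi>) \<le> (16 * real K + 8) * \<gamma>" if "a \<in> A" "\<xi> \<in> X" for a \<xi>
        using S that by (simp add: inv_def)
      have S_l2: "avg I (\<lambda>\<xi>. energy \<Theta> a (S \<xi>)) \<xi>
          \<le> 4 * (\<Sum>k | k \<in> I \<and> k < j. \<Sum>y\<in>Q. p y * energy \<Theta> a (D k y \<xi>))"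
        if "a \<in> A" "\<xi> \<in> X" for a \<xi>
        using S that by (simp add: inv_def)
      have S_avg: "avg (I - {k}) (\<lambda>\<xi>. S \<xi> \<theta>) \<xi> = D k (\<xi> k) \<xi> \<theta>"
        if "k \<in> I" "k < j" "\<xi> \<in> X" "\<theta> \<in> \<Theta>" for k \<xi> \<theta>
        using S that by (simp add: inv_def)
      have S_mean: "avg I (\<lambda>\<xi>. S \<xi> \<theta>) \<xi> = 0" if "\<xi> \<in> X" "\<theta> \<in> \<Theta>" for \<xi> \<theta>
        using S that by (simp add: inv_def)
      have ovS: "S (override_on \<xi> \<eta> {i\<in>I. j \<le> i}) \<theta> = S \<xi> \<theta>"
        if "\<xi> \<in> X" "\<eta> \<in> X" "\<theta> \<in> \<Theta>" for \<xi> \<eta> \<theta>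
        using indepD [OF S_ind] that by simp
      \<comment> \<open>The indicator that \<open>\<theta>\<close> is still running after the coordinates below \<open>j\<close>.\<close>
      define w :: "(nat \<Rightarrow> nat) \<Rightarrow> nat \<Rightarrow> real" where
        "w = (\<lambda>\<xi> \<theta>. if \<forall>a\<in>A. 0 < a \<theta> \<longrightarrow> energy \<Theta> a (S \<xi>) \<le> R then 1 else 0)"
      define W where "W = (\<lambda>\<xi> \<theta>. avg I (\<lambda>\<xi>. w \<xi> \<theta>) \<xi>)"
      define inc where "inc = (\<lambda>\<xi> \<theta>. (w \<xi> \<theta> / W \<xi> \<theta>) *\<^sub>R D j (\<xi> j) \<xi> \<theta>)"
      have w_ind: "indep {i\<in>I. j \<le> i} (\<lambda>\<xi>. w \<xi> \<theta>)" for \<theta>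
      proof -
        have "energy \<Theta> a (S (override_on \<xi> \<eta> {i\<in>I. j \<le> i})) = energy \<Theta> a (S \<xi>)"
          if "\<xi> \<in> X" "\<eta> \<in> X" for a \<xi> \<eta>
          using that ovS by (intro energy_cong) auto
        then show ?thesis unfolding indep_def w_def by simp
      qed
      have W_ind: "indep I (\<lambda>\<xi>. W \<xi> \<theta>)" for \<theta>
        unfolding W_def by (rule indep_avg)
      have w01: "0 \<le> w \<xi> \<theta>" "w \<xi> \<theta> \<le> 1" for \<xi> \<theta> by (auto simp: w_def)
      have W_half: "1 / 2 \<le> W \<xi> \<theta>" if "\<xi> \<in> X" "\<theta> \<in> \<Theta>" for \<xi> \<theta>
      proof -
        let ?A = "{a\<in>A. 0 < a \<theta>}"
        have "1 - w \<zeta> \<theta> \<le> (1 / R) *\<^sub>R (\<Sum>a\<in>?A. energy \<Theta> a (S \<zeta>))" for \<zeta>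
        proof (cases "w \<zeta> \<theta> = 1")
          case True then show ?thesis using R E0 by (auto intro!: sum_nonneg divide_nonneg_pos)
        next
          case False
          then obtain a where a: "a \<in> ?A" "R < energy \<Theta> a (S \<zeta>)" unfolding w_def
            by (metis (mono_tags, lifting) linorder_not_le mem_Collect_eq)
          have "R \<le> (\<Sum>a\<in>?A. energy \<Theta> a (S \<zeta>))"
            using a member_le_sum [of a ?A "\<lambda>a. energy \<Theta> a (S \<zeta>)"] E0 fA by auto
          then have "1 \<le> (1 / R) *\<^sub>R (\<Sum>a\<in>?A. energy \<Theta> a (S \<zeta>))" using R by (simp add: field_simps)
          then show ?thesis using w01(1) [of \<zeta> \<theta>] by simp
        qed
        then have "avg I (\<lambda>\<xi>. 1 - w \<xi> \<theta>) \<xi> \<le> avg I (\<lambda>\<xi>. (1 / R) *\<^sub>R (\<Sum>a\<in>?A. energy \<Theta> a (S \<xi>))) \<xi>"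
          using that by (intro avg_mono) auto
        also have "\<dots> = (1 / R) * (\<Sum>a\<in>?A. avg I (\<lambda>\<xi>. energy \<Theta> a (S \<xi>)) \<xi>)"
          unfolding avg_scaleR avg_sum by simp
        also have "\<dots> \<le> (1 / R) * (\<Sum>a\<in>?A. 4 * \<gamma>)"
        proof (intro mult_left_mono sum_mono)
          fix a assume a: "a \<in> ?A"
          have "(\<Sum>k | k \<in> I \<and> k < j. \<Sum>y\<in>Q. p y * energy \<Theta> a (D k y \<xi>))
              \<le> (\<Sum>k\<in>I. \<Sum>y\<in>Q. p y * energy \<Theta> a (D k y \<xi>))"
            using a fI E0 p_nonneg by (intro sum_mono2) (auto intro!: sum_nonneg mult_nonneg_nonneg)
          then show "avg I (\<lambda>\<xi>. energy \<Theta> a (S \<xi>)) \<xi> \<le> 4 * \<gamma>"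
            using S_l2 [of a \<xi>] bound_l2 [of a \<xi>] a that by auto
        qed (use R in auto)
        also have "\<dots> = (1 / R) * (real (card ?A) * (4 * \<gamma>))" by simp
        also have "\<dots> \<le> (1 / R) * (real K * (4 * \<gamma>))"
          using R \<gamma> card_a [OF that(2)] by (intro mult_left_mono mult_right_mono) auto
        also have "\<dots> = 1 / 2" using K \<gamma> by (simp add: R_def)
        finally show ?thesis by (simp add: avg_diff W_def)
      qed
      have Dov: "D j y (override_on \<xi> \<eta> T) \<theta> = D j y \<xi> \<theta>"
        if "\<xi> \<in> X" "\<eta> \<in> X" "T \<subseteq> I" "y \<in> Q" "\<theta> \<in> \<Theta>" for y \<xi> \<eta> T \<theta>
        using indepD [OF indep_subset [OF ind [OF jI \<open>y \<in> Q\<close> \<open>\<theta> \<in> \<Theta>\<close>] \<open>T \<subseteq> I\<close>]] that by simp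
      have Dupd: "D j y (\<xi>(j := z)) \<theta> = D j y \<xi> \<theta>"
        if "\<xi> \<in> X" "z \<in> Q" "y \<in> Q" "\<theta> \<in> \<Theta>" for y z \<xi> \<theta>
        using indep_upd [OF ind [OF jI \<open>y \<in> Q\<close> \<open>\<theta> \<in> \<Theta>\<close>] jI _ jn] that by simp
      have wupd: "w (\<xi>(j := z)) \<theta> = w \<xi> \<theta>" if "\<xi> \<in> X" "z \<in> Q" for z \<xi> \<theta>
        using indep_upd [OF w_ind, of j] that jI jn by simp
      have Wupd: "W (\<xi>(j := z)) \<theta> = W \<xi> \<theta>" if "\<xi> \<in> X" "z \<in> Q" for z \<xi> \<theta>
        using indep_upd [OF W_ind, of j] that jI jn by simp
      \<comment> \<open>Neither weight depends on the coordinate \<open>j\<close>, and \<open>D j\<close> is centred in it.\<close>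
      have inc_mean_j: "avg {j} (\<lambda>\<xi>. inc \<xi> \<theta>) \<xi> = 0" if "\<xi> \<in> X" "\<theta> \<in> \<Theta>" for \<xi> \<theta>
      proof -
        have "avg {j} (\<lambda>\<xi>. inc \<xi> \<theta>) \<xi> = (\<Sum>y\<in>Q. p y *\<^sub>R (w \<xi> \<theta> / W \<xi> \<theta>) *\<^sub>R D j y \<xi> \<theta>)"
          using that by (simp add: avg_singleton [OF jn] inc_def Dupd wupd Wupd)
        also have "\<dots> = (w \<xi> \<theta> / W \<xi> \<theta>) *\<^sub>R (\<Sum>y\<in>Q. p y *\<^sub>R D j y \<xi> \<theta>)"
          by (simp add: scaleR_sum_right mult.commute)
        finally show ?thesis using cent jI that by simp
      qed
      have inc_mean: "avg T (\<lambda>\<xi>. inc \<xi> \<theta>) \<xi> = 0" if "\<xi> \<in> X" "\<theta> \<in> \<Theta>" "j \<in> T" for \<xi> \<theta> T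
        using avg_eq_0 [of "{j}" T] inc_mean_j that by blast
      have inc_energy: "energy \<Theta> a (inc \<xi>) \<le> 4 * energy \<Theta> a (D j (\<xi> j) \<xi>)"
        if "a \<in> A" "\<xi> \<in> X" for a \<xi>
      proof -
        have "(norm (inc \<xi> \<theta>))\<^sup>2 \<le> 4 * (norm (D j (\<xi> j) \<xi> \<theta>))\<^sup>2" if \<theta>: "\<theta> \<in> \<Theta>" for \<theta>
        proof -
          have "0 \<le> w \<xi> \<theta> / W \<xi> \<theta>" "w \<xi> \<theta> / W \<xi> \<theta> \<le> 2"
            using W_half [OF \<open>\<xi> \<in> X\<close> \<theta>] w01 [of \<xi> \<theta>] by (auto simp: divide_simps)
          then have "(w \<xi> \<theta> / W \<xi> \<theta>)\<^sup>2 \<le> 2\<^sup>2" by (intro power_mono)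
          then have "(w \<xi> \<theta> / W \<xi> \<theta>)\<^sup>2 * (norm (D j (\<xi> j) \<xi> \<theta>))\<^sup>2 \<le> 4 * (norm (D j (\<xi> j) \<xi> \<theta>))\<^sup>2"
            by (intro mult_right_mono) auto
          moreover have "(norm (inc \<xi> \<theta>))\<^sup>2 = (w \<xi> \<theta> / W \<xi> \<theta>)\<^sup>2 * (norm (D j (\<xi> j) \<xi> \<theta>))\<^sup>2"
            by (simp only: inc_def norm_scaleR power_mult_distrib power2_abs)
          ultimately show ?thesis by simp
        qed
        then have "a \<theta> * (norm (inc \<xi> \<theta>))\<^sup>2 \<le> 4 * (a \<theta> * (norm (D j (\<xi> j) \<xi> \<theta>))\<^sup>2)"
          if "\<theta> \<in> \<Theta>" for \<theta>
          using mult_left_mono [of _ _ "a \<theta>"] a0 \<open>a \<in> A\<close> that by fastforce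
        then show ?thesis unfolding energy_def sum_distrib_left by (intro sum_mono) auto
      qed
      define S' where "S' = (\<lambda>\<xi> \<theta>. S \<xi> \<theta> + inc \<xi> \<theta>)"
      have 1: "indep {i\<in>I. Suc j \<le> i} (\<lambda>\<xi>. S' \<xi> \<theta>)" if "\<theta> \<in> \<Theta>" for \<theta>
      proof -
        let ?T = "{i\<in>I. Suc j \<le> i}"
        have T: "?T \<subseteq> {i\<in>I. j \<le> i}" "?T \<subseteq> I" "j \<notin> ?T" by auto
        have "S (override_on \<xi> \<eta> ?T) \<theta> = S \<xi> \<theta>" "w (override_on \<xi> \<eta> ?T) \<theta> = w \<xi> \<theta>"
          "W (override_on \<xi> \<eta> ?T) \<theta> = W \<xi> \<theta>"
          "D j (\<xi> j) (override_on \<xi> \<eta> ?T) \<theta> = D j (\<xi> j) \<xi> \<theta>" "override_on \<xi> \<eta> ?T j = \<xi> j"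
          if "\<xi> \<in> X" "\<eta> \<in> X" for \<xi> \<eta>
          using indepD [OF indep_subset [OF S_ind T(1)]] indepD [OF indep_subset [OF w_ind T(1)]]
            indepD [OF indep_subset [OF W_ind T(2)]] Dov [OF _ _ T(2)] that \<open>\<theta> \<in> \<Theta>\<close>
            coord_in_Q [OF _ jn] T(3) by auto
        then show ?thesis unfolding indep_def S'_def inc_def by auto
      qed
      have 2: "energy \<Theta> a (S' \<xi>) \<le> (16 * real K + 8) * \<gamma>" if "a \<in> A" "\<xi> \<in> X" for a \<xi>
      \<comment> \<open>One increment may overshoot the threshold; beyond it the constraint is frozen.\<close>
      proof (cases "energy \<Theta> a (S \<xi>) \<le> R")
        case True
        have "energy \<Theta> a (S' \<xi>) \<le> 2 * energy \<Theta> a (S \<xi>) + 2 * energy \<Theta> a (inc \<xi>)"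
          unfolding S'_def using a0 that by (intro energy_add_le) auto
        also have "\<dots> \<le> 2 * R + 2 * (4 * \<gamma>)"
          using True inc_energy [OF that] bound_sup [OF that(1) jI coord_in_Q [OF that(2) jn] that(2)] by linarith
        finally show ?thesis by (simp add: R_def algebra_simps)
      next
        case False
        have "a \<theta> * (norm (S' \<xi> \<theta>))\<^sup>2 = a \<theta> * (norm (S \<xi> \<theta>))\<^sup>2" if "\<theta> \<in> \<Theta>" for \<theta>
        proof (cases "0 < a \<theta>")
          case True
          then have "w \<xi> \<theta> = 0" using False \<open>a \<in> A\<close> by (auto simp: w_def)
          then show ?thesis by (simp add: S'_def inc_def)
        next
          case False
          then have "a \<theta> = 0" using a0 \<open>a \<in> A\<close> that by force
          then show ?thesis by simp
        qed
        then have "energy \<Theta> a (S' \<xi>) = energy \<Theta> a (S \<xi>)"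
          unfolding energy_def by (intro sum.cong) auto
        then show ?thesis using S_bound that by simp
      qed
      have 3: "avg I (\<lambda>\<xi>. energy \<Theta> a (S' \<xi>)) \<xi>
          \<le> 4 * (\<Sum>k | k \<in> I \<and> k < Suc j. \<Sum>y\<in>Q. p y * energy \<Theta> a (D k y \<xi>))"
        if a: "a \<in> A" and \<xi>: "\<xi> \<in> X" for a \<xi>
      proof -
        have "energy \<Theta> a (S' \<zeta>) = energy \<Theta> a (S \<zeta>)
            + (2::real) *\<^sub>R (\<Sum>\<theta>\<in>\<Theta>. a \<theta> *\<^sub>R inner (S \<zeta> \<theta>) (inc \<zeta> \<theta>)) + energy \<Theta> a (inc \<zeta>)" for \<zeta>
          unfolding energy_def S'_def power2_norm_eq_inner
          by (simp add: inner_add_left inner_add_right inner_commute algebra_simps sum.distrib sum_distrib_left)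
        then have "avg I (\<lambda>\<xi>. energy \<Theta> a (S' \<xi>)) \<xi> = avg I (\<lambda>\<xi>. energy \<Theta> a (S \<xi>)) \<xi>
            + (2::real) *\<^sub>R (\<Sum>\<theta>\<in>\<Theta>. a \<theta> *\<^sub>R avg I (\<lambda>\<xi>. inner (S \<xi> \<theta>) (inc \<xi> \<theta>)) \<xi>)
            + avg I (\<lambda>\<xi>. energy \<Theta> a (inc \<xi>)) \<xi>"
          by (simp only: avg_add avg_scaleR avg_sum)
        \<comment> \<open>Martingale orthogonality of the running sum and the next increment.\<close>
        also have "(\<Sum>\<theta>\<in>\<Theta>. a \<theta> *\<^sub>R avg I (\<lambda>\<xi>. inner (S \<xi> \<theta>) (inc \<xi> \<theta>)) \<xi>) = 0"
        proof (intro sum.neutral ballI)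
          fix \<theta> assume \<theta>: "\<theta> \<in> \<Theta>"
          have "indep {j} (\<lambda>\<xi>. S \<xi> \<theta>)" using indep_subset [OF S_ind [OF \<theta>]] jI by simp
          then have "avg {j} (\<lambda>\<xi>. inner (S \<xi> \<theta>) (inc \<xi> \<theta>)) \<zeta> = 0" if "\<zeta> \<in> X" for \<zeta>
            using that \<theta> by (simp add: avg_inner_indep inc_mean_j)
          then have "avg I (\<lambda>\<xi>. inner (S \<xi> \<theta>) (inc \<xi> \<theta>)) \<xi> = 0"
            using avg_eq_0 [of "{j}" I] jI \<xi> by blast
          then show "a \<theta> *\<^sub>R avg I (\<lambda>\<xi>. inner (S \<xi> \<theta>) (inc \<xi> \<theta>)) \<xi> = 0" by simp
        qed
        also have "avg I (\<lambda>\<xi>. energy \<Theta> a (inc \<xi>)) \<xi> \<le> 4 * (\<Sum>y\<in>Q. p y * energy \<Theta> a (D j y \<xi>))"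
        proof -
          define e where "e = (\<lambda>\<xi>. energy \<Theta> a (D j (\<xi> j) \<xi>))"
          have upd: "energy \<Theta> a (D j y (\<zeta>(j := z))) = energy \<Theta> a (D j y \<zeta>)"
            if "y \<in> Q" "z \<in> Q" "\<zeta> \<in> X" for y z \<zeta>
            using that Dupd by (intro energy_cong) auto
          have e_avg: "avg {j} e \<zeta> = (\<Sum>y\<in>Q. p y * energy \<Theta> a (D j y \<zeta>))" if "\<zeta> \<in> X" for \<zeta>
            using that by (simp add: avg_singleton [OF jn] e_def upd)
          have "energy \<Theta> a (D j y (override_on \<zeta> \<eta> I)) = energy \<Theta> a (D j y \<zeta>)"
            if "y \<in> Q" "\<eta> \<in> X" "\<zeta> \<in> X" for y \<eta> \<zeta>
            using that Dov by (intro energy_cong) auto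
          then have "indep I (\<lambda>\<xi>. \<Sum>y\<in>Q. p y * energy \<Theta> a (D j y \<xi>))"
            by (simp add: indep_def)
          then have "avg I (\<lambda>\<xi>. \<Sum>y\<in>Q. p y * energy \<Theta> a (D j y \<xi>)) \<xi> = (\<Sum>y\<in>Q. p y * energy \<Theta> a (D j y \<xi>))"
            using \<xi> by (rule avg_indep)
          moreover have "avg I e \<xi> = avg I (\<lambda>\<xi>. \<Sum>y\<in>Q. p y * energy \<Theta> a (D j y \<xi>)) \<xi>"
            using avg_absorb [of "{j}" I \<xi> e] jI \<xi> avg_cong [OF \<xi> e_avg, where T = I] by auto
          moreover have "avg I (\<lambda>\<xi>. energy \<Theta> a (inc \<xi>)) \<xi> \<le> avg I (\<lambda>\<xi>. 4 *\<^sub>R e \<xi>) \<xi>"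
            using \<xi> inc_energy [OF a] by (intro avg_mono) (auto simp: e_def)
          ultimately show ?thesis by (simp only: avg_scaleR) simp
        qed
        finally have "avg I (\<lambda>\<xi>. energy \<Theta> a (S' \<xi>)) \<xi>
          \<le> 4 * (\<Sum>k | k \<in> I \<and> k < j. \<Sum>y\<in>Q. p y * energy \<Theta> a (D k y \<xi>))
            + 4 * (\<Sum>y\<in>Q. p y * energy \<Theta> a (D j y \<xi>))"
          using S_l2 [OF a \<xi>] by simp
        moreover have "{k. k \<in> I \<and> k < Suc j} = insert j {k. k \<in> I \<and> k < j}"
          using jI by auto
        ultimately show ?thesis using fI by simp
      qed
      have 4: "avg (I - {k}) (\<lambda>\<xi>. S' \<xi> \<theta>) \<xi> = D k (\<xi> k) \<xi> \<theta>"
        if k: "k \<in> I" "k < Suc j" and \<xi>: "\<xi> \<in> X" and \<theta>: "\<theta> \<in> \<Theta>" for k \<xi> \<theta>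
      proof (cases "k = j")
        case False
        then show ?thesis
          using S_avg [of k] inc_mean [of \<xi> \<theta> "I - {k}"] that jI by (simp add: S'_def avg_add)
      next
        case True
        have "avg (I - {j}) (\<lambda>\<xi>. S \<xi> \<theta>) \<xi> = avg I (\<lambda>\<xi>. S \<xi> \<theta>) \<xi>"
          using avg_indep_absorb [OF indep_subset [OF S_ind [OF \<theta>], of "{j}"] \<xi>, of "I - {j}"] jI
          by (simp add: insert_absorb)
        moreover have "avg (I - {j}) (\<lambda>\<xi>. inc \<xi> \<theta>) \<xi> = D j (\<xi> j) \<xi> \<theta>"
        proof -
          have "indep (I - {j}) (\<lambda>\<xi>. (1 / W \<xi> \<theta>) *\<^sub>R D j (\<xi> j) \<xi> \<theta>)"
            using indepD [OF indep_subset [OF W_ind, of "I - {j}"]] Dov [of _ _ "I - {j}"] \<theta>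
              coord_in_Q [OF _ jn]
            by (auto simp: indep_def)
          then have "avg (I - {j}) (\<lambda>\<xi>. w \<xi> \<theta> *\<^sub>R ((1 / W \<xi> \<theta>) *\<^sub>R D j (\<xi> j) \<xi> \<theta>)) \<xi>
              = avg (I - {j}) (\<lambda>\<xi>. w \<xi> \<theta>) \<xi> *\<^sub>R ((1 / W \<xi> \<theta>) *\<^sub>R D j (\<xi> j) \<xi> \<theta>)"
            using \<xi> by (rule avg_scaleR_indep_right)
          also have "avg (I - {j}) (\<lambda>\<xi>. w \<xi> \<theta>) \<xi> = W \<xi> \<theta>"
            using avg_indep_absorb [OF indep_subset [OF w_ind, of "{j}"] \<xi>, of "I - {j}"] jI
            by (simp add: insert_absorb W_def)
          finally show ?thesis using W_half [OF \<xi> \<theta>] by (simp add: inc_def)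
        qed
        ultimately show ?thesis using True S_mean [OF \<xi> \<theta>] by (simp add: S'_def avg_add)
      qed
      have 5: "avg I (\<lambda>\<xi>. S' \<xi> \<theta>) \<xi> = 0" if "\<xi> \<in> X" "\<theta> \<in> \<Theta>" for \<xi> \<theta>
        using S_mean inc_mean jI that by (simp add: S'_def avg_add)
      have "inv (Suc j) S'" unfolding inv_def using 1 2 3 4 5 by blast
      then show ?thesis by blast
    qed
  qed
  then obtain \<Phi> :: "(nat \<Rightarrow> nat) \<Rightarrow> nat \<Rightarrow> 'v" where "inv n \<Phi>" by blast
  then show ?thesis unfolding inv_def using I by (intro exI [of _ \<Phi>]) auto
qed

end

section \<open>Joint extensions for products over disjoint blocks\<close>

text \<open>
  In the induction over blocks the coordinate \<open>j\<close> of the last block and its value \<open>y\<close> become part of the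
  index. Packing \<open>(\<theta>, j, y)\<close> into a natural number keeps the type of the index fixed.
\<close>

definition enc :: "nat \<Rightarrow> nat \<Rightarrow> nat \<Rightarrow> nat" where
  "enc \<theta> j y = prod_encode (\<theta>, prod_encode (j, y))"

definition enc_index :: "nat \<Rightarrow> nat" where
  "enc_index x = fst (prod_decode x)"

definition enc_coord :: "nat \<Rightarrow> nat" where
  "enc_coord x = fst (prod_decode (snd (prod_decode x)))"

definition enc_value :: "nat \<Rightarrow> nat" where
  "enc_value x = snd (prod_decode (snd (prod_decode x)))"

lemma enc_inverse [simp]:
  "enc_index (enc \<theta> j y) = \<theta>" "enc_coord (enc \<theta> j y) = j" "enc_value (enc \<theta> j y) = y"
  by (simp_all add: enc_def enc_index_def enc_coord_def enc_value_def)

definition enc_set :: "nat set \<Rightarrow> nat set \<Rightarrow> nat set \<Rightarrow> nat set" where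
  "enc_set \<Theta> I Q = (\<lambda>(\<theta>, j, y). enc \<theta> j y) ` (\<Theta> \<times> I \<times> Q)"

text \<open>
  Every constraint on the old index set splits into those that \<open>stopped_sum\<close> asks of the increments:
  it has to hold for each single \<open>(j, y)\<close>, and in square mean over \<open>(j, y)\<close>. This doubles the overlap.
\<close>

definition point_constraint :: "(nat \<Rightarrow> real) \<Rightarrow> nat \<Rightarrow> nat \<Rightarrow> nat \<Rightarrow> real" where
  "point_constraint a j y x = (if enc_coord x = j \<and> enc_value x = y then a (enc_index x) else 0)"

definition l2_constraint :: "(nat \<Rightarrow> real) \<Rightarrow> (nat \<Rightarrow> real) \<Rightarrow> nat \<Rightarrow> real" where
  "l2_constraint p a x = a (enc_index x) * p (enc_value x)"

lemma sum_enc_set: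
  "(\<Sum>x\<in>enc_set \<Theta> I Q. g x) = (\<Sum>\<theta>\<in>\<Theta>. \<Sum>j\<in>I. \<Sum>y\<in>Q. g (enc \<theta> j y))"
proof -
  have "inj_on (\<lambda>(\<theta>, j, y). enc \<theta> j y) (\<Theta> \<times> I \<times> Q)"
    by (auto simp: inj_on_def) (metis enc_inverse)+
  then show ?thesis
    unfolding enc_set_def
    by (subst sum.reindex) (auto simp: sum.cartesian_product case_prod_beta o_def)
qed

lemma energy_point_constraint:
  assumes "finite I" "finite Q" "j \<in> I" "y \<in> Q"
  shows "energy (enc_set \<Theta> I Q) (point_constraint a j y) u = energy \<Theta> a (\<lambda>\<theta>. u (enc \<theta> j y))"
proof -
  have "(\<Sum>i\<in>I. \<Sum>z\<in>Q. point_constraint a j y (enc \<theta> i z) * (norm (u (enc \<theta> i z)))\<^sup>2)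
      = a \<theta> * (norm (u (enc \<theta> j y)))\<^sup>2" for \<theta>
  proof -
    have "(\<Sum>i\<in>I. \<Sum>z\<in>Q. point_constraint a j y (enc \<theta> i z) * (norm (u (enc \<theta> i z)))\<^sup>2)
      = (\<Sum>i\<in>I. if i = j then (\<Sum>z\<in>Q. if z = y then a \<theta> * (norm (u (enc \<theta> j y)))\<^sup>2 else 0) else 0)"
      by (intro sum.cong refl) (auto simp: point_constraint_def intro!: sum.cong sum.neutral)
    then show ?thesis using assms by simp
  qed
  then show ?thesis unfolding energy_def sum_enc_set by simp
qed

lemma energy_l2_constraint:
  "energy (enc_set \<Theta> I Q) (l2_constraint p a) u
    = (\<Sum>j\<in>I. \<Sum>y\<in>Q. p y * energy \<Theta> a (\<lambda>\<theta>. u (enc \<theta> j y)))"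
proof -
  have "energy (enc_set \<Theta> I Q) (l2_constraint p a) u
      = (\<Sum>\<theta>\<in>\<Theta>. \<Sum>j\<in>I. \<Sum>y\<in>Q. p y * (a \<theta> * (norm (u (enc \<theta> j y)))\<^sup>2))"
    unfolding energy_def sum_enc_set l2_constraint_def by (intro sum.cong refl) (simp add: mult_ac)
  also have "\<dots> = (\<Sum>j\<in>I. \<Sum>\<theta>\<in>\<Theta>. \<Sum>y\<in>Q. p y * (a \<theta> * (norm (u (enc \<theta> j y)))\<^sup>2))"
    by (rule sum.swap)
  also have "\<dots> = (\<Sum>j\<in>I. \<Sum>y\<in>Q. \<Sum>\<theta>\<in>\<Theta>. p y * (a \<theta> * (norm (u (enc \<theta> j y)))\<^sup>2))"
    by (subst (2) sum.swap) (rule refl)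
  finally show ?thesis by (simp add: energy_def sum_distrib_left)
qed

text \<open>
  The constants belong to \<open>rainbow_joint_extension\<close>; they involve the number of blocks and the overlap,
  and no other data of the product.
\<close>

fun ext_const :: "nat \<Rightarrow> nat \<Rightarrow> real" where
  "ext_const 0 K = 1"
| "ext_const (Suc m) K = (16 * real K + 8) * (16 * ext_const m (2 * K))"

lemma ext_const_pos: "ext_const m K > 0"
  by (induction m K rule: ext_const.induct) (auto intro!: mult_pos_pos add_nonneg_pos)

context finite_power
begin

definition enc_constraints :: "(nat \<Rightarrow> real) set \<Rightarrow> nat set \<Rightarrow> (nat \<Rightarrow> real) set" where
  "enc_constraints A I = (\<lambda>(a, j, y). point_constraint a j y) ` (A \<times> I \<times> Q) \<union> l2_constraint p ` A"

lemma constraints_enc: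
  assumes A: "constraints \<Theta> A K" and I: "finite I"
  shows "constraints (enc_set \<Theta> I Q) (enc_constraints A I) (2 * K)"
proof -
  have a0: "\<And>a \<theta>. a \<in> A \<Longrightarrow> \<theta> \<in> \<Theta> \<Longrightarrow> 0 \<le> a \<theta>" and fA: "finite A" and f\<Theta>: "finite \<Theta>"
    and card_a: "\<And>\<theta>. \<theta> \<in> \<Theta> \<Longrightarrow> card {a \<in> A. 0 < a \<theta>} \<le> K"
    using A by (auto simp: constraints_def)
  have "card {b \<in> enc_constraints A I. 0 < b x} \<le> 2 * K" if x': "x \<in> enc_set \<Theta> I Q" for x
  proof -
    obtain \<theta> j y where x: "x = enc \<theta> j y" "\<theta> \<in> \<Theta>" "j \<in> I" "y \<in> Q"
      using x' by (auto simp: enc_set_def)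
    let ?P = "{a \<in> A. 0 < a \<theta>}"
    have "{b \<in> enc_constraints A I. 0 < b x} \<subseteq> (\<lambda>a. point_constraint a j y) ` ?P \<union> l2_constraint p ` ?P"
      using x a0 p_pos
      by (auto simp: enc_constraints_def point_constraint_def l2_constraint_def zero_less_mult_iff
          split: if_splits) (meson not_less)+
    then have "card {b \<in> enc_constraints A I. 0 < b x}
        \<le> card ((\<lambda>a. point_constraint a j y) ` ?P \<union> l2_constraint p ` ?P)"
      using fA by (intro card_mono) auto
    also have "\<dots> \<le> card ((\<lambda>a. point_constraint a j y) ` ?P) + card (l2_constraint p ` ?P)"
      by (rule card_Un_le)
    also have "\<dots> \<le> card ?P + card ?P"
      using fA by (intro add_mono card_image_le) auto
    also have "\<dots> \<le> 2 * K" using card_a [OF x(2)] by simp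
    finally show ?thesis .
  qed
  moreover have "0 \<le> b x" if "b \<in> enc_constraints A I" "x \<in> enc_set \<Theta> I Q" for b x
    using that a0 p_nonneg
    by (auto simp: enc_constraints_def enc_set_def point_constraint_def l2_constraint_def)
  ultimately show ?thesis
    using fA f\<Theta> I finite_Q unfolding constraints_def by (auto simp: enc_constraints_def enc_set_def)
qed

text \<open>
  The tests are scalar and act for each \<open>\<theta>\<close> separately: constraints couple the indices, pairings do not.
\<close>

definition same_on :: "(((nat \<Rightarrow> nat) \<Rightarrow> real) \<Rightarrow> bool) \<Rightarrow> nat set \<Rightarrow>
    ((nat \<Rightarrow> nat) \<Rightarrow> nat \<Rightarrow> 'v::real_vector) \<Rightarrow> ((nat \<Rightarrow> nat) \<Rightarrow> nat \<Rightarrow> 'v) \<Rightarrow> bool" where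
  "same_on U \<Theta> \<Phi> \<Psi> \<longleftrightarrow>
     (\<forall>u. U u \<longrightarrow> (\<forall>\<theta>\<in>\<Theta>. Ex (\<lambda>\<xi>. u \<xi> *\<^sub>R \<Phi> \<xi> \<theta>) = Ex (\<lambda>\<xi>. u \<xi> *\<^sub>R \<Psi> \<xi> \<theta>)))"

text \<open>
  Tests with one centred factor from each of the colour classes below \<open>m\<close>. Being centred, they ignore
  everything but the component of degree exactly one in each of these classes.
\<close>

inductive rainbow :: "(nat \<Rightarrow> nat) \<Rightarrow> nat \<Rightarrow> ((nat \<Rightarrow> nat) \<Rightarrow> real) \<Rightarrow> bool" for \<delta> where
  rainbow_0: "rainbow \<delta> 0 (\<lambda>_. 1)"
| rainbow_Suc: "\<lbrakk>rainbow \<delta> m u; k < n; \<delta> k = m; (\<Sum>y\<in>Q. p y * v y) = 0\<rbrakk>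
    \<Longrightarrow> rainbow \<delta> (Suc m) (\<lambda>\<xi>. u \<xi> * v (\<xi> k))"

lemma rainbow_0_iff: "rainbow \<delta> 0 u \<longleftrightarrow> u = (\<lambda>_. 1)"
  by (auto intro: rainbow_0 elim: rainbow.cases)

lemma rainbow_Suc_cases:
  assumes "rainbow \<delta> (Suc m) u"
  obtains u' k v where "rainbow \<delta> m u'" "k < n" "\<delta> k = m" "(\<Sum>y\<in>Q. p y * v y) = 0"
    "u = (\<lambda>\<xi>. u' \<xi> * v (\<xi> k))"
  using assms by (cases rule: rainbow.cases) auto

lemma rainbow_indep: "rainbow \<delta> m u \<Longrightarrow> (\<And>i. i \<in> T \<Longrightarrow> m \<le> \<delta> i) \<Longrightarrow> indep T u"
proof (induction rule: rainbow.induct)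
  case (rainbow_Suc m u k v)
  then have "indep T u" "k \<notin> T" by fastforce+
  then show ?case by (auto simp: indep_def)
qed (simp add: indep_def)

lemma Ex_coord_split:
  fixes h :: "(nat \<Rightarrow> nat) \<Rightarrow> 'v::real_vector"
  assumes k: "k < n" and u: "indep {k} u"
  shows "Ex (\<lambda>\<xi>. (u \<xi> * v (\<xi> k)) *\<^sub>R h \<xi>)
    = (\<Sum>y\<in>Q. (p y * v y) *\<^sub>R Ex (\<lambda>\<xi>. u \<xi> *\<^sub>R h (\<xi>(k := y))))"
proof -
  have "Ex (\<lambda>\<xi>. (u \<xi> * v (\<xi> k)) *\<^sub>R h \<xi>) = Ex (avg {k} (\<lambda>\<xi>. (u \<xi> * v (\<xi> k)) *\<^sub>R h \<xi>))"
    by (simp add: Ex_avg)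
  also have "\<dots> = Ex (\<lambda>\<xi>. \<Sum>y\<in>Q. (p y * v y) *\<^sub>R (u \<xi> *\<^sub>R h (\<xi>(k := y))))"
  proof (rule Ex_cong)
    fix \<xi> assume "\<xi> \<in> X"
    then show "avg {k} (\<lambda>\<xi>. (u \<xi> * v (\<xi> k)) *\<^sub>R h \<xi>) \<xi>
        = (\<Sum>y\<in>Q. (p y * v y) *\<^sub>R (u \<xi> *\<^sub>R h (\<xi>(k := y))))"
      unfolding avg_singleton [OF k]
      by (intro sum.cong refl) (simp add: indep_upd [OF u _ _ k] mult_ac)
  qed
  finally show ?thesis by (simp only: Ex_sum Ex_scaleR)
qed

definition increment :: "nat set \<Rightarrow> ((nat \<Rightarrow> nat) \<Rightarrow> nat \<Rightarrow> 'v::real_vector) \<Rightarrow> (nat \<Rightarrow> nat) \<Rightarrow> nat \<Rightarrow> 'v" where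
  "increment I \<Psi> \<xi> x =
     avg (I - {enc_coord x}) (\<lambda>\<xi>. \<Psi> \<xi> (enc_index x)) (\<xi>(enc_coord x := enc_value x))
     - avg I (\<lambda>\<xi>. \<Psi> \<xi> (enc_index x)) \<xi>"

text \<open>
  The centred factor is the normalised indicator of \<open>y\<close>, minus its mean. So equality on rainbow tests
  with \<open>m + 1\<close> colours passes to the increments, on rainbow tests with \<open>m\<close> colours.
\<close>

lemma Ex_increment:
  assumes u: "indep I u" and j: "j \<in> I" "j < n" and y: "y \<in> Q"
  shows "Ex (\<lambda>\<xi>. u \<xi> *\<^sub>R increment I \<Psi> \<xi> (enc \<theta> j y))
    = Ex (\<lambda>\<xi>. (u \<xi> * ((if \<xi> j = y then 1 / p y else 0) - 1)) *\<^sub>R \<Psi> \<xi> \<theta>)"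
proof -
  define v where "v = (\<lambda>z. (if z = y then 1 / p y else 0) - 1 :: real)"
  define h where "h = avg (I - {j}) (\<lambda>\<xi>. \<Psi> \<xi> \<theta>)"
  have uj: "indep {j} u" using u j by (auto intro: indep_subset)
  have u': "indep (I - {j}) u" using u by (auto intro: indep_subset)
  have "indep (I - {j}) (\<lambda>\<xi>. u \<xi> * v (\<xi> j))"
    using u' by (auto simp: indep_def)
  then have "avg (I - {j}) (\<lambda>\<xi>. u \<xi> * v (\<xi> j)) \<xi> = u \<xi> * v (\<xi> j)" if "\<xi> \<in> X" for \<xi>
    using that by (rule avg_indep)
  then have "Ex (\<lambda>\<xi>. (u \<xi> * v (\<xi> j)) *\<^sub>R \<Psi> \<xi> \<theta>) = Ex (\<lambda>\<xi>. (u \<xi> * v (\<xi> j)) *\<^sub>R h \<xi>)"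
    unfolding h_def by (subst Ex_avg_adjoint) (auto intro: Ex_cong)
  also have "\<dots> = (\<Sum>z\<in>Q. (p z * v z) *\<^sub>R Ex (\<lambda>\<xi>. u \<xi> *\<^sub>R h (\<xi>(j := z))))"
    by (rule Ex_coord_split [OF j(2) uj])
  also have "\<dots> = (\<Sum>z\<in>Q. (if z = y then Ex (\<lambda>\<xi>. u \<xi> *\<^sub>R h (\<xi>(j := y))) else 0)
      - p z *\<^sub>R Ex (\<lambda>\<xi>. u \<xi> *\<^sub>R h (\<xi>(j := z))))"
    using p_pos [OF y] by (intro sum.cong) (auto simp: v_def algebra_simps scaleR_diff_left)
  also have "\<dots> = Ex (\<lambda>\<xi>. u \<xi> *\<^sub>R h (\<xi>(j := y))) - (\<Sum>z\<in>Q. p z *\<^sub>R Ex (\<lambda>\<xi>. u \<xi> *\<^sub>R h (\<xi>(j := z))))"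
    using y finite_Q by (simp add: sum_subtractf)
  also have "(\<Sum>z\<in>Q. p z *\<^sub>R Ex (\<lambda>\<xi>. u \<xi> *\<^sub>R h (\<xi>(j := z)))) = Ex (\<lambda>\<xi>. u \<xi> *\<^sub>R avg {j} h \<xi>)"
    by (simp add: avg_singleton [OF j(2)] scaleR_sum_right Ex_sum flip: Ex_scaleR) (simp add: mult.commute)
  also have "avg {j} h = avg I (\<lambda>\<xi>. \<Psi> \<xi> \<theta>)"
    using j by (auto simp: h_def avg_avg fun_eq_iff insert_absorb)
  finally show ?thesis
    by (simp only: v_def increment_def h_def enc_inverse scaleR_diff_right Ex_diff)
qed

lemma sum_p_indicator_minus_1: "y \<in> Q \<Longrightarrow> (\<Sum>z\<in>Q. p z * ((if z = y then 1 / p y else 0) - 1)) = 0"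
proof -
  assume y: "y \<in> Q"
  have "(\<Sum>z\<in>Q. p z * ((if z = y then 1 / p y else 0) - 1)) = (\<Sum>z\<in>Q. (if z = y then 1 else 0) - p z)"
    using p_pos [OF y] by (intro sum.cong) (auto simp: algebra_simps)
  then show ?thesis using y finite_Q by (simp add: sum_subtractf p_sum)
qed

text \<open>
  When only the mean is prescribed, the constant function works: constraints are convex.
\<close>

lemma joint_extension_of_mean:
  fixes \<Phi>0 :: "(nat \<Rightarrow> nat) \<Rightarrow> nat \<Rightarrow> 'v::real_inner"
  assumes A: "constraints \<Theta> A K"
    and loc: "\<And>a. a \<in> A \<Longrightarrow> \<exists>\<Psi>. (\<forall>\<theta>\<in>\<Theta>. Ex (\<lambda>\<xi>. \<Psi> \<xi> \<theta>) = Ex (\<lambda>\<xi>. \<Phi>0 \<xi> \<theta>)) \<and>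
      (\<forall>\<xi>\<in>X. energy \<Theta> a (\<Psi> \<xi>) \<le> \<beta>)"
  shows "\<forall>a\<in>A. energy \<Theta> a (\<lambda>\<theta>. Ex (\<lambda>\<xi>. \<Phi>0 \<xi> \<theta>)) \<le> \<beta>"
proof
  fix a assume a: "a \<in> A"
  then obtain \<Psi> where \<Psi>: "\<And>\<theta>. \<theta> \<in> \<Theta> \<Longrightarrow> Ex (\<lambda>\<xi>. \<Psi> \<xi> \<theta>) = Ex (\<lambda>\<xi>. \<Phi>0 \<xi> \<theta>)"
    "\<And>\<xi>. \<xi> \<in> X \<Longrightarrow> energy \<Theta> a (\<Psi> \<xi>) \<le> \<beta>"
    using loc by blast
  have "energy \<Theta> a (\<lambda>\<theta>. Ex (\<lambda>\<xi>. \<Phi>0 \<xi> \<theta>)) = energy \<Theta> a (\<lambda>\<theta>. Ex (\<lambda>\<xi>. \<Psi> \<xi> \<theta>))"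
    using \<Psi>(1) by (intro energy_cong) auto
  also have "\<dots> \<le> Ex (\<lambda>\<xi>. energy \<Theta> a (\<Psi> \<xi>))"
    using A a by (intro energy_Ex_le) (auto simp: constraints_def)
  also have "\<dots> \<le> Ex (\<lambda>_. \<beta>)" using \<Psi>(2) by (rule Ex_mono)
  finally show "energy \<Theta> a (\<lambda>\<theta>. Ex (\<lambda>\<xi>. \<Phi>0 \<xi> \<theta>)) \<le> \<beta>" by simp
qed

lemma increment_energy_le:
  fixes \<Psi> :: "(nat \<Rightarrow> nat) \<Rightarrow> nat \<Rightarrow> 'v::real_inner"
  assumes A: "constraints \<Theta> A K" and a: "a \<in> A" and I: "I \<subseteq> {..<n}"
    and bound: "\<And>\<xi>. \<xi> \<in> X \<Longrightarrow> energy \<Theta> a (\<Psi> \<xi>) \<le> \<beta>" and \<xi>: "\<xi> \<in> X"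
  shows "\<lbrakk>j \<in> I; y \<in> Q\<rbrakk> \<Longrightarrow> energy \<Theta> a (\<lambda>\<theta>. increment I \<Psi> \<xi> (enc \<theta> j y)) \<le> 4 * \<beta>"
    and "(\<Sum>j\<in>I. \<Sum>y\<in>Q. p y * energy \<Theta> a (\<lambda>\<theta>. increment I \<Psi> \<xi> (enc \<theta> j y))) \<le> \<beta>"
proof -
  have a0: "\<And>\<theta>. \<theta> \<in> \<Theta> \<Longrightarrow> 0 \<le> a \<theta>" using A a by (auto simp: constraints_def)
  have fI: "finite I" using I finite_subset by blast
  {
    assume jy: "j \<in> I" "y \<in> Q"
    let ?h = "\<lambda>\<theta>. avg (I - {j}) (\<lambda>\<xi>. \<Psi> \<xi> \<theta>) (\<xi>(j := y))"
    have "energy \<Theta> a (\<lambda>\<theta>. increment I \<Psi> \<xi> (enc \<theta> j y))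
        \<le> 2 * energy \<Theta> a ?h + 2 * energy \<Theta> a (\<lambda>\<theta>. avg I (\<lambda>\<xi>. \<Psi> \<xi> \<theta>) \<xi>)"
      unfolding increment_def enc_inverse by (rule energy_add_le(2)) (rule a0)
    also have "energy \<Theta> a ?h \<le> \<beta>"
      using jy I \<xi> bound by (intro energy_avg_le_const a0) (auto intro: upd_in_X)
    also have "energy \<Theta> a (\<lambda>\<theta>. avg I (\<lambda>\<xi>. \<Psi> \<xi> \<theta>) \<xi>) \<le> \<beta>"
      using \<xi> bound by (intro energy_avg_le_const a0)
    finally show "energy \<Theta> a (\<lambda>\<theta>. increment I \<Psi> \<xi> (enc \<theta> j y)) \<le> 4 * \<beta>" by simp
  }
  have "(\<Sum>j\<in>I. \<Sum>y\<in>Q. p y * energy \<Theta> a (\<lambda>\<theta>. increment I \<Psi> \<xi> (enc \<theta> j y)))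
      = (\<Sum>j\<in>I. \<Sum>y\<in>Q. \<Sum>\<theta>\<in>\<Theta>. a \<theta> * (p y * (norm (increment I \<Psi> \<xi> (enc \<theta> j y)))\<^sup>2))"
    unfolding energy_def sum_distrib_left by (intro sum.cong refl) (simp add: mult_ac)
  also have "\<dots> = (\<Sum>\<theta>\<in>\<Theta>. \<Sum>j\<in>I. \<Sum>y\<in>Q. a \<theta> * (p y * (norm (increment I \<Psi> \<xi> (enc \<theta> j y)))\<^sup>2))"
    by (subst (2) sum.swap) (subst sum.swap, rule refl)
  also have "\<dots> = (\<Sum>\<theta>\<in>\<Theta>. a \<theta> * (\<Sum>j\<in>I. \<Sum>y\<in>Q. p y * (norm (increment I \<Psi> \<xi> (enc \<theta> j y)))\<^sup>2))"
    by (simp add: sum_distrib_left)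
  also have "\<dots> \<le> (\<Sum>\<theta>\<in>\<Theta>. a \<theta> * avg I (\<lambda>\<xi>. (norm (\<Psi> \<xi> \<theta>))\<^sup>2) \<xi>)"
    unfolding increment_def enc_inverse
    by (intro sum_mono mult_left_mono bessel_increments I \<xi> a0)
  also have "\<dots> = avg I (\<lambda>\<xi>. energy \<Theta> a (\<Psi> \<xi>)) \<xi>"
    unfolding energy_def avg_sum using avg_scaleR [of I, where 'a = real] by simp
  also have "\<dots> \<le> avg I (\<lambda>_. \<beta>) \<xi>" using \<xi> bound by (intro avg_mono)
  finally show "(\<Sum>j\<in>I. \<Sum>y\<in>Q. p y * energy \<Theta> a (\<lambda>\<theta>. increment I \<Psi> \<xi> (enc \<theta> j y))) \<le> \<beta>" by simp
qed

text \<open>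
  If each constraint alone can be met without changing the pairings with rainbow tests, then all can be
  met at once, up to a constant. The last block is treated by \<open>stopped_sum\<close>. Its increments are first
  made to meet their constraints by the induction hypothesis, in which the other blocks vary and the
  coordinate and value of the increment are part of the index.
\<close>

lemma rainbow_joint_extension:
  fixes \<Phi>0 :: "(nat \<Rightarrow> nat) \<Rightarrow> nat \<Rightarrow> 'v::real_inner"
  assumes "constraints \<Theta> A K" "K \<ge> 1" "\<beta> > 0"
    and "\<And>a. a \<in> A \<Longrightarrow> \<exists>\<Psi>. same_on (rainbow \<delta> m) \<Theta> \<Psi> \<Phi>0 \<and> (\<forall>\<xi>\<in>X. energy \<Theta> a (\<Psi> \<xi>) \<le> \<beta>)"
  shows "\<exists>\<Phi>. same_on (rainbow \<delta> m) \<Theta> \<Phi> \<Phi>0 \<and> (\<forall>a\<in>A. \<forall>\<xi>\<in>X. energy \<Theta> a (\<Phi> \<xi>) \<le> ext_const m K * \<beta>)"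
  using assms
proof (induction m arbitrary: \<Theta> A K \<beta> \<Phi>0)
  case 0
  define \<Phi> where "\<Phi> = (\<lambda>\<xi> :: nat \<Rightarrow> nat. \<lambda>\<theta>. Ex (\<lambda>\<xi>. \<Phi>0 \<xi> \<theta>))"
  have "\<forall>a\<in>A. energy \<Theta> a (\<lambda>\<theta>. Ex (\<lambda>\<xi>. \<Phi>0 \<xi> \<theta>)) \<le> \<beta>"
    using "0.prems"(4) by (intro joint_extension_of_mean [OF "0.prems"(1)]) (auto simp: same_on_def rainbow_0_iff)
  moreover have "same_on (rainbow \<delta> 0) \<Theta> \<Phi> \<Phi>0"
    by (auto simp: same_on_def rainbow_0_iff \<Phi>_def)
  ultimately show ?case by (intro exI [of _ \<Phi>]) (auto simp: \<Phi>_def)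
next
  case (Suc m)
  note A = Suc.prems(1) and K = Suc.prems(2) and \<beta> = Suc.prems(3) and loc = Suc.prems(4)
  define I where "I = {i. i < n \<and> \<delta> i = m}"
  have I: "I \<subseteq> {..<n}" and fI: "finite I" by (auto simp: I_def)
  have a0: "\<And>a \<theta>. a \<in> A \<Longrightarrow> \<theta> \<in> \<Theta> \<Longrightarrow> 0 \<le> a \<theta>" using A by (auto simp: constraints_def)
  have ind_u: "indep T u" if "rainbow \<delta> m u" "T \<subseteq> I" for u T
    using rainbow_indep [OF that(1), of T] that(2) by (auto simp: I_def)
  let ?\<Theta> = "enc_set \<Theta> I Q" and ?A = "enc_constraints A I"
  define c where "c = ext_const m (2 * K) * (4 * \<beta>)"
  have c: "c > 0" using ext_const_pos \<beta> by (auto simp: c_def)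
  have "\<exists>D. same_on (rainbow \<delta> m) ?\<Theta> D (increment I \<Phi>0) \<and> (\<forall>b\<in>?A. \<forall>\<xi>\<in>X. energy ?\<Theta> b (D \<xi>) \<le> c)"
    unfolding c_def
  proof (rule Suc.IH)
    show "constraints ?\<Theta> ?A (2 * K)" by (rule constraints_enc [OF A fI])
    fix b assume "b \<in> ?A"
    then consider a j y where "b = point_constraint a j y" "a \<in> A" "j \<in> I" "y \<in> Q"
      | a where "b = l2_constraint p a" "a \<in> A"
      by (auto simp: enc_constraints_def)
    then obtain a where a: "a \<in> A" and b: "b = l2_constraint p a \<or> (\<exists>j\<in>I. \<exists>y\<in>Q. b = point_constraint a j y)"
      by cases auto
    obtain \<Psi> where \<Psi>: "same_on (rainbow \<delta> (Suc m)) \<Theta> \<Psi> \<Phi>0" "\<And>\<xi>. \<xi> \<in> X \<Longrightarrow> energy \<Theta> a (\<Psi> \<xi>) \<le> \<beta>"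
      using loc [OF a] by blast
    have "same_on (rainbow \<delta> m) ?\<Theta> (increment I \<Psi>) (increment I \<Phi>0)"
      unfolding same_on_def
    proof (intro allI impI ballI)
      fix u x assume u: "rainbow \<delta> m u" and "x \<in> ?\<Theta>"
      then obtain \<theta> j y where x: "x = enc \<theta> j y" "\<theta> \<in> \<Theta>" "j \<in> I" "y \<in> Q"
        by (auto simp: enc_set_def)
      let ?v = "\<lambda>z. (if z = y then 1 / p y else 0) - 1"
      have "rainbow \<delta> (Suc m) (\<lambda>\<xi>. u \<xi> * ?v (\<xi> j))"
        using x by (intro rainbow_Suc u sum_p_indicator_minus_1) (auto simp: I_def)
      then show "Ex (\<lambda>\<xi>. u \<xi> *\<^sub>R increment I \<Psi> \<xi> x) = Ex (\<lambda>\<xi>. u \<xi> *\<^sub>R increment I \<Phi>0 \<xi> x)"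
        using \<Psi>(1) x I ind_u [OF u] unfolding x(1) same_on_def
        by (subst (1 2) Ex_increment) auto
    qed
    moreover have "energy ?\<Theta> b (increment I \<Psi> \<xi>) \<le> 4 * \<beta>" if \<xi>: "\<xi> \<in> X" for \<xi>
      using b
    proof
      assume "b = l2_constraint p a"
      then show ?thesis
        using increment_energy_le(2) [where \<Psi> = \<Psi>, OF A a I \<Psi>(2) \<xi>] \<beta> by (simp add: energy_l2_constraint)
    next
      assume "\<exists>j\<in>I. \<exists>y\<in>Q. b = point_constraint a j y"
      then show ?thesis
        using increment_energy_le(1) [where \<Psi> = \<Psi>, OF A a I \<Psi>(2) \<xi>] fI finite_Q
        by (auto simp: energy_point_constraint)
    qed
    ultimately show "\<exists>\<Psi>. same_on (rainbow \<delta> m) ?\<Theta> \<Psi> (increment I \<Phi>0) \<and> (\<forall>\<xi>\<in>X. energy ?\<Theta> b (\<Psi> \<xi>) \<le> 4 * \<beta>)"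
      by blast
  qed (use K \<beta> in auto)
  then obtain D' where D'_same: "same_on (rainbow \<delta> m) ?\<Theta> D' (increment I \<Phi>0)"
    and D'_bound: "\<And>b \<xi>. b \<in> ?A \<Longrightarrow> \<xi> \<in> X \<Longrightarrow> energy ?\<Theta> b (D' \<xi>) \<le> c"
    by blast
  \<comment> \<open>Averaging over the last block and centring in \<open>y\<close> provide what \<open>stopped_sum\<close> assumes, and do not change the pairings with centred tests.\<close>
  define D'' where "D'' = (\<lambda>j y \<xi> \<theta>. avg I (\<lambda>\<xi>. D' \<xi> (enc \<theta> j y)) \<xi>)"
  define D where "D = (\<lambda>j y \<xi> \<theta>. D'' j y \<xi> \<theta> - (\<Sum>z\<in>Q. p z *\<^sub>R D'' j z \<xi> \<theta>))"
  have D''_sup: "energy \<Theta> a (D'' j y \<xi>) \<le> c" if "a \<in> A" "j \<in> I" "y \<in> Q" "\<xi> \<in> X" for a j y \<xi>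
  proof -
    have "point_constraint a j y \<in> ?A" using that by (force simp: enc_constraints_def)
    then have "energy \<Theta> a (\<lambda>\<theta>. D' \<zeta> (enc \<theta> j y)) \<le> c" if "\<zeta> \<in> X" for \<zeta>
      using D'_bound [of "point_constraint a j y" \<zeta>] fI finite_Q that \<open>j \<in> I\<close> \<open>y \<in> Q\<close>
      by (simp add: energy_point_constraint)
    then show ?thesis unfolding D''_def using that a0 by (intro energy_avg_le_const) auto
  qed
  have D''_l2: "(\<Sum>j\<in>I. \<Sum>y\<in>Q. p y * energy \<Theta> a (D'' j y \<xi>)) \<le> c" if "a \<in> A" "\<xi> \<in> X" for a \<xi>
  proof -
    have "(\<Sum>j\<in>I. \<Sum>y\<in>Q. p y * energy \<Theta> a (D'' j y \<xi>))
        \<le> (\<Sum>j\<in>I. \<Sum>y\<in>Q. p y * avg I (\<lambda>\<xi>. energy \<Theta> a (\<lambda>\<theta>. D' \<xi> (enc \<theta> j y))) \<xi>)"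
      unfolding D''_def using that a0 by (intro sum_mono mult_left_mono energy_avg_le p_nonneg) auto
    also have "\<dots> = avg I (\<lambda>\<xi>. energy ?\<Theta> (l2_constraint p a) (D' \<xi>)) \<xi>"
      unfolding energy_l2_constraint avg_sum using avg_scaleR [of I, where 'a = real] by simp
    also have "\<dots> \<le> avg I (\<lambda>_. c) \<xi>"
      using D'_bound [of "l2_constraint p a"] that by (intro avg_mono) (auto simp: enc_constraints_def)
    finally show ?thesis by simp
  qed
  have D_le: "energy \<Theta> a (D j y \<xi>) \<le> 2 * energy \<Theta> a (D'' j y \<xi>) + 2 * (\<Sum>z\<in>Q. p z * energy \<Theta> a (D'' j z \<xi>))"
    if "a \<in> A" for a j y \<xi>
  proof -
    have "energy \<Theta> a (D j y \<xi>)
        \<le> 2 * energy \<Theta> a (D'' j y \<xi>) + 2 * energy \<Theta> a (\<lambda>\<theta>. \<Sum>z\<in>Q. p z *\<^sub>R D'' j z \<xi> \<theta>)"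
      unfolding D_def using a0 that by (intro energy_add_le(2)) auto
    also have "energy \<Theta> a (\<lambda>\<theta>. \<Sum>z\<in>Q. p z *\<^sub>R D'' j z \<xi> \<theta>) \<le> (\<Sum>z\<in>Q. p z * energy \<Theta> a (D'' j z \<xi>))"
      using a0 that by (intro energy_convex_sum_le) auto
    finally show ?thesis by simp
  qed
  have "\<exists>\<Phi>. (\<forall>k\<in>I. \<forall>\<xi>\<in>X. \<forall>\<theta>\<in>\<Theta>. avg (I - {k}) (\<lambda>\<xi>. \<Phi> \<xi> \<theta>) \<xi> = D k (\<xi> k) \<xi> \<theta>) \<and>
    (\<forall>a\<in>A. \<forall>\<xi>\<in>X. energy \<Theta> a (\<Phi> \<xi>) \<le> (16 * real K + 8) * (4 * c))"
  proof (rule stopped_sum [where D = D, OF A K _ I])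
    show "0 < 4 * c" using c by simp
    show "indep I (\<lambda>\<xi>. D j y \<xi> \<theta>)" for j y \<theta>
      unfolding D_def D''_def indep_def by (simp add: indepD [OF indep_avg])
    show "(\<Sum>y\<in>Q. p y *\<^sub>R D j y \<xi> \<theta>) = 0" for j \<xi> \<theta>
      by (simp add: D_def scaleR_diff_right sum_subtractf p_sum flip: scaleR_sum_left)
    show "energy \<Theta> a (D j y \<xi>) \<le> 4 * c" if "a \<in> A" "j \<in> I" "y \<in> Q" "\<xi> \<in> X" for a j y \<xi>
    proof -
      have "(\<Sum>z\<in>Q. p z * energy \<Theta> a (D'' j z \<xi>)) \<le> (\<Sum>z\<in>Q. p z * c)"
        using D''_sup that p_nonneg by (intro sum_mono mult_left_mono) auto
      then show ?thesis using D_le [OF that(1), of j y \<xi>] D''_sup [OF that]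
        by (simp add: p_sum flip: sum_distrib_right)
    qed
    show "(\<Sum>j\<in>I. \<Sum>y\<in>Q. p y * energy \<Theta> a (D j y \<xi>)) \<le> 4 * c" if "a \<in> A" "\<xi> \<in> X" for a \<xi>
    proof -
      have "(\<Sum>y\<in>Q. p y * energy \<Theta> a (D j y \<xi>)) \<le> 4 * (\<Sum>y\<in>Q. p y * energy \<Theta> a (D'' j y \<xi>))" for j
      proof -
        define s where "s = (\<Sum>z\<in>Q. p z * energy \<Theta> a (D'' j z \<xi>))"
        have "(\<Sum>y\<in>Q. p y * energy \<Theta> a (D j y \<xi>))
            \<le> (\<Sum>y\<in>Q. p y * (2 * energy \<Theta> a (D'' j y \<xi>) + 2 * s))"
          using D_le [OF that(1)] p_nonneg unfolding s_def by (intro sum_mono mult_left_mono) auto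
        also have "\<dots> = (\<Sum>y\<in>Q. 2 * (p y * energy \<Theta> a (D'' j y \<xi>)) + p y * (2 * s))"
          by (simp add: algebra_simps)
        also have "\<dots> = 2 * s + (\<Sum>y\<in>Q. p y) * (2 * s)"
          by (simp add: s_def sum.distrib flip: sum_distrib_left sum_distrib_right)
        finally show ?thesis by (simp add: p_sum s_def)
      qed
      then have "(\<Sum>j\<in>I. \<Sum>y\<in>Q. p y * energy \<Theta> a (D j y \<xi>))
          \<le> (\<Sum>j\<in>I. 4 * (\<Sum>y\<in>Q. p y * energy \<Theta> a (D'' j y \<xi>)))"
        by (rule sum_mono)
      then show ?thesis using D''_l2 [OF that] by (simp flip: sum_distrib_left)
    qed
  qed
  then obtain \<Phi> where \<Phi>_avg: "\<And>k \<xi> \<theta>. \<lbrakk>k \<in> I; \<xi> \<in> X; \<theta> \<in> \<Theta>\<rbrakk> \<Longrightarrow> avg (I - {k}) (\<lambda>\<xi>. \<Phi> \<xi> \<theta>) \<xi> = D k (\<xi> k) \<xi> \<theta>"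
    and \<Phi>_bound: "\<And>a \<xi>. a \<in> A \<Longrightarrow> \<xi> \<in> X \<Longrightarrow> energy \<Theta> a (\<Phi> \<xi>) \<le> (16 * real K + 8) * (4 * c)"
    by blast
  have "same_on (rainbow \<delta> (Suc m)) \<Theta> \<Phi> \<Phi>0"
    unfolding same_on_def
  proof (intro allI impI ballI)
    fix u \<theta> assume "rainbow \<delta> (Suc m) u" and \<theta>: "\<theta> \<in> \<Theta>"
    then obtain u' k v where u': "rainbow \<delta> m u'" and k: "k < n" "\<delta> k = m"
      and v: "(\<Sum>y\<in>Q. p y * v y) = 0" and u: "u = (\<lambda>\<xi>. u' \<xi> * v (\<xi> k))"
      by (elim rainbow_Suc_cases)
    have kI: "k \<in> I" using k by (simp add: I_def)
    have ind_k: "indep {k} u'" and ind_I: "indep I u'" and ind_Ik: "indep (I - {k}) u'"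
      using ind_u [OF u'] kI by auto
    have "indep (I - {k}) u" unfolding u using ind_Ik by (auto simp: indep_def)
    then have "avg (I - {k}) u \<xi> = u \<xi>" if "\<xi> \<in> X" for \<xi> using that by (rule avg_indep)
    then have red: "Ex (\<lambda>\<xi>. u \<xi> *\<^sub>R \<Psi> \<xi>) = Ex (\<lambda>\<xi>. u \<xi> *\<^sub>R avg (I - {k}) \<Psi> \<xi>)" for \<Psi> :: "(nat \<Rightarrow> nat) \<Rightarrow> 'v"
      by (subst Ex_avg_adjoint) (auto intro: Ex_cong)
    have upd: "D k y (\<xi>(k := z)) \<theta> = D k y \<xi> \<theta>" if "\<xi> \<in> X" "z \<in> Q" for \<xi> y z
      unfolding D_def D''_def using that by (simp add: indep_upd_avg [OF k(1) kI])
    have "Ex (\<lambda>\<xi>. u \<xi> *\<^sub>R \<Phi> \<xi> \<theta>) = Ex (\<lambda>\<xi>. u \<xi> *\<^sub>R D k (\<xi> k) \<xi> \<theta>)"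
      using \<Phi>_avg [OF kI _ \<theta>] by (subst red) (auto intro: Ex_cong)
    also have "\<dots> = (\<Sum>y\<in>Q. (p y * v y) *\<^sub>R Ex (\<lambda>\<xi>. u' \<xi> *\<^sub>R D k y \<xi> \<theta>))"
      unfolding u Ex_coord_split [OF k(1) ind_k, of v "\<lambda>\<xi>. D k (\<xi> k) \<xi> \<theta>"]
      using upd by (intro sum.cong refl arg_cong2 [where f = "(*\<^sub>R)"] Ex_cong) auto
    also have "\<dots> = (\<Sum>y\<in>Q. (p y * v y) *\<^sub>R Ex (\<lambda>\<xi>. u' \<xi> *\<^sub>R D'' k y \<xi> \<theta>))
        - (\<Sum>y\<in>Q. p y * v y) *\<^sub>R Ex (\<lambda>\<xi>. u' \<xi> *\<^sub>R (\<Sum>z\<in>Q. p z *\<^sub>R D'' k z \<xi> \<theta>))"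
      by (simp only: D_def scaleR_diff_right Ex_diff sum_subtractf scaleR_sum_left)
    also have "\<dots> = (\<Sum>y\<in>Q. (p y * v y) *\<^sub>R Ex (\<lambda>\<xi>. u' \<xi> *\<^sub>R D' \<xi> (enc \<theta> k y)))"
    proof -
      have "Ex (\<lambda>\<xi>. u' \<xi> *\<^sub>R D'' k y \<xi> \<theta>) = Ex (\<lambda>\<xi>. u' \<xi> *\<^sub>R D' \<xi> (enc \<theta> k y))" for y
        unfolding D''_def Ex_avg_adjoint by (intro Ex_cong) (simp add: avg_indep [OF ind_I])
      then show ?thesis by (simp add: v)
    qed
    also have "\<dots> = (\<Sum>y\<in>Q. (p y * v y) *\<^sub>R Ex (\<lambda>\<xi>. u' \<xi> *\<^sub>R increment I \<Phi>0 \<xi> (enc \<theta> k y)))"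
    proof (intro sum.cong refl arg_cong2 [where f = "(*\<^sub>R)"])
      fix y assume "y \<in> Q"
      then have "enc \<theta> k y \<in> ?\<Theta>" using \<theta> kI by (force simp: enc_set_def)
      then show "Ex (\<lambda>\<xi>. u' \<xi> *\<^sub>R D' \<xi> (enc \<theta> k y)) = Ex (\<lambda>\<xi>. u' \<xi> *\<^sub>R increment I \<Phi>0 \<xi> (enc \<theta> k y))"
        using D'_same u' unfolding same_on_def by blast
    qed
    also have "\<dots> = (\<Sum>y\<in>Q. (p y * v y) *\<^sub>R Ex (\<lambda>\<xi>. u' \<xi> *\<^sub>R avg (I - {k}) (\<lambda>\<xi>. \<Phi>0 \<xi> \<theta>) (\<xi>(k := y))))
        - (\<Sum>y\<in>Q. p y * v y) *\<^sub>R Ex (\<lambda>\<xi>. u' \<xi> *\<^sub>R avg I (\<lambda>\<xi>. \<Phi>0 \<xi> \<theta>) \<xi>)"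
      by (simp only: increment_def enc_inverse scaleR_diff_right Ex_diff sum_subtractf scaleR_sum_left)
    also have "\<dots> = Ex (\<lambda>\<xi>. u \<xi> *\<^sub>R avg (I - {k}) (\<lambda>\<xi>. \<Phi>0 \<xi> \<theta>) \<xi>)"
      unfolding u Ex_coord_split [OF k(1) ind_k, of v "avg (I - {k}) (\<lambda>\<xi>. \<Phi>0 \<xi> \<theta>)"] v by simp
    also have "\<dots> = Ex (\<lambda>\<xi>. u \<xi> *\<^sub>R \<Phi>0 \<xi> \<theta>)" by (rule red [symmetric])
    finally show "Ex (\<lambda>\<xi>. u \<xi> *\<^sub>R \<Phi> \<xi> \<theta>) = Ex (\<lambda>\<xi>. u \<xi> *\<^sub>R \<Phi>0 \<xi> \<theta>)" .
  qed
  moreover have const: "(16 * real K + 8) * (4 * c) = ext_const (Suc m) K * \<beta>"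
    by (simp add: c_def)
  ultimately show ?case using \<Phi>_bound unfolding const by blast
qed

end

section \<open>Joint extensions for products of boundedly many factors\<close>

lemma energy_sum_le:
  fixes u :: "'i \<Rightarrow> nat \<Rightarrow> 'v::real_inner"
  assumes "\<And>\<theta>. \<theta> \<in> \<Theta> \<Longrightarrow> 0 \<le> a \<theta>"
  shows "energy \<Theta> a (\<lambda>\<theta>. \<Sum>i\<in>D. u i \<theta>) \<le> card D * (\<Sum>i\<in>D. energy \<Theta> a (u i))"
proof -
  have "(norm (\<Sum>i\<in>D. u i \<theta>))\<^sup>2 \<le> card D * (\<Sum>i\<in>D. (norm (u i \<theta>))\<^sup>2)" for \<theta>
  proof -
    have "(norm (\<Sum>i\<in>D. u i \<theta>))\<^sup>2 \<le> (\<Sum>i\<in>D. norm (u i \<theta>))\<^sup>2"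
      by (intro power_mono norm_sum) auto
    also have "\<dots> \<le> (\<Sum>i\<in>D. (norm (u i \<theta>))\<^sup>2) * card D"
      by (rule sum_squared_le_sum_of_squares)
    finally show ?thesis by (simp add: mult.commute)
  qed
  then have "energy \<Theta> a (\<lambda>\<theta>. \<Sum>i\<in>D. u i \<theta>) \<le> (\<Sum>\<theta>\<in>\<Theta>. a \<theta> * (card D * (\<Sum>i\<in>D. (norm (u i \<theta>))\<^sup>2)))"
    unfolding energy_def using assms by (intro sum_mono mult_left_mono) auto
  also have "\<dots> = (\<Sum>\<theta>\<in>\<Theta>. \<Sum>i\<in>D. card D * (a \<theta> * (norm (u i \<theta>))\<^sup>2))"
    by (simp add: sum_distrib_left mult_ac)
  also have "\<dots> = (\<Sum>i\<in>D. \<Sum>\<theta>\<in>\<Theta>. card D * (a \<theta> * (norm (u i \<theta>))\<^sup>2))"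
    by (rule sum.swap)
  finally show ?thesis by (simp add: energy_def sum_distrib_left)
qed

text \<open>
  The inverse of the probability that a uniform random colouring with \<open>N\<close> colours is injective on \<open>N\<close>
  given coordinates. It does not depend on the number of coordinates.
\<close>

definition color_ratio :: "nat \<Rightarrow> real" where
  "color_ratio N = real (N ^ N) / fact N"

fun full_const :: "nat \<Rightarrow> nat \<Rightarrow> real" where
  "full_const 0 K = 1"
| "full_const (Suc N) K = 2 * full_const N K + 2 * (color_ratio (Suc N))\<^sup>2 *
     (4 ^ Suc N * (2 * ext_const (Suc N) K + 2 * full_const N K))"

lemma full_const_pos: "full_const N K > 0"
proof (induction N)
  case (Suc N)
  then show ?case
    using ext_const_pos [of "Suc N" K]
    by (auto intro!: add_pos_nonneg mult_nonneg_nonneg add_nonneg_nonneg simp: less_imp_le simp del: ext_const.simps)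
qed simp

context finite_power
begin

definition mean :: "(nat \<Rightarrow> real) \<Rightarrow> real" where
  "mean f = (\<Sum>y\<in>Q. p y * f y)"

definition few_coords :: "nat \<Rightarrow> ((nat \<Rightarrow> nat) \<Rightarrow> real) \<Rightarrow> bool" where
  "few_coords N u \<longleftrightarrow> (\<exists>S v. S \<subseteq> {..<n} \<and> card S \<le> N \<and> u = (\<lambda>\<xi>. \<Prod>i\<in>S. v i (\<xi> i)))"

definition block :: "(nat \<Rightarrow> nat) \<Rightarrow> nat \<Rightarrow> nat set" where
  "block \<delta> c = {i. i < n \<and> \<delta> i = c}"

text \<open>
  A product that misses one of the colours has pairing zero with a peeled function. This singles out the
  products that are injectively coloured.
\<close>

primrec peel :: "(nat \<Rightarrow> nat) \<Rightarrow> nat \<Rightarrow> ((nat \<Rightarrow> nat) \<Rightarrow> 'v::real_vector) \<Rightarrow> (nat \<Rightarrow> nat) \<Rightarrow> 'v" where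
  "peel \<delta> 0 f = f"
| "peel \<delta> (Suc c) f = (\<lambda>\<xi>. peel \<delta> c f \<xi> - avg (block \<delta> c) (peel \<delta> c f) \<xi>)"

lemma Ex_prod:
  assumes "S \<subseteq> {..<n}"
  shows "Ex (\<lambda>\<xi>. \<Prod>i\<in>S. v i (\<xi> i)) = (\<Prod>i\<in>S. mean (v i))"
proof -
  define g where "g = (\<lambda>i c. p c * (if i \<in> S then v i c else 1))"
  have "Ex (\<lambda>\<xi>. \<Prod>i\<in>S. v i (\<xi> i)) = (\<Sum>\<xi>\<in>X. \<Prod>i<n. g i (\<xi> i))"
    unfolding Ex_def
  proof (intro sum.cong refl)
    fix \<xi>
    have "(\<Prod>i<n. if i \<in> S then v i (\<xi> i) else 1) = (\<Prod>i\<in>S. v i (\<xi> i))"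
      using assms by (intro prod.mono_neutral_cong_right) auto
    then show "pw \<xi> *\<^sub>R (\<Prod>i\<in>S. v i (\<xi> i)) = (\<Prod>i<n. g i (\<xi> i))"
      by (simp add: g_def pw_def prod.distrib)
  qed
  also have "\<dots> = (\<Prod>i<n. \<Sum>c\<in>Q. g i c)"
    unfolding X_def by (rule prod_sum_PiE [symmetric]) (auto simp: finite_Q)
  also have "\<dots> = (\<Prod>i\<in>S. mean (v i))"
    using assms by (intro prod.mono_neutral_cong_right) (auto simp: g_def mean_def p_sum)
  finally show ?thesis .
qed

lemma avg_prod:
  assumes S: "S \<subseteq> {..<n}"
  shows "avg T (\<lambda>\<xi>. \<Prod>i\<in>S. v i (\<xi> i)) \<xi> = (\<Prod>i\<in>S \<inter> T. mean (v i)) * (\<Prod>i\<in>S - T. v i (\<xi> i))"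
proof -
  have fS: "finite S" using S finite_subset by blast
  have "(\<Prod>i\<in>S. v i (override_on \<xi> \<eta> T i)) = (\<Prod>i\<in>S - T. v i (\<xi> i)) * (\<Prod>i\<in>S \<inter> T. v i (\<eta> i))" for \<eta>
  proof -
    have "(\<Prod>i\<in>S. v i (override_on \<xi> \<eta> T i))
        = (\<Prod>i\<in>(S - T) \<union> (S \<inter> T). v i (override_on \<xi> \<eta> T i))"
      by (simp add: Un_Diff_Int)
    also have "\<dots> = (\<Prod>i\<in>S - T. v i (override_on \<xi> \<eta> T i)) * (\<Prod>i\<in>S \<inter> T. v i (override_on \<xi> \<eta> T i))"
      using fS by (intro prod.union_disjoint) auto
    finally show ?thesis by simp
  qed
  then show ?thesis unfolding avg_def using S by (simp add: Ex_mult_left Ex_prod le_infI1)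
qed

lemma Ex_peel_Suc:
  "Ex (\<lambda>\<xi>. u \<xi> *\<^sub>R peel \<delta> (Suc c) f \<xi>) =
    Ex (\<lambda>\<xi>. u \<xi> *\<^sub>R peel \<delta> c f \<xi>) - Ex (\<lambda>\<xi>. avg (block \<delta> c) u \<xi> *\<^sub>R peel \<delta> c f \<xi>)"
  by (simp add: scaleR_diff_right Ex_diff Ex_avg_adjoint)

lemma Ex_peel_missing_color:
  assumes "S \<subseteq> {..<n}" "c0 < c" "\<And>i. i \<in> S \<Longrightarrow> \<delta> i \<noteq> c0"
  shows "Ex (\<lambda>\<xi>. (\<Prod>i\<in>S. v i (\<xi> i)) *\<^sub>R peel \<delta> c f \<xi>) = 0"
  using assms
proof (induction c arbitrary: S)
  case (Suc c)
  show ?case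
  proof (cases "c0 = c")
    case True
    then have "S \<inter> block \<delta> c = {}" "S - block \<delta> c = S"
      using Suc.prems by (auto simp: block_def)
    then show ?thesis unfolding Ex_peel_Suc by (simp add: avg_prod Suc.prems)
  next
    case False
    have "Ex (\<lambda>\<xi>. (\<Prod>i\<in>S. v i (\<xi> i)) *\<^sub>R peel \<delta> c f \<xi>) = 0"
      "Ex (\<lambda>\<xi>. (\<Prod>i\<in>S - block \<delta> c. v i (\<xi> i)) *\<^sub>R peel \<delta> c f \<xi>) = 0"
      using False Suc.prems by (auto intro!: Suc.IH)
    then show ?thesis
      unfolding Ex_peel_Suc by (simp add: avg_prod Suc.prems Ex_scaleR flip: scaleR_scaleR)
  qed
qed simp

text \<open>
  If \<open>S\<close> has a single element of a colour, averaging over that class averages one factor only, so that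
  peeling centres this factor.
\<close>

lemma Ex_peel_rainbow:
  assumes "S \<subseteq> {..<n}" "\<And>c'. c' < c \<Longrightarrow> \<exists>!k. k \<in> S \<and> \<delta> k = c'"
  shows "Ex (\<lambda>\<xi>. (\<Prod>i\<in>S. v i (\<xi> i)) *\<^sub>R peel \<delta> c f \<xi>)
    = Ex (\<lambda>\<xi>. (\<Prod>i\<in>S. v i (\<xi> i) - (if \<delta> i < c then mean (v i) else 0)) *\<^sub>R f \<xi>)"
  using assms(2)
proof (induction c arbitrary: v)
  case (Suc c)
  have fS: "finite S" using assms(1) finite_subset by blast
  obtain k where k: "k \<in> S" "\<delta> k = c" and uniq: "\<And>i. i \<in> S \<Longrightarrow> \<delta> i = c \<Longrightarrow> i = k"
    using Suc.prems [of c] by auto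
  have B: "S \<inter> block \<delta> c = {k}" "S - block \<delta> c = S - {k}"
    using k assms(1) by (auto simp: block_def dest: uniq)
  define w where "w = v(k := (\<lambda>y. v k y - mean (v k)))"
  have "(\<Prod>i\<in>S. v i (\<xi> i)) - avg (block \<delta> c) (\<lambda>\<xi>. \<Prod>i\<in>S. v i (\<xi> i)) \<xi> = (\<Prod>i\<in>S. w i (\<xi> i))" for \<xi>
  proof -
    have rest: "(\<Prod>i\<in>S - {k}. w i (\<xi> i)) = (\<Prod>i\<in>S - {k}. v i (\<xi> i))"
      by (intro prod.cong) (auto simp: w_def)
    have "w k (\<xi> k) = v k (\<xi> k) - mean (v k)" by (simp add: w_def)
    then show ?thesis
      unfolding avg_prod [OF assms(1)] B unfolding prod.remove [OF fS k(1)] rest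
      by (simp add: left_diff_distrib)
  qed
  then have "Ex (\<lambda>\<xi>. (\<Prod>i\<in>S. v i (\<xi> i)) *\<^sub>R peel \<delta> (Suc c) f \<xi>)
      = Ex (\<lambda>\<xi>. (\<Prod>i\<in>S. w i (\<xi> i)) *\<^sub>R peel \<delta> c f \<xi>)"
    unfolding Ex_peel_Suc Ex_diff [symmetric] scaleR_diff_left [symmetric] by simp
  also have "\<dots> = Ex (\<lambda>\<xi>. (\<Prod>i\<in>S. w i (\<xi> i) - (if \<delta> i < c then mean (w i) else 0)) *\<^sub>R f \<xi>)"
    by (rule Suc.IH) (rule Suc.prems, simp)
  also have "\<dots> = Ex (\<lambda>\<xi>. (\<Prod>i\<in>S. v i (\<xi> i) - (if \<delta> i < Suc c then mean (v i) else 0)) *\<^sub>R f \<xi>)"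
  proof -
    have "w i y - (if \<delta> i < c then mean (w i) else 0) = v i y - (if \<delta> i < Suc c then mean (v i) else 0)"
      if "i \<in> S" for i y
    proof (cases "i = k")
      case True
      then show ?thesis using k by (simp add: w_def)
    next
      case False
      then have "\<delta> i \<noteq> c" using uniq that by blast
      then show ?thesis using False by (simp add: w_def less_Suc_eq)
    qed
    then show ?thesis by (intro Ex_cong arg_cong2 [where f = "(*\<^sub>R)"] prod.cong refl) auto
  qed
  finally show ?case .
qed simp

lemma rainbow_prod:
  assumes "S \<subseteq> {..<n}" "bij_betw \<delta> S {..<N}" "\<And>i. i \<in> S \<Longrightarrow> mean (v i) = 0"
  shows "rainbow \<delta> N (\<lambda>\<xi>. \<Prod>i\<in>S. v i (\<xi> i))"
  using assms
proof (induction N arbitrary: S)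
  case 0
  then have "S = {}" by (simp add: bij_betw_def)
  then show ?case by (simp add: rainbow_0)
next
  case (Suc N)
  have fS: "finite S" using Suc.prems(1) finite_subset by blast
  obtain k where k: "k \<in> S" "\<delta> k = N"
    using Suc.prems(2) by (auto simp: bij_betw_def image_iff set_eq_iff) (metis lessI)
  have "bij_betw \<delta> (S - {k}) ({..<Suc N} - {N})"
    using Suc.prems(2) k inj_on_image_set_diff [of \<delta> S S "{k}"]
    by (auto simp: bij_betw_def intro: inj_on_subset)
  moreover have "{..<Suc N} - {N} = {..<N}" by auto
  ultimately have "rainbow \<delta> N (\<lambda>\<xi>. \<Prod>i\<in>S - {k}. v i (\<xi> i))"
    using Suc.prems by (intro Suc.IH) auto
  then have "rainbow \<delta> (Suc N) (\<lambda>\<xi>. (\<Prod>i\<in>S - {k}. v i (\<xi> i)) * v k (\<xi> k))"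
    using k Suc.prems by (intro rainbow_Suc) (auto simp: mean_def)
  then show ?case using fS k by (simp add: prod.remove [of S k] mult.commute)
qed

lemma rainbow_is_prod:
  assumes "rainbow \<delta> N u"
  shows "\<exists>S v. S \<subseteq> {..<n} \<and> card S = N \<and> (\<forall>i\<in>S. \<delta> i < N) \<and> u = (\<lambda>\<xi>. \<Prod>i\<in>S. v i (\<xi> i))"
  using assms
proof (induction rule: rainbow.induct)
  case rainbow_0
  then show ?case by (intro exI [of _ "{}"]) auto
next
  case (rainbow_Suc m u k v)
  then obtain S w where S: "S \<subseteq> {..<n}" "card S = m" "\<forall>i\<in>S. \<delta> i < m"
    and u: "u = (\<lambda>\<xi>. \<Prod>i\<in>S. w i (\<xi> i))" by auto
  have kS: "k \<notin> S" using S(3) rainbow_Suc.hyps by auto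
  have fS: "finite S" using S(1) finite_subset by blast
  have "u \<xi> * v (\<xi> k) = (\<Prod>i\<in>insert k S. (w(k := v)) i (\<xi> i))" for \<xi>
  proof -
    have "(\<Prod>i\<in>S. (w(k := v)) i (\<xi> i)) = u \<xi>"
      unfolding u using kS by (intro prod.cong) auto
    then show ?thesis using fS kS by (simp add: mult.commute)
  qed
  then have eq: "(\<lambda>\<xi>. u \<xi> * v (\<xi> k)) = (\<lambda>\<xi>. \<Prod>i\<in>insert k S. (w(k := v)) i (\<xi> i))"
    by (rule ext)
  show ?case
  proof (intro exI conjI)
    show "insert k S \<subseteq> {..<n}" "card (insert k S) = Suc m" "\<forall>i\<in>insert k S. \<delta> i < Suc m"
      using S(1,2) kS fS rainbow_Suc.hyps(2,3) less_SucI S(3) by (simp_all, blast)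
  qed (rule eq)
qed

lemma rainbow_few_coords:
  assumes "rainbow \<delta> N u"
  shows "few_coords N u"
proof -
  obtain S v where "S \<subseteq> {..<n}" "card S = N" "u = (\<lambda>\<xi>. \<Prod>i\<in>S. v i (\<xi> i))"
    using rainbow_is_prod [OF assms] by blast
  then show ?thesis unfolding few_coords_def by (intro exI [of _ S] exI [of _ v]) simp
qed

lemma few_coords_mono:
  assumes "few_coords M u" "M \<le> N"
  shows "few_coords N u"
proof -
  obtain S v where "S \<subseteq> {..<n}" "card S \<le> M" "u = (\<lambda>\<xi>. \<Prod>i\<in>S. v i (\<xi> i))"
    using assms(1) unfolding few_coords_def by blast
  then show ?thesis unfolding few_coords_def using assms(2) by (intro exI [of _ S] exI [of _ v]) simp
qed

lemma same_on_mono: "same_on U \<Theta> \<Psi> \<Phi> \<Longrightarrow> (\<And>u. V u \<Longrightarrow> U u) \<Longrightarrow> same_on V \<Theta> \<Psi> \<Phi>"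
  unfolding same_on_def by blast

lemma same_on_rainbow:
  "same_on (few_coords N) \<Theta> \<Psi> \<Phi> \<Longrightarrow> same_on (rainbow \<delta> N) \<Theta> \<Psi> \<Phi>"
  by (erule same_on_mono) (rule rainbow_few_coords)

lemma same_on_few_mono:
  "same_on (few_coords N) \<Theta> \<Psi> \<Phi> \<Longrightarrow> M \<le> N \<Longrightarrow> same_on (few_coords M) \<Theta> \<Psi> \<Phi>"
  by (erule same_on_mono) (rule few_coords_mono)

text \<open>Modulo fewer factors, centring the factors of a product changes nothing.\<close>

lemma Ex_prod_centred:
  fixes H :: "(nat \<Rightarrow> nat) \<Rightarrow> 'v::real_vector"
  assumes S: "S \<subseteq> {..<n}" "card S = Suc N"
    and H: "\<And>u. few_coords N u \<Longrightarrow> Ex (\<lambda>\<xi>. u \<xi> *\<^sub>R H \<xi>) = 0"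
  shows "Ex (\<lambda>\<xi>. (\<Prod>i\<in>S. v i (\<xi> i) - e i) *\<^sub>R H \<xi>) = Ex (\<lambda>\<xi>. (\<Prod>i\<in>S. v i (\<xi> i)) *\<^sub>R H \<xi>)"
proof -
  have fS: "finite S" using S finite_subset by blast
  have "(\<Prod>i\<in>S. v i (\<xi> i) - e i) = (\<Sum>A\<in>Pow S. (\<Prod>i\<in>S - A. - e i) * (\<Prod>i\<in>A. v i (\<xi> i)))" for \<xi>
    using prod_add [OF fS, of "\<lambda>i. v i (\<xi> i)" "\<lambda>i. - e i"] by (simp add: mult.commute)
  then have "Ex (\<lambda>\<xi>. (\<Prod>i\<in>S. v i (\<xi> i) - e i) *\<^sub>R H \<xi>)
      = (\<Sum>A\<in>Pow S. (\<Prod>i\<in>S - A. - e i) *\<^sub>R Ex (\<lambda>\<xi>. (\<Prod>i\<in>A. v i (\<xi> i)) *\<^sub>R H \<xi>))"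
    by (simp add: scaleR_sum_left Ex_sum flip: Ex_scaleR)
  also have "\<dots> = (\<Sum>A\<in>{S}. (\<Prod>i\<in>S - A. - e i) *\<^sub>R Ex (\<lambda>\<xi>. (\<Prod>i\<in>A. v i (\<xi> i)) *\<^sub>R H \<xi>))"
  proof (rule sum.mono_neutral_right)
    show "\<forall>A\<in>Pow S - {S}. (\<Prod>i\<in>S - A. - e i) *\<^sub>R Ex (\<lambda>\<xi>. (\<Prod>i\<in>A. v i (\<xi> i)) *\<^sub>R H \<xi>) = 0"
    proof
      fix A assume A: "A \<in> Pow S - {S}"
      then have "A \<subset> S" by auto
      then have "card A < Suc N" using psubset_card_mono [OF fS, of A] S by simp
      then have "few_coords N (\<lambda>\<xi>. \<Prod>i\<in>A. v i (\<xi> i))"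
        unfolding few_coords_def using A S by (intro exI [of _ A] exI [of _ v]) auto
      then show "(\<Prod>i\<in>S - A. - e i) *\<^sub>R Ex (\<lambda>\<xi>. (\<Prod>i\<in>A. v i (\<xi> i)) *\<^sub>R H \<xi>) = 0"
        by (simp add: H)
    qed
  qed (use fS in auto)
  finally show ?thesis by simp
qed

lemma energy_peel_le:
  fixes g :: "(nat \<Rightarrow> nat) \<Rightarrow> nat \<Rightarrow> 'v::real_inner"
  assumes "\<And>\<theta>. \<theta> \<in> \<Theta> \<Longrightarrow> 0 \<le> a \<theta>" "\<And>\<xi>. \<xi> \<in> X \<Longrightarrow> energy \<Theta> a (g \<xi>) \<le> b" "\<xi> \<in> X"
  shows "energy \<Theta> a (\<lambda>\<theta>. peel \<delta> c (\<lambda>\<xi>. g \<xi> \<theta>) \<xi>) \<le> 4 ^ c * b"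
  using assms(3)
proof (induction c arbitrary: \<xi>)
  case 0
  then show ?case using assms by simp
next
  case (Suc c)
  let ?h = "\<lambda>\<xi> \<theta>. peel \<delta> c (\<lambda>\<xi>. g \<xi> \<theta>) \<xi>"
  have "energy \<Theta> a (\<lambda>\<theta>. peel \<delta> (Suc c) (\<lambda>\<xi>. g \<xi> \<theta>) \<xi>)
      \<le> 2 * energy \<Theta> a (?h \<xi>) + 2 * energy \<Theta> a (\<lambda>\<theta>. avg (block \<delta> c) (\<lambda>\<xi>. ?h \<xi> \<theta>) \<xi>)"
    unfolding peel.simps by (rule energy_add_le(2)) (rule assms(1))
  also have "energy \<Theta> a (\<lambda>\<theta>. avg (block \<delta> c) (\<lambda>\<xi>. ?h \<xi> \<theta>) \<xi>) \<le> 4 ^ c * b"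
    using Suc by (intro energy_avg_le_const assms(1)) auto
  also have "energy \<Theta> a (?h \<xi>) \<le> 4 ^ c * b" using Suc by simp
  finally show ?case by (simp add: mult_ac)
qed

lemma card_rainbow_colorings:
  assumes "S \<subseteq> {..<n}" "card S = N"
  shows "card {\<delta> \<in> {..<n} \<rightarrow>\<^sub>E {..<N}. inj_on \<delta> S} = N ^ (n - N) * fact N"
  using card_inj_on_subset_funcset [of "{..<n}" "{..<N}" S] assms
  by (simp add: fact_prod_rev)

text \<open>
  The reduction to rainbow tests, by induction on the number \<open>N\<close> of factors. Let \<open>\<Psi>'\<close> be the extension
  for fewer than \<open>N\<close> factors and \<open>\<Psi> \<delta>\<close> that for the rainbow tests of a colouring \<open>\<delta>\<close>. After peeling,
  \<open>\<Psi> \<delta> - \<Psi>'\<close> is invisible to products with fewer than \<open>N\<close> factors and to those with \<open>N\<close> factors whose coordinates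
  are not coloured injectively; against the other products it supplies the missing pairing. A fixed
  proportion of all colourings is injective on \<open>N\<close> given coordinates, so a multiple of the average over
  \<open>\<delta>\<close> corrects \<open>\<Psi>'\<close>.
\<close>

lemma joint_extension:
  fixes \<Phi>0 :: "(nat \<Rightarrow> nat) \<Rightarrow> nat \<Rightarrow> 'v::real_inner"
  assumes A: "constraints \<Theta> A K" and K: "K \<ge> 1" and \<beta>: "\<beta> > 0"
    and "\<And>a. a \<in> A \<Longrightarrow> \<exists>\<Psi>. same_on (few_coords N) \<Theta> \<Psi> \<Phi>0 \<and> (\<forall>\<xi>\<in>X. energy \<Theta> a (\<Psi> \<xi>) \<le> \<beta>)"
  shows "\<exists>\<Phi>. same_on (few_coords N) \<Theta> \<Phi> \<Phi>0 \<and> (\<forall>a\<in>A. \<forall>\<xi>\<in>X. energy \<Theta> a (\<Phi> \<xi>) \<le> full_const N K * \<beta>)"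
  using assms(4)
proof (induction N)
  case 0
  define \<Phi> where "\<Phi> = (\<lambda>\<xi> :: nat \<Rightarrow> nat. \<lambda>\<theta>. Ex (\<lambda>\<xi>. \<Phi>0 \<xi> \<theta>))"
  have few0: "few_coords 0 u \<longleftrightarrow> u = (\<lambda>_. 1)" for u
  proof -
    have "card S = 0 \<longleftrightarrow> S = {}" if "S \<subseteq> {..<n}" for S :: "nat set"
      using that finite_subset by (auto simp: card_eq_0_iff)
    then show ?thesis by (auto simp: few_coords_def)
  qed
  have "\<forall>a\<in>A. energy \<Theta> a (\<lambda>\<theta>. Ex (\<lambda>\<xi>. \<Phi>0 \<xi> \<theta>)) \<le> \<beta>"
    using 0 by (intro joint_extension_of_mean [OF A]) (auto simp: same_on_def few0)
  moreover have "same_on (few_coords 0) \<Theta> \<Phi> \<Phi>0"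
    by (auto simp: same_on_def few0 \<Phi>_def)
  ultimately show ?case by (intro exI [of _ \<Phi>]) (auto simp: \<Phi>_def)
next
  case (Suc M)
  let ?N = "Suc M"
  have a0: "\<And>a \<theta>. a \<in> A \<Longrightarrow> \<theta> \<in> \<Theta> \<Longrightarrow> 0 \<le> a \<theta>" using A by (auto simp: constraints_def)
  have "\<exists>\<Psi>. same_on (few_coords M) \<Theta> \<Psi> \<Phi>0 \<and> (\<forall>\<xi>\<in>X. energy \<Theta> a (\<Psi> \<xi>) \<le> \<beta>)" if "a \<in> A" for a
    using Suc.prems [OF that] same_on_few_mono [of ?N] by (meson le_SucI order_refl)
  then obtain \<Psi>' where \<Psi>'_same: "same_on (few_coords M) \<Theta> \<Psi>' \<Phi>0"
    and \<Psi>'_bound: "\<And>a \<xi>. a \<in> A \<Longrightarrow> \<xi> \<in> X \<Longrightarrow> energy \<Theta> a (\<Psi>' \<xi>) \<le> full_const M K * \<beta>"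
    using Suc.IH by blast
  have "\<exists>\<Phi>. same_on (rainbow \<delta> ?N) \<Theta> \<Phi> \<Phi>0 \<and> (\<forall>a\<in>A. \<forall>\<xi>\<in>X. energy \<Theta> a (\<Phi> \<xi>) \<le> ext_const ?N K * \<beta>)" for \<delta>
    using Suc.prems same_on_rainbow by (intro rainbow_joint_extension [OF A K \<beta>]) blast
  then obtain \<Psi> where \<Psi>_same: "\<And>\<delta>. same_on (rainbow \<delta> ?N) \<Theta> (\<Psi> \<delta>) \<Phi>0"
    and \<Psi>_bound: "\<And>\<delta> a \<xi>. a \<in> A \<Longrightarrow> \<xi> \<in> X \<Longrightarrow> energy \<Theta> a (\<Psi> \<delta> \<xi>) \<le> ext_const ?N K * \<beta>"
    by metis
  define \<Delta> where "\<Delta> = {..<n} \<rightarrow>\<^sub>E {..<?N}"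
  have card_\<Delta>: "card \<Delta> = ?N ^ n" and fin_\<Delta>: "finite \<Delta>"
    by (auto simp: \<Delta>_def card_funcsetE intro: finite_PiE)
  define \<kappa> :: real where "\<kappa> = (if ?N \<le> n then 1 / (real (?N ^ (n - ?N)) * fact ?N) else 0)"
  have \<kappa>: "0 \<le> \<kappa> * card \<Delta>" "\<kappa> * card \<Delta> \<le> color_ratio ?N"
  proof -
    show "0 \<le> \<kappa> * card \<Delta>" by (simp add: \<kappa>_def)
    show "\<kappa> * card \<Delta> \<le> color_ratio ?N"
    proof (cases "?N \<le> n")
      case True
      then have "real ?N ^ n = real ?N ^ (n - ?N) * real ?N ^ ?N" by (metis power_add le_add_diff_inverse2)
      then have "\<kappa> * card \<Delta> = real ?N ^ (n - ?N) * real ?N ^ ?N / (real ?N ^ (n - ?N) * fact ?N)"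
        using True unfolding \<kappa>_def card_\<Delta> of_nat_power by simp
      also have "\<dots> = color_ratio ?N"
        unfolding color_ratio_def of_nat_power by (rule mult_divide_mult_cancel_left) simp
      finally show ?thesis by simp
    qed (simp add: \<kappa>_def color_ratio_def)
  qed
  define G where "G = (\<lambda>\<delta> \<xi> \<theta>. peel \<delta> ?N (\<lambda>\<xi>. \<Psi> \<delta> \<xi> \<theta> - \<Psi>' \<xi> \<theta>) \<xi>)"
  define \<Phi> where "\<Phi> = (\<lambda>\<xi> \<theta>. \<Psi>' \<xi> \<theta> + \<kappa> *\<^sub>R (\<Sum>\<delta>\<in>\<Delta>. G \<delta> \<xi> \<theta>))"
  have "same_on (few_coords ?N) \<Theta> \<Phi> \<Phi>0"
    unfolding same_on_def
  proof (intro allI impI ballI)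
    fix u \<theta> assume "few_coords ?N u" and \<theta>: "\<theta> \<in> \<Theta>"
    then obtain S v where S: "S \<subseteq> {..<n}" "card S \<le> ?N" and u: "u = (\<lambda>\<xi>. \<Prod>i\<in>S. v i (\<xi> i))"
      by (auto simp: few_coords_def)
    have fS: "finite S" using S finite_subset by blast
    have split: "Ex (\<lambda>\<xi>. u \<xi> *\<^sub>R \<Phi> \<xi> \<theta>)
        = Ex (\<lambda>\<xi>. u \<xi> *\<^sub>R \<Psi>' \<xi> \<theta>) + \<kappa> *\<^sub>R (\<Sum>\<delta>\<in>\<Delta>. Ex (\<lambda>\<xi>. u \<xi> *\<^sub>R G \<delta> \<xi> \<theta>))"
    proof -
      have "u \<xi> *\<^sub>R \<Phi> \<xi> \<theta> = u \<xi> *\<^sub>R \<Psi>' \<xi> \<theta> + \<kappa> *\<^sub>R (\<Sum>\<delta>\<in>\<Delta>. u \<xi> *\<^sub>R G \<delta> \<xi> \<theta>)" for \<xi>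
        unfolding \<Phi>_def scaleR_add_right scaleR_sum_right [symmetric] by (simp add: mult.commute)
      then show ?thesis by (simp only: Ex_add Ex_scaleR Ex_sum)
    qed
    have zero: "Ex (\<lambda>\<xi>. u \<xi> *\<^sub>R G \<delta> \<xi> \<theta>) = 0" if "\<delta> \<in> \<Delta>" "card (\<delta> ` S) < ?N" for \<delta>
    proof -
      have "\<not> {..<?N} \<subseteq> \<delta> ` S"
        using that(2) card_mono [of "\<delta> ` S" "{..<?N}"] fS by auto
      then obtain c0 where "c0 < ?N" "c0 \<notin> \<delta> ` S" by auto
      then show ?thesis unfolding u G_def using S by (intro Ex_peel_missing_color) auto
    qed
    have diff0: "Ex (\<lambda>\<xi>. w \<xi> *\<^sub>R (\<Phi>0 \<xi> \<theta> - \<Psi>' \<xi> \<theta>)) = 0" if "few_coords M w" for w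
      using \<Psi>'_same that \<theta> unfolding same_on_def by (simp add: scaleR_diff_right Ex_diff)
    show "Ex (\<lambda>\<xi>. u \<xi> *\<^sub>R \<Phi> \<xi> \<theta>) = Ex (\<lambda>\<xi>. u \<xi> *\<^sub>R \<Phi>0 \<xi> \<theta>)"
    proof (cases "card S = ?N")
      case False
      then have cS: "card S \<le> M" using S by simp
      then have "few_coords M u" using S u by (auto simp: few_coords_def)
      then have "Ex (\<lambda>\<xi>. u \<xi> *\<^sub>R \<Psi>' \<xi> \<theta>) = Ex (\<lambda>\<xi>. u \<xi> *\<^sub>R \<Phi>0 \<xi> \<theta>)"
        using \<Psi>'_same \<theta> unfolding same_on_def by blast
      moreover have "card (\<delta> ` S) < ?N" for \<delta> :: "nat \<Rightarrow> nat"
        using card_image_le [OF fS, of \<delta>] cS by simp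
      then have "(\<Sum>\<delta>\<in>\<Delta>. Ex (\<lambda>\<xi>. u \<xi> *\<^sub>R G \<delta> \<xi> \<theta>)) = 0"
        using zero by (intro sum.neutral ballI) auto
      ultimately show ?thesis unfolding split by simp
    next
      case True
      then have "?N \<le> n" using card_mono [of "{..<n}" S] S by simp
      let ?R = "{\<delta> \<in> \<Delta>. inj_on \<delta> S}"
      have rb: "Ex (\<lambda>\<xi>. u \<xi> *\<^sub>R G \<delta> \<xi> \<theta>) = Ex (\<lambda>\<xi>. u \<xi> *\<^sub>R (\<Phi>0 \<xi> \<theta> - \<Psi>' \<xi> \<theta>))" if \<delta>: "\<delta> \<in> ?R" for \<delta>
      proof -
        have img: "\<delta> ` S \<subseteq> {..<?N}" using \<delta> S by (auto simp: \<Delta>_def)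
        moreover have "card (\<delta> ` S) = ?N" using \<delta> True by (simp add: card_image)
        ultimately have "\<delta> ` S = {..<?N}" by (intro card_subset_eq) auto
        then have bij: "bij_betw \<delta> S {..<?N}" using \<delta> by (simp add: bij_betw_def)
        have ex1: "\<exists>!k. k \<in> S \<and> \<delta> k = c'" if "c' < ?N" for c'
          using bij that unfolding bij_betw_def inj_on_def by (metis imageE lessThan_iff)
        define w where "w = (\<lambda>i y. v i y - mean (v i))"
        have "mean (w i) = 0" for i
        proof -
          have "mean (w i) = mean (v i) - (\<Sum>y\<in>Q. p y) * mean (v i)"
            unfolding w_def mean_def [of "\<lambda>y. v i y - mean (v i)"]
            by (simp add: right_diff_distrib sum_subtractf mean_def sum_distrib_right)
          then show ?thesis by (simp add: p_sum)
        qed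
        then have rbw: "rainbow \<delta> ?N (\<lambda>\<xi>. \<Prod>i\<in>S. w i (\<xi> i))"
          by (intro rainbow_prod S bij)
        have "Ex (\<lambda>\<xi>. u \<xi> *\<^sub>R G \<delta> \<xi> \<theta>) = Ex (\<lambda>\<xi>. (\<Prod>i\<in>S. w i (\<xi> i)) *\<^sub>R (\<Psi> \<delta> \<xi> \<theta> - \<Psi>' \<xi> \<theta>))"
        proof -
          have "(\<Prod>i\<in>S. v i (\<xi> i) - (if \<delta> i < ?N then mean (v i) else 0)) = (\<Prod>i\<in>S. w i (\<xi> i))" for \<xi>
            using img by (intro prod.cong) (auto simp: w_def image_subset_iff)
          then show ?thesis unfolding u G_def using Ex_peel_rainbow [where c = ?N and v = v, OF S(1) ex1] by (simp del: peel.simps)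
        qed
        also have "\<dots> = Ex (\<lambda>\<xi>. (\<Prod>i\<in>S. w i (\<xi> i)) *\<^sub>R (\<Phi>0 \<xi> \<theta> - \<Psi>' \<xi> \<theta>))"
          using \<Psi>_same rbw \<theta> by (simp add: scaleR_diff_right Ex_diff same_on_def)
        also have "\<dots> = Ex (\<lambda>\<xi>. u \<xi> *\<^sub>R (\<Phi>0 \<xi> \<theta> - \<Psi>' \<xi> \<theta>))"
          unfolding u w_def by (rule Ex_prod_centred [OF S(1) True diff0])
        finally show ?thesis .
      qed
      have "Ex (\<lambda>\<xi>. u \<xi> *\<^sub>R G \<delta> \<xi> \<theta>) = 0" if "\<delta> \<in> \<Delta> - ?R" for \<delta>
      proof (rule zero)
        have "card (\<delta> ` S) \<noteq> card S" using that fS eq_card_imp_inj_on by blast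
        then show "card (\<delta> ` S) < ?N" using card_image_le [OF fS, of \<delta>] True by simp
      qed (use that in auto)
      then have "(\<Sum>\<delta>\<in>\<Delta>. Ex (\<lambda>\<xi>. u \<xi> *\<^sub>R G \<delta> \<xi> \<theta>)) = (\<Sum>\<delta>\<in>?R. Ex (\<lambda>\<xi>. u \<xi> *\<^sub>R G \<delta> \<xi> \<theta>))"
        using fin_\<Delta> by (intro sum.mono_neutral_right) auto
      also have "\<dots> = real (card ?R) *\<^sub>R Ex (\<lambda>\<xi>. u \<xi> *\<^sub>R (\<Phi>0 \<xi> \<theta> - \<Psi>' \<xi> \<theta>))"
        using rb by (simp add: scaleR_conv_of_real flip: sum_constant_scaleR)
      finally have "\<kappa> *\<^sub>R (\<Sum>\<delta>\<in>\<Delta>. Ex (\<lambda>\<xi>. u \<xi> *\<^sub>R G \<delta> \<xi> \<theta>)) = Ex (\<lambda>\<xi>. u \<xi> *\<^sub>R (\<Phi>0 \<xi> \<theta> - \<Psi>' \<xi> \<theta>))"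
        using card_rainbow_colorings [OF S(1) True] \<open>?N \<le> n\<close> by (simp add: \<Delta>_def \<kappa>_def del: fact_Suc)
      then show ?thesis unfolding split by (simp add: scaleR_diff_right Ex_diff)
    qed
  qed
  moreover have "energy \<Theta> a (\<Phi> \<xi>) \<le> full_const ?N K * \<beta>" if a: "a \<in> A" and \<xi>: "\<xi> \<in> X" for a \<xi>
  proof -
    define b where "b = 4 ^ ?N * (2 * (ext_const ?N K * \<beta>) + 2 * (full_const M K * \<beta>))"
    have b0: "0 \<le> b"
      using ext_const_pos [of ?N K] full_const_pos [of M K] \<beta> unfolding b_def
      by (intro mult_nonneg_nonneg add_nonneg_nonneg) auto
    have "energy \<Theta> a (\<lambda>\<theta>. \<Psi> \<delta> \<zeta> \<theta> - \<Psi>' \<zeta> \<theta>) \<le> 2 * (ext_const ?N K * \<beta>) + 2 * (full_const M K * \<beta>)"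
      if "\<zeta> \<in> X" for \<delta> \<zeta>
      using energy_add_le(2) [of \<Theta> a "\<Psi> \<delta> \<zeta>" "\<Psi>' \<zeta>"] a0 a \<Psi>_bound [OF a that, of \<delta>] \<Psi>'_bound [OF a that]
      by fastforce
    then have G: "energy \<Theta> a (G \<delta> \<xi>) \<le> b" for \<delta>
      unfolding G_def b_def using a0 a \<xi>
        energy_peel_le [where g = "\<lambda>\<xi> \<theta>. \<Psi> \<delta> \<xi> \<theta> - \<Psi>' \<xi> \<theta>" and c = ?N and \<delta> = \<delta>] by blast
    have "energy \<Theta> a (\<lambda>\<theta>. \<Sum>\<delta>\<in>\<Delta>. G \<delta> \<xi> \<theta>) \<le> card \<Delta> * (\<Sum>\<delta>\<in>\<Delta>. energy \<Theta> a (G \<delta> \<xi>))"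
      using a0 a by (intro energy_sum_le) auto
    also have "\<dots> \<le> card \<Delta> * (card \<Delta> * b)"
      using G sum_mono [of \<Delta> "\<lambda>\<delta>. energy \<Theta> a (G \<delta> \<xi>)" "\<lambda>_. b"] by (intro mult_left_mono) auto
    finally have "\<kappa>\<^sup>2 * energy \<Theta> a (\<lambda>\<theta>. \<Sum>\<delta>\<in>\<Delta>. G \<delta> \<xi> \<theta>) \<le> \<kappa>\<^sup>2 * (card \<Delta> * (card \<Delta> * b))"
      by (intro mult_left_mono) auto
    also have "\<dots> = (\<kappa> * card \<Delta>)\<^sup>2 * b" by (simp add: power2_eq_square)
    also have "\<dots> \<le> (color_ratio ?N)\<^sup>2 * b"
      using \<kappa> b0 by (intro mult_right_mono power_mono) auto
    finally have "energy \<Theta> a (\<lambda>\<theta>. \<kappa> *\<^sub>R (\<Sum>\<delta>\<in>\<Delta>. G \<delta> \<xi> \<theta>)) \<le> (color_ratio ?N)\<^sup>2 * b"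
      unfolding energy_scaleR .
    moreover have "energy \<Theta> a (\<Phi> \<xi>)
        \<le> 2 * energy \<Theta> a (\<Psi>' \<xi>) + 2 * energy \<Theta> a (\<lambda>\<theta>. \<kappa> *\<^sub>R (\<Sum>\<delta>\<in>\<Delta>. G \<delta> \<xi> \<theta>))"
      unfolding \<Phi>_def using a0 a by (intro energy_add_le(1)) auto
    moreover have "energy \<Theta> a (\<Psi>' \<xi>) \<le> full_const M K * \<beta>" by (rule \<Psi>'_bound [OF a \<xi>])
    ultimately have "energy \<Theta> a (\<Phi> \<xi>) \<le> 2 * (full_const M K * \<beta>) + 2 * ((color_ratio ?N)\<^sup>2 * b)"
      by linarith
    also have "\<dots> = full_const ?N K * \<beta>"
      unfolding full_const.simps b_def by (simp only: distrib_left distrib_right mult_ac)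
    finally show ?thesis .
  qed
  ultimately show ?case by blast
qed

end

section \<open>The finite form of the duality argument\<close>

lemma DERIV_sqrt_quadratic:
  fixes a b c :: real
  assumes "a > 0"
  shows "((\<lambda>\<tau>. sqrt (a + 2 * \<tau> * b + \<tau>\<^sup>2 * c)) has_real_derivative b / sqrt a) (at 0)"
  using assms by (auto intro!: derivative_eq_intros simp: field_simps)

text \<open>Pairing with the gradient of the smoothed norm recovers the norm up to \<open>\<eta>\<close>.\<close>

lemma norm_le_smoothed:
  fixes r \<eta> :: real
  assumes "r \<ge> 0" "\<eta> > 0"
  shows "r \<le> r\<^sup>2 / sqrt (\<eta>\<^sup>2 + r\<^sup>2) + \<eta>"
proof -
  define s where "s = sqrt (\<eta>\<^sup>2 + r\<^sup>2)"
  have s: "s > 0" using assms by (auto simp: s_def intro!: real_sqrt_gt_zero add_pos_nonneg)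
  have s_le: "s \<le> \<eta> + r" using assms unfolding s_def by (intro real_le_lsqrt) (auto simp: power2_sum)
  have "(r - \<eta>) * s \<le> r\<^sup>2"
  proof (cases "r \<ge> \<eta>")
    case True
    then have "(r - \<eta>) * s \<le> (r - \<eta>) * (\<eta> + r)" using s_le by (intro mult_left_mono) auto
    also have "\<dots> \<le> r\<^sup>2" by (simp add: algebra_simps power2_eq_square)
    finally show ?thesis .
  next
    case False
    then have "(r - \<eta>) * s \<le> 0" using s by (intro mult_nonpos_nonneg) auto
    then show ?thesis using zero_le_power2 [of r] by linarith
  qed
  then have "r - \<eta> \<le> r\<^sup>2 / s" using s by (simp add: field_simps)
  then show ?thesis by (simp add: s_def)
qed

lemma compact_functions_bounded_on:
  fixes R :: real
  shows "compact {g :: 'i \<Rightarrow> 'v::euclidean_space. (\<forall>z\<in>Z. norm (g z) \<le> R) \<and> (\<forall>z. z \<notin> Z \<longrightarrow> g z = 0)}"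
proof -
  have "compactin (product_topology (\<lambda>_ :: 'i. euclidean :: 'v topology) UNIV)
      (\<Pi>\<^sub>E z\<in>UNIV. if z \<in> Z then cball 0 R else {0})"
    unfolding compactin_PiE by (auto simp: compactin_euclidean_iff)
  moreover have "(\<Pi>\<^sub>E z\<in>UNIV. if z \<in> Z then cball 0 R else {0 :: 'v})
      = {g. (\<forall>z\<in>Z. norm (g z) \<le> R) \<and> (\<forall>z. z \<notin> Z \<longrightarrow> g z = 0)}"
    by (force simp: PiE_iff split: if_splits)
  ultimately show ?thesis
    by (simp add: euclidean_product_topology compactin_euclidean_iff)
qed

context finite_power
begin

text \<open>
  The component belonging exactly to the coordinates in \<open>S\<close>, in the decomposition of \<open>f\<close> by Moebius
  inversion of its conditional expectations. The vanishing of the components of large \<open>S\<close> describes the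
  span of the functions of few coordinates by equations, which makes it visibly closed.
\<close>

definition pure_part :: "nat set \<Rightarrow> ((nat \<Rightarrow> nat) \<Rightarrow> 'k::{real_normed_field,euclidean_space}) \<Rightarrow> (nat \<Rightarrow> nat) \<Rightarrow> 'k" where
  "pure_part S f \<xi> = (-1) ^ card S * (\<Sum>A\<in>Pow S. (-1) ^ card A * avg (- A) f \<xi>)"

lemma sum_pure_part:
  assumes "\<xi> \<in> X"
  shows "(\<Sum>S\<in>Pow {..<n}. pure_part S f \<xi>) = f \<xi>"
proof -
  have "(\<Sum>S\<in>Pow {..<n}. pure_part S f \<xi>) = avg (- {..<n}) f \<xi>"
    unfolding pure_part_def
    by (rule inclusion_exclusion_symmetric [symmetric]) auto
  also have "\<dots> = f \<xi>"
  proof -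
    have "override_on \<xi> \<eta> (- {..<n}) = \<xi>" if "\<eta> \<in> X" for \<eta>
      using assms that by (auto simp: X_def PiE_iff extensional_def override_on_def fun_eq_iff)
    then have "avg (- {..<n}) f \<xi> = Ex (\<lambda>_. f \<xi>)"
      unfolding avg_def by (intro Ex_cong) simp
    then show ?thesis by simp
  qed
  finally show ?thesis .
qed

lemma pure_part_cong_coords:
  assumes "\<And>i. i \<in> S \<Longrightarrow> \<xi> i = \<xi>' i"
  shows "pure_part S f \<xi> = pure_part S f \<xi>'"
proof -
  have "avg (- A) f \<xi> = avg (- A) f \<xi>'" if "A \<subseteq> S" for A
  proof -
    have "override_on \<xi> \<eta> (- A) = override_on \<xi>' \<eta> (- A)" for \<eta> :: "nat \<Rightarrow> nat"
      using assms that by (auto simp: override_on_def fun_eq_iff)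
    then show ?thesis by (simp add: avg_def)
  qed
  then show ?thesis unfolding pure_part_def by (intro arg_cong2 [where f = "(*)"] sum.cong) auto
qed

lemma pure_part_cong:
  "\<xi> \<in> X \<Longrightarrow> (\<And>\<xi>. \<xi> \<in> X \<Longrightarrow> f \<xi> = g \<xi>) \<Longrightarrow> pure_part S f \<xi> = pure_part S g \<xi>"
  unfolding pure_part_def using avg_cong [of \<xi> f g] by simp

lemma pure_part_diff: "pure_part S (\<lambda>\<xi>. f \<xi> - g \<xi>) \<xi> = pure_part S f \<xi> - pure_part S g \<xi>"
  unfolding pure_part_def by (simp add: avg_diff right_diff_distrib sum_subtractf)

lemma pure_part_add: "pure_part S (\<lambda>\<xi>. f \<xi> + g \<xi>) \<xi> = pure_part S f \<xi> + pure_part S g \<xi>"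
  unfolding pure_part_def by (simp add: avg_add distrib_left sum.distrib)

lemma pure_part_scaleR: "pure_part S (\<lambda>\<xi>. c *\<^sub>R f \<xi>) \<xi> = c *\<^sub>R pure_part S f \<xi>"
  unfolding pure_part_def by (simp add: avg_scaleR flip: scaleR_sum_right)

lemma pure_part_0: "pure_part S (\<lambda>\<xi>. 0) \<xi> = 0"
  unfolding pure_part_def by simp

lemma pure_part_sum: "pure_part S (\<lambda>\<xi>. \<Sum>k\<in>K. f k \<xi>) \<xi> = (\<Sum>k\<in>K. pure_part S (f k) \<xi>)"
  by (induction K rule: infinite_finite_induct) (auto simp: pure_part_0 pure_part_add)

lemma pure_part_eq_0:
  fixes f :: "(nat \<Rightarrow> nat) \<Rightarrow> 'k::{real_normed_field,euclidean_space}"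
  assumes k: "k \<in> S" "finite S" and ind: "indep {k} f" and \<xi>: "\<xi> \<in> X"
  shows "pure_part S f \<xi> = 0"
proof -
  define h where "h = (\<lambda>A. (-1) ^ card A * avg (- A) f \<xi>)"
  have "avg (- insert k A) f \<xi> = avg (- A) f \<xi>" if "A \<subseteq> S - {k}" for A
  proof -
    have "- insert k A \<union> {k} = - A" using that by auto
    then show ?thesis using avg_indep_absorb [OF ind \<xi>, of "- insert k A"] by simp
  qed
  then have "h (insert k A) = - h A" if "A \<in> Pow (S - {k})" for A
    using that k finite_subset [of A S] by (subst (1) h_def, subst card_insert_disjoint) (auto simp: h_def)
  then have "(\<Sum>A\<in>insert k ` Pow (S - {k}). h A) = - (\<Sum>A\<in>Pow (S - {k}). h A)"
    by (subst sum.reindex) (auto simp: inj_on_def sum_negf [symmetric] intro!: sum.cong)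
  moreover have "Pow S = Pow (S - {k}) \<union> insert k ` Pow (S - {k})"
    using k(1) Pow_insert [of k "S - {k}"] by (simp add: insert_absorb)
  moreover have "Pow (S - {k}) \<inter> insert k ` Pow (S - {k}) = {}" by auto
  ultimately have "(\<Sum>A\<in>Pow S. h A) = 0"
    using k(2) by (simp add: sum.union_disjoint)
  then show ?thesis by (simp add: pure_part_def h_def)
qed

lemma pure_part_few_coords:
  fixes c :: "'k::{real_normed_field,euclidean_space}"
  assumes "few_coords M u" "finite S" "M < card S" "\<xi> \<in> X"
  shows "pure_part S (\<lambda>\<xi>. u \<xi> *\<^sub>R c) \<xi> = 0"
proof -
  obtain T v where T: "T \<subseteq> {..<n}" "card T \<le> M" and u: "u = (\<lambda>\<xi>. \<Prod>i\<in>T. v i (\<xi> i))"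
    using assms(1) unfolding few_coords_def by blast
  have "\<not> S \<subseteq> T" using T assms(3) card_mono [of T S] finite_subset [of T "{..<n}"] by auto
  then obtain k where k: "k \<in> S" "k \<notin> T" by blast
  have "(\<Prod>i\<in>T. v i (override_on \<xi> \<eta> {k} i)) = (\<Prod>i\<in>T. v i (\<xi> i))" for \<xi> \<eta>
    using k(2) by (intro prod.cong) (auto simp: override_on_def)
  then have "indep {k} (\<lambda>\<xi>. u \<xi> *\<^sub>R c)" by (simp add: u indep_def)
  then show ?thesis by (rule pure_part_eq_0 [OF k(1) assms(2) _ assms(4)])
qed

text \<open>
  \<open>G\<close> minimises the smoothed norm \<open>J\<close> of the decomposition \<open>F = G + (F - G)\<close> inside the span of the
  functions of few coordinates. The derivative of \<open>J\<close> vanishes at the minimum, which says that the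
  supporting functionals \<open>\<Phi>0\<close> of the first norm at \<open>G\<close> and \<open>\<Phi>1\<close> of the second norm at \<open>F - G\<close> agree on
  that span. One satisfies the pointwise bound and the other the \<open>L\<^sup>2\<close> bound; \<open>joint_extension\<close> yields a
  single \<open>\<Phi>\<close> with both bounds and the same pairing with \<open>F\<close>, which is the sum of the two norms up to the
  smoothing error.
\<close>

lemma finite_duality:
  fixes F :: "(nat \<Rightarrow> nat) \<Rightarrow> nat \<Rightarrow> 'k::{real_normed_field,euclidean_space}"
  assumes B: "finite B" and \<nu>: "\<And>b. b \<in> B \<Longrightarrow> \<nu> b > 0" and t: "t > 0" and \<epsilon>: "\<epsilon> > 0"
    and F: "\<And>\<xi> b. \<lbrakk>\<xi> \<in> X; b \<in> B\<rbrakk> \<Longrightarrow> F \<xi> b = (\<Sum>k\<in>L. u k \<xi> *\<^sub>R \<beta> k b)"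
    and L: "\<And>k. k \<in> L \<Longrightarrow> few_coords M (u k)"
  obtains G \<Phi> where
    "\<forall>S\<subseteq>{..<n}. M < card S \<longrightarrow> (\<forall>b\<in>B. \<forall>\<xi>\<in>X. pure_part S (\<lambda>\<xi>. G \<xi> b) \<xi> = 0)"
    "\<forall>S\<subseteq>{..<n}. M < card S \<longrightarrow> (\<forall>b\<in>B. \<forall>\<xi>\<in>X. pure_part S (\<lambda>\<xi>. F \<xi> b - G \<xi> b) \<xi> = 0)"
    "\<forall>\<xi>\<in>X. \<forall>b\<in>B. (norm (\<Phi> \<xi> b))\<^sup>2 \<le> full_const M 2"
    "\<forall>\<xi>\<in>X. (\<Sum>b\<in>B. \<nu> b * (norm (\<Phi> \<xi> b))\<^sup>2) \<le> full_const M 2 * t\<^sup>2"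
    "Ex (\<lambda>\<xi>. \<Sum>b\<in>B. \<nu> b * norm (G \<xi> b)) + t * Ex (\<lambda>\<xi>. sqrt (\<Sum>b\<in>B. \<nu> b * (norm (F \<xi> b - G \<xi> b))\<^sup>2))
      \<le> Ex (\<lambda>\<xi>. \<Sum>b\<in>B. \<nu> b * inner (\<Phi> \<xi> b) (F \<xi> b)) + \<epsilon>"
proof -
  have \<nu>0: "0 \<le> \<nu> b" if "b \<in> B" for b using \<nu> [OF that] by simp
  \<comment> \<open>The smoothing parameter: it keeps \<open>J\<close> differentiable at zero, and costs at most \<open>\<eta>\<close> times the total weight.\<close>
  define \<eta> where "\<eta> = \<epsilon> / ((\<Sum>b\<in>B. \<nu> b) + t + 1)"
  have pos: "(\<Sum>b\<in>B. \<nu> b) + t + 1 > 0" using \<nu>0 t by (intro add_nonneg_pos add_nonneg_nonneg sum_nonneg) auto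
  then have \<eta>: "\<eta> > 0" using \<epsilon> by (simp add: \<eta>_def)
  define Z where "Z = X \<times> B"
  have fZ: "finite Z" using B by (simp add: Z_def)
  define Y :: "((nat \<Rightarrow> nat) \<times> nat \<Rightarrow> 'k) set" where
    "Y = {g. \<forall>S\<subseteq>{..<n}. M < card S \<longrightarrow> (\<forall>b\<in>B. \<forall>\<xi>\<in>X. pure_part S (\<lambda>\<xi>. g (\<xi>, b)) \<xi> = 0)}"
  have Y_add: "(\<lambda>z. g z + \<tau> *\<^sub>R h z) \<in> Y" if "g \<in> Y" "h \<in> Y" for g h \<tau>
    using that by (simp add: Y_def pure_part_add pure_part_scaleR)
  have Y_few: "h \<in> Y" if "few_coords M w" "\<And>\<xi> b. \<xi> \<in> X \<Longrightarrow> b \<in> B \<Longrightarrow> h (\<xi>, b) = w \<xi> *\<^sub>R c b" for h w c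
    unfolding Y_def
  proof (intro CollectI allI impI ballI)
    fix S b \<xi> assume S: "S \<subseteq> {..<n}" "M < card S" and "b \<in> B" "\<xi> \<in> X"
    then have "pure_part S (\<lambda>\<xi>. h (\<xi>, b)) \<xi> = pure_part S (\<lambda>\<xi>. w \<xi> *\<^sub>R c b) \<xi>"
      using that(2) by (intro pure_part_cong) auto
    then show "pure_part S (\<lambda>\<xi>. h (\<xi>, b)) \<xi> = 0"
      using pure_part_few_coords [OF that(1)] S \<open>\<xi> \<in> X\<close> finite_subset by (metis finite_lessThan)
  qed
  have F_pure: "pure_part S (\<lambda>\<xi>. F \<xi> b) \<xi> = 0"
    if "S \<subseteq> {..<n}" "M < card S" "b \<in> B" "\<xi> \<in> X" for S b \<xi>
  proof -
    have "pure_part S (\<lambda>\<xi>. F \<xi> b) \<xi> = (\<Sum>k\<in>L. pure_part S (\<lambda>\<xi>. u k \<xi> *\<^sub>R \<beta> k b) \<xi>)"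
      unfolding pure_part_sum [symmetric] using that F by (intro pure_part_cong) auto
    moreover have "finite S" using that finite_subset by blast
    then have "pure_part S (\<lambda>\<xi>. u k \<xi> *\<^sub>R \<beta> k b) \<xi> = 0" if "k \<in> L" for k
      using pure_part_few_coords [OF L [OF that] _ \<open>M < card S\<close> \<open>\<xi> \<in> X\<close>] by blast
    ultimately show ?thesis by simp
  qed
  define J1 where "J1 = (\<lambda>g :: (nat \<Rightarrow> nat) \<times> nat \<Rightarrow> 'k.
    Ex (\<lambda>\<xi>. \<Sum>b\<in>B. \<nu> b * sqrt (\<eta>\<^sup>2 + (norm (g (\<xi>, b)))\<^sup>2)))"
  define J2 where "J2 = (\<lambda>g :: (nat \<Rightarrow> nat) \<times> nat \<Rightarrow> 'k.
    Ex (\<lambda>\<xi>. sqrt (\<eta>\<^sup>2 + (\<Sum>b\<in>B. \<nu> b * (norm (F \<xi> b - g (\<xi>, b)))\<^sup>2))))"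
  define J where "J = (\<lambda>g. J1 g + t * J2 g)"
  define J0 where "J0 = J (\<lambda>_. 0)"
  have J2_nonneg: "0 \<le> J2 g" for g
    unfolding J2_def using \<nu>0 by (intro Ex_nonneg real_sqrt_ge_zero add_nonneg_nonneg sum_nonneg) auto
  have coercive: "pw \<xi> * \<nu> b * norm (g (\<xi>, b)) \<le> J g" if z: "\<xi> \<in> X" "b \<in> B" for g \<xi> b
  proof -
    have nn: "0 \<le> \<nu> b * sqrt (\<eta>\<^sup>2 + (norm (g (\<xi>, b)))\<^sup>2)" if "b \<in> B" for b \<xi>
      using \<nu>0 [OF that] by simp
    have "\<nu> b * norm (g (\<xi>, b)) \<le> \<nu> b * sqrt (\<eta>\<^sup>2 + (norm (g (\<xi>, b)))\<^sup>2)"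
      using \<nu>0 [OF z(2)] by (intro mult_left_mono real_le_rsqrt) auto
    also have "\<dots> \<le> (\<Sum>b\<in>B. \<nu> b * sqrt (\<eta>\<^sup>2 + (norm (g (\<xi>, b)))\<^sup>2))"
      using nn z B by (intro member_le_sum) auto
    finally have "pw \<xi> * (\<nu> b * norm (g (\<xi>, b))) \<le> pw \<xi> * (\<Sum>b\<in>B. \<nu> b * sqrt (\<eta>\<^sup>2 + (norm (g (\<xi>, b)))\<^sup>2))"
      using pw_nonneg [OF z(1)] by (rule mult_left_mono)
    also have "\<dots> \<le> J1 g"
      unfolding J1_def Ex_def real_scaleR_def
      using z nn pw_nonneg \<nu>0
      by (intro member_le_sum [where f = "\<lambda>\<xi>. pw \<xi> * (\<Sum>b\<in>B. \<nu> b * sqrt (\<eta>\<^sup>2 + (norm (g (\<xi>, b)))\<^sup>2))"]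
          mult_nonneg_nonneg sum_nonneg) auto
    also have "\<dots> \<le> J g" using J2_nonneg t by (simp add: J_def)
    finally show ?thesis by simp
  qed
  \<comment> \<open>Since all weights are positive, \<open>J\<close> bounds every value, so the minimisation takes place in a compact set.\<close>
  define R where "R = (\<Sum>(\<xi>, b)\<in>Z. J0 / (pw \<xi> * \<nu> b))"
  define T where "T = {g \<in> Y. (\<forall>z\<in>Z. norm (g z) \<le> R) \<and> (\<forall>z. z \<notin> Z \<longrightarrow> g z = 0)}"
  have J0: "0 \<le> J0"
    unfolding J0_def J_def J1_def using J2_nonneg t \<nu>0
    by (intro add_nonneg_nonneg mult_nonneg_nonneg Ex_nonneg sum_nonneg) auto
  have norm_le_R: "norm (g z) \<le> R" if Jg: "J g \<le> J0" and zZ: "z \<in> Z" for g z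
  proof -
    obtain \<xi> b where z: "z = (\<xi>, b)" "\<xi> \<in> X" "b \<in> B" using zZ by (auto simp: Z_def)
    have w: "pw \<xi> * \<nu> b > 0" using pw_pos \<nu> z by simp
    have "pw \<xi> * \<nu> b * norm (g z) \<le> J0" using coercive [OF z(2,3), of g] Jg z by simp
    then have "norm (g z) \<le> J0 / (pw \<xi> * \<nu> b)" using w by (simp add: field_simps)
    also have "\<dots> \<le> R"
      unfolding R_def
      using member_le_sum [of z Z "\<lambda>(\<xi>, b). J0 / (pw \<xi> * \<nu> b)"] zZ z fZ J0 pw_pos \<nu>
      by (force simp: Z_def intro!: divide_nonneg_pos mult_pos_pos)
    finally show ?thesis .
  qed
  have zero_T: "(\<lambda>_. 0) \<in> T"
    using norm_le_R [of "\<lambda>_. 0"] by (auto simp: T_def Y_def J0_def pure_part_0)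
  have coord: "continuous_on UNIV (\<lambda>g :: (nat \<Rightarrow> nat) \<times> nat \<Rightarrow> 'k. g z)" for z
    by (rule continuous_on_product_coordinates)
  have "compact T"
  proof -
    have "closed Y"
    proof -
      have "continuous_on UNIV (\<lambda>g :: (nat \<Rightarrow> nat) \<times> nat \<Rightarrow> 'k. pure_part S (\<lambda>\<xi>. g (\<xi>, b)) \<xi>)" for S b \<xi>
        unfolding pure_part_def avg_def Ex_def by (intro continuous_intros coord)
      then have "closed {g :: (nat \<Rightarrow> nat) \<times> nat \<Rightarrow> 'k. pure_part S (\<lambda>\<xi>. g (\<xi>, b)) \<xi> = 0}" for S b \<xi>
        by (intro closed_Collect_eq) auto
      then show ?thesis
        unfolding Y_def Ball_def by (intro closed_Collect_all closed_Collect_imp) auto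
    qed
    then have "compact ({g. (\<forall>z\<in>Z. norm (g z) \<le> R) \<and> (\<forall>z. z \<notin> Z \<longrightarrow> g z = 0)} \<inter> Y)"
      by (rule compact_Int_closed [OF compact_functions_bounded_on])
    moreover have "T = {g. (\<forall>z\<in>Z. norm (g z) \<le> R) \<and> (\<forall>z. z \<notin> Z \<longrightarrow> g z = 0)} \<inter> Y"
      by (auto simp: T_def)
    ultimately show ?thesis by simp
  qed
  moreover have "continuous_on T J"
    unfolding J_def J1_def J2_def Ex_def
    by (intro continuous_intros continuous_on_subset [OF coord]) auto
  ultimately obtain g where gT: "g \<in> T" and g_min: "\<And>h. h \<in> T \<Longrightarrow> J g \<le> J h"
    using continuous_attains_inf [of T J] zero_T by blast
  have gY: "g \<in> Y" and g_off: "\<And>z. z \<notin> Z \<Longrightarrow> g z = 0" using gT by (auto simp: T_def)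
  have g_min': "J g \<le> J h" if "h \<in> Y" "\<And>z. z \<notin> Z \<Longrightarrow> h z = 0" for h
  proof (cases "J h \<le> J0")
    case True
    then show ?thesis using that norm_le_R by (intro g_min) (auto simp: T_def)
  next
    case False
    then show ?thesis using g_min [OF zero_T] by (simp add: J0_def)
  qed
  define s0 where "s0 = (\<lambda>\<xi> b. sqrt (\<eta>\<^sup>2 + (norm (g (\<xi>, b)))\<^sup>2))"
  define s1 where "s1 = (\<lambda>\<xi>. sqrt (\<eta>\<^sup>2 + (\<Sum>b\<in>B. \<nu> b * (norm (F \<xi> b - g (\<xi>, b)))\<^sup>2)))"
  define \<Phi>0 where "\<Phi>0 = (\<lambda>\<xi> b. (1 / s0 \<xi> b) *\<^sub>R g (\<xi>, b))"
  define \<Phi>1 where "\<Phi>1 = (\<lambda>\<xi> b. (t / s1 \<xi>) *\<^sub>R (F \<xi> b - g (\<xi>, b)))"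
  have sum_nn: "0 \<le> (\<Sum>b\<in>B. \<nu> b * (norm (f b))\<^sup>2)" for f :: "nat \<Rightarrow> 'k"
    using \<nu>0 by (intro sum_nonneg) auto
  have a0: "\<eta>\<^sup>2 + (norm x)\<^sup>2 > 0" for x :: 'k using \<eta> by (simp add: add_pos_nonneg)
  have a1: "\<eta>\<^sup>2 + (\<Sum>b\<in>B. \<nu> b * (norm (f b))\<^sup>2) > 0" for f :: "nat \<Rightarrow> 'k"
    using \<eta> sum_nn by (simp add: add_pos_nonneg)
  have s0: "s0 \<xi> b > 0" for \<xi> b using a0 by (simp add: s0_def)
  have s1: "s1 \<xi> > 0" for \<xi> using a1 by (simp add: s1_def)
  define pair where "pair = (\<lambda>(\<Phi> :: (nat \<Rightarrow> nat) \<Rightarrow> nat \<Rightarrow> 'k) (h :: (nat \<Rightarrow> nat) \<Rightarrow> nat \<Rightarrow> 'k).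
    Ex (\<lambda>\<xi>. \<Sum>b\<in>B. \<nu> b * inner (\<Phi> \<xi> b) (h \<xi> b)))"
  have stationary: "pair \<Phi>0 (\<lambda>\<xi> b. h (\<xi>, b)) = pair \<Phi>1 (\<lambda>\<xi> b. h (\<xi>, b))"
    if h: "h \<in> Y" "\<And>z. z \<notin> Z \<Longrightarrow> h z = 0" for h
  proof -
    define f1 where "f1 = (\<lambda>\<tau>. J1 (\<lambda>z. g z + \<tau> *\<^sub>R h z))"
    define f2 where "f2 = (\<lambda>\<tau>. J2 (\<lambda>z. g z + \<tau> *\<^sub>R h z))"
    have e1: "f1 = (\<lambda>\<tau>. \<Sum>\<xi>\<in>X. pw \<xi> * (\<Sum>b\<in>B. \<nu> b * sqrt ((\<eta>\<^sup>2 + (norm (g (\<xi>, b)))\<^sup>2)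
        + 2 * \<tau> * inner (g (\<xi>, b)) (h (\<xi>, b)) + \<tau>\<^sup>2 * (norm (h (\<xi>, b)))\<^sup>2)))"
      unfolding f1_def J1_def Ex_def power2_norm_eq_inner real_scaleR_def
      by (intro ext sum.cong refl arg_cong2 [where f = "(*)"] arg_cong [where f = sqrt])
        (simp add: inner_add_left inner_add_right inner_commute algebra_simps power2_eq_square)
    have "(f1 has_real_derivative pair \<Phi>0 (\<lambda>\<xi> b. h (\<xi>, b))) (at 0)"
    proof -
      have "pair \<Phi>0 (\<lambda>\<xi> b. h (\<xi>, b))
          = (\<Sum>\<xi>\<in>X. pw \<xi> * (\<Sum>b\<in>B. \<nu> b * (inner (g (\<xi>, b)) (h (\<xi>, b)) / s0 \<xi> b)))"
        by (simp add: pair_def Ex_def \<Phi>0_def)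
      then show ?thesis
        unfolding e1 s0_def by (simp only:) (intro DERIV_sum DERIV_cmult DERIV_sqrt_quadratic a0)
    qed
    moreover have "(f2 has_real_derivative - (pair \<Phi>1 (\<lambda>\<xi> b. h (\<xi>, b)) / t)) (at 0)"
    proof -
      have e2: "f2 = (\<lambda>\<tau>. \<Sum>\<xi>\<in>X. pw \<xi> * sqrt ((\<eta>\<^sup>2 + (\<Sum>b\<in>B. \<nu> b * (norm (F \<xi> b - g (\<xi>, b)))\<^sup>2))
        + 2 * \<tau> * (- (\<Sum>b\<in>B. \<nu> b * inner (F \<xi> b - g (\<xi>, b)) (h (\<xi>, b))))
        + \<tau>\<^sup>2 * (\<Sum>b\<in>B. \<nu> b * (norm (h (\<xi>, b)))\<^sup>2)))"
      proof -
        have q: "(norm (F \<xi> b - (g (\<xi>, b) + \<tau> *\<^sub>R h (\<xi>, b))))\<^sup>2 = (norm (F \<xi> b - g (\<xi>, b)))\<^sup>2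
            + (2 * \<tau> * (- inner (F \<xi> b - g (\<xi>, b)) (h (\<xi>, b))) + \<tau>\<^sup>2 * (norm (h (\<xi>, b)))\<^sup>2)" for \<xi> b \<tau>
          unfolding power2_norm_eq_inner
          by (simp add: inner_add_left inner_add_right inner_diff_left inner_diff_right inner_commute
              algebra_simps power2_eq_square)
        have "(\<Sum>b\<in>B. \<nu> b * (x b + (2 * \<tau> * (- y b) + \<tau>\<^sup>2 * z b)))
            = (\<Sum>b\<in>B. \<nu> b * x b) + 2 * \<tau> * (- (\<Sum>b\<in>B. \<nu> b * y b)) + \<tau>\<^sup>2 * (\<Sum>b\<in>B. \<nu> b * z b)"
          for \<tau> and x y z :: "nat \<Rightarrow> real"
          by (simp add: distrib_left right_diff_distrib sum.distrib sum_subtractf sum_distrib_left sum_negf mult_ac)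
        then show ?thesis
          unfolding f2_def J2_def Ex_def real_scaleR_def q by (simp add: add_diff_eq add.assoc [symmetric])
      qed
      have "(f2 has_real_derivative (\<Sum>\<xi>\<in>X. pw \<xi> *
          (- (\<Sum>b\<in>B. \<nu> b * inner (F \<xi> b - g (\<xi>, b)) (h (\<xi>, b))) / s1 \<xi>))) (at 0)"
        unfolding e2 s1_def by (intro DERIV_sum DERIV_cmult DERIV_sqrt_quadratic a1)
      moreover have "(\<Sum>\<xi>\<in>X. pw \<xi> * (- (\<Sum>b\<in>B. \<nu> b * inner (F \<xi> b - g (\<xi>, b)) (h (\<xi>, b))) / s1 \<xi>))
          = - (pair \<Phi>1 (\<lambda>\<xi> b. h (\<xi>, b)) / t)"
        unfolding pair_def Ex_def \<Phi>1_def real_scaleR_def sum_divide_distrib sum_negf [symmetric]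
        using t by (intro sum.cong refl) (simp add: sum_distrib_left sum_divide_distrib sum_negf [symmetric] mult_ac)
      ultimately show ?thesis by simp
    qed
    ultimately have "((\<lambda>\<tau>. f1 \<tau> + t * f2 \<tau>) has_real_derivative
        (pair \<Phi>0 (\<lambda>\<xi> b. h (\<xi>, b)) + t * (- (pair \<Phi>1 (\<lambda>\<xi> b. h (\<xi>, b)) / t)))) (at 0)"
      by (intro DERIV_add DERIV_cmult)
    moreover have "f1 0 + t * f2 0 \<le> f1 \<tau> + t * f2 \<tau>" for \<tau>
      using g_min' [OF Y_add [OF gY h(1)], of \<tau>] g_off h(2) by (simp add: f1_def f2_def J_def)
    ultimately have "pair \<Phi>0 (\<lambda>\<xi> b. h (\<xi>, b)) + t * (- (pair \<Phi>1 (\<lambda>\<xi> b. h (\<xi>, b)) / t)) = 0"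
      by (intro DERIV_local_min [where d = 1]) auto
    then show ?thesis using t by simp
  qed
  have same: "same_on (few_coords M) B \<Phi>1 \<Phi>0"
    unfolding same_on_def
  proof (intro allI impI ballI)
    fix w b assume w: "few_coords M w" and b: "b \<in> B"
    have pair_test: "pair \<Phi> (\<lambda>\<xi> b'. if (\<xi>, b') \<in> Z \<and> b' = b then w \<xi> *\<^sub>R e else 0)
        = \<nu> b * inner (Ex (\<lambda>\<xi>. w \<xi> *\<^sub>R \<Phi> \<xi> b)) e" for \<Phi> e
    proof -
      have "(\<Sum>b'\<in>B. \<nu> b' * inner (\<Phi> \<xi> b') (if (\<xi>, b') \<in> Z \<and> b' = b then w \<xi> *\<^sub>R e else 0))
          = \<nu> b * inner (w \<xi> *\<^sub>R \<Phi> \<xi> b) e" if "\<xi> \<in> X" for \<xi>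
      proof -
        have "(\<Sum>b'\<in>B. \<nu> b' * inner (\<Phi> \<xi> b') (if (\<xi>, b') \<in> Z \<and> b' = b then w \<xi> *\<^sub>R e else 0))
          = (\<Sum>b'\<in>B. if b' = b then \<nu> b * inner (w \<xi> *\<^sub>R \<Phi> \<xi> b) e else 0)"
          using that by (intro sum.cong) (auto simp: Z_def)
        then show ?thesis using b B by simp
      qed
      then have "pair \<Phi> (\<lambda>\<xi> b'. if (\<xi>, b') \<in> Z \<and> b' = b then w \<xi> *\<^sub>R e else 0)
          = Ex (\<lambda>\<xi>. \<nu> b * inner (w \<xi> *\<^sub>R \<Phi> \<xi> b) e)"
        unfolding pair_def by (intro Ex_cong)
      then show ?thesis by (simp only: Ex_mult_left Ex_inner_right)
    qed
    have "inner (Ex (\<lambda>\<xi>. w \<xi> *\<^sub>R \<Phi>0 \<xi> b)) e = inner (Ex (\<lambda>\<xi>. w \<xi> *\<^sub>R \<Phi>1 \<xi> b)) e" for e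
    proof -
      define h where "h = (\<lambda>z. if z \<in> Z \<and> snd z = b then w (fst z) *\<^sub>R e else 0)"
      have "h \<in> Y"
        by (rule Y_few [OF w, of h "\<lambda>b'. if b' = b then e else 0"]) (auto simp: h_def Z_def)
      then have "pair \<Phi>0 (\<lambda>\<xi> b. h (\<xi>, b)) = pair \<Phi>1 (\<lambda>\<xi> b. h (\<xi>, b))"
        by (rule stationary) (auto simp: h_def)
      then show ?thesis using \<nu> [OF b] unfolding h_def fst_conv snd_conv pair_test by simp
    qed
    then show "Ex (\<lambda>\<xi>. w \<xi> *\<^sub>R \<Phi>1 \<xi> b) = Ex (\<lambda>\<xi>. w \<xi> *\<^sub>R \<Phi>0 \<xi> b)"
      using vector_eq_rdot by metis
  qed
  have \<Phi>0_bound: "(norm (\<Phi>0 \<xi> b))\<^sup>2 \<le> 1" for \<xi> b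
  proof -
    have "(norm (\<Phi>0 \<xi> b))\<^sup>2 = (norm (g (\<xi>, b)))\<^sup>2 / (s0 \<xi> b)\<^sup>2"
      using s0 [of \<xi> b] by (simp add: \<Phi>0_def power_divide)
    also have "(s0 \<xi> b)\<^sup>2 = \<eta>\<^sup>2 + (norm (g (\<xi>, b)))\<^sup>2" using a0 by (simp add: s0_def less_imp_le)
    also have "(norm (g (\<xi>, b)))\<^sup>2 / (\<eta>\<^sup>2 + (norm (g (\<xi>, b)))\<^sup>2) \<le> 1" using a0 by simp
    finally show ?thesis .
  qed
  have \<Phi>1_bound: "(\<Sum>b\<in>B. \<nu> b * (norm (\<Phi>1 \<xi> b))\<^sup>2) \<le> t\<^sup>2" for \<xi>
  proof -
    let ?q = "\<Sum>b\<in>B. \<nu> b * (norm (F \<xi> b - g (\<xi>, b)))\<^sup>2"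
    have "(\<Sum>b\<in>B. \<nu> b * (norm (\<Phi>1 \<xi> b))\<^sup>2) = (t / s1 \<xi>)\<^sup>2 * ?q"
      unfolding sum_distrib_left
      by (intro sum.cong refl) (simp only: \<Phi>1_def norm_scaleR power_mult_distrib power2_abs mult_ac)
    also have "\<dots> = t\<^sup>2 * (?q / (s1 \<xi>)\<^sup>2)" by (simp add: power_divide)
    also have "(s1 \<xi>)\<^sup>2 = \<eta>\<^sup>2 + ?q" using a1 by (simp add: s1_def less_imp_le)
    also have "t\<^sup>2 * (?q / (\<eta>\<^sup>2 + ?q)) \<le> t\<^sup>2 * 1"
      using a1 by (intro mult_left_mono) auto
    finally show ?thesis by simp
  qed
  \<comment> \<open>Overlap two: the index \<open>b\<close> occurs in its own pointwise constraint and in the \<open>L\<^sup>2\<close> constraint.\<close>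
  define pt where "pt = (\<lambda>b \<theta> :: nat. if \<theta> = b then 1 else 0 :: real)"
  define l2 where "l2 = (\<lambda>\<theta>. \<nu> \<theta> / t\<^sup>2)"
  define A where "A = insert l2 (pt ` B)"
  have energy_pt: "energy B (pt b) f = (norm (f b))\<^sup>2" if "b \<in> B" for b and f :: "nat \<Rightarrow> 'k"
  proof -
    have "energy B (pt b) f = (\<Sum>\<theta>\<in>B. if \<theta> = b then (norm (f b))\<^sup>2 else 0)"
      unfolding energy_def pt_def by (intro sum.cong) auto
    then show ?thesis using that B by simp
  qed
  have energy_l2: "energy B l2 f = (\<Sum>b\<in>B. \<nu> b * (norm (f b))\<^sup>2) / t\<^sup>2" for f :: "nat \<Rightarrow> 'k"
    unfolding energy_def l2_def sum_divide_distrib by (intro sum.cong) auto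
  have "constraints B A 2"
    unfolding constraints_def
  proof (intro conjI ballI)
    fix \<theta> assume "\<theta> \<in> B"
    have "{a \<in> A. 0 < a \<theta>} \<subseteq> {l2, pt \<theta>}" by (auto simp: A_def pt_def split: if_splits)
    then have "card {a \<in> A. 0 < a \<theta>} \<le> card {l2, pt \<theta>}" by (intro card_mono) auto
    also have "\<dots> \<le> 2" by (simp add: card_insert_if)
    finally show "card {a \<in> A. 0 < a \<theta>} \<le> 2" .
  next
    fix a \<theta> assume "a \<in> A" "\<theta> \<in> B"
    then show "0 \<le> a \<theta>" using \<nu>0 by (auto simp: A_def pt_def l2_def)
  qed (use B in \<open>auto simp: A_def\<close>)
  moreover have "\<exists>\<Psi>. same_on (few_coords M) B \<Psi> \<Phi>0 \<and> (\<forall>\<xi>\<in>X. energy B a (\<Psi> \<xi>) \<le> 1)" if aA: "a \<in> A" for a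
  proof (cases "a = l2")
    case True
    have "energy B l2 (\<Phi>1 \<xi>) \<le> 1" for \<xi> using \<Phi>1_bound [of \<xi>] t by (simp add: energy_l2)
    then show ?thesis using same True by blast
  next
    case False
    then obtain b where "b \<in> B" "a = pt b" using aA by (auto simp: A_def)
    then have "energy B a (\<Phi>0 \<xi>) \<le> 1" for \<xi> using \<Phi>0_bound by (simp add: energy_pt)
    moreover have "same_on (few_coords M) B \<Phi>0 \<Phi>0" by (simp add: same_on_def)
    ultimately show ?thesis by blast
  qed
  ultimately obtain \<Phi> where \<Phi>_same: "same_on (few_coords M) B \<Phi> \<Phi>0"
    and \<Phi>_bound: "\<And>a \<xi>. a \<in> A \<Longrightarrow> \<xi> \<in> X \<Longrightarrow> energy B a (\<Phi> \<xi>) \<le> full_const M 2 * 1"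
    using joint_extension [of B A 2 1 M \<Phi>0] by auto
  have b0: "(norm (\<Phi> \<xi> b))\<^sup>2 \<le> full_const M 2" if "\<xi> \<in> X" "b \<in> B" for \<xi> b
    using \<Phi>_bound [of "pt b" \<xi>] that by (simp add: A_def energy_pt)
  have b1: "(\<Sum>b\<in>B. \<nu> b * (norm (\<Phi> \<xi> b))\<^sup>2) \<le> full_const M 2 * t\<^sup>2" if "\<xi> \<in> X" for \<xi>
    using \<Phi>_bound [of l2 \<xi>] that t by (simp add: A_def energy_l2 field_simps)
  define h where "h = (\<lambda>z. if z \<in> Z then F (fst z) (snd z) - g z else 0)"
  have H_pure: "pure_part S (\<lambda>\<xi>. F \<xi> b - g (\<xi>, b)) \<xi> = 0"
    if "S \<subseteq> {..<n}" "M < card S" "b \<in> B" "\<xi> \<in> X" for S b \<xi>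
    using F_pure [OF that] gY that by (simp add: pure_part_diff Y_def)
  have hY: "h \<in> Y"
    unfolding Y_def
  proof (intro CollectI allI impI ballI)
    fix S b \<xi> assume S: "S \<subseteq> {..<n}" "M < card S" "b \<in> B" "\<xi> \<in> X"
    have "pure_part S (\<lambda>\<xi>. h (\<xi>, b)) \<xi> = pure_part S (\<lambda>\<xi>. F \<xi> b - g (\<xi>, b)) \<xi>"
      using S by (intro pure_part_cong) (auto simp: h_def Z_def)
    then show "pure_part S (\<lambda>\<xi>. h (\<xi>, b)) \<xi> = 0" using H_pure [OF S] by simp
  qed
  have pair_F: "pair \<Phi> F = pair \<Phi>0 F"
  proof -
    have "pair \<Psi> F = (\<Sum>b\<in>B. \<nu> b * (\<Sum>k\<in>L. inner (Ex (\<lambda>\<xi>. u k \<xi> *\<^sub>R \<Psi> \<xi> b)) (\<beta> k b)))" for \<Psi>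
    proof -
      have "pair \<Psi> F = Ex (\<lambda>\<xi>. \<Sum>b\<in>B. \<nu> b * (\<Sum>k\<in>L. inner (u k \<xi> *\<^sub>R \<Psi> \<xi> b) (\<beta> k b)))"
        unfolding pair_def by (intro Ex_cong sum.cong refl) (simp add: F inner_sum_right)
      then show ?thesis by (simp only: Ex_sum Ex_mult_left Ex_inner_right)
    qed
    then show ?thesis using \<Phi>_same L unfolding same_on_def by simp
  qed
  have "pair \<Phi>0 F = pair \<Phi>0 (\<lambda>\<xi> b. g (\<xi>, b)) + pair \<Phi>0 (\<lambda>\<xi> b. F \<xi> b - g (\<xi>, b))"
    unfolding pair_def Ex_add [symmetric] sum.distrib [symmetric]
    by (simp add: inner_diff_right algebra_simps)
  also have "pair \<Phi>0 (\<lambda>\<xi> b. F \<xi> b - g (\<xi>, b)) = pair \<Phi>0 (\<lambda>\<xi> b. h (\<xi>, b))"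
    unfolding pair_def by (intro Ex_cong sum.cong) (auto simp: h_def Z_def)
  also have "\<dots> = pair \<Phi>1 (\<lambda>\<xi> b. h (\<xi>, b))"
    by (rule stationary [OF hY]) (auto simp: h_def)
  also have "\<dots> = pair \<Phi>1 (\<lambda>\<xi> b. F \<xi> b - g (\<xi>, b))"
    unfolding pair_def by (intro Ex_cong sum.cong) (auto simp: h_def Z_def)
  finally have split: "pair \<Phi> F = pair \<Phi>0 (\<lambda>\<xi> b. g (\<xi>, b)) + pair \<Phi>1 (\<lambda>\<xi> b. F \<xi> b - g (\<xi>, b))"
    using pair_F by simp
  have G_le: "Ex (\<lambda>\<xi>. \<Sum>b\<in>B. \<nu> b * norm (g (\<xi>, b))) \<le> pair \<Phi>0 (\<lambda>\<xi> b. g (\<xi>, b)) + \<eta> * (\<Sum>b\<in>B. \<nu> b)"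
  proof -
    have "norm (g (\<xi>, b)) \<le> inner (\<Phi>0 \<xi> b) (g (\<xi>, b)) + \<eta>" for \<xi> b
      using norm_le_smoothed [of "norm (g (\<xi>, b))" \<eta>] \<eta>
      by (simp add: \<Phi>0_def s0_def power2_norm_eq_inner)
    then have "Ex (\<lambda>\<xi>. \<Sum>b\<in>B. \<nu> b * norm (g (\<xi>, b)))
        \<le> Ex (\<lambda>\<xi>. \<Sum>b\<in>B. \<nu> b * (inner (\<Phi>0 \<xi> b) (g (\<xi>, b)) + \<eta>))"
      using \<nu>0 by (intro Ex_mono sum_mono mult_left_mono) auto
    also have "\<dots> = pair \<Phi>0 (\<lambda>\<xi> b. g (\<xi>, b)) + \<eta> * (\<Sum>b\<in>B. \<nu> b)"
      by (simp add: pair_def distrib_left sum.distrib Ex_add sum_distrib_left mult.commute)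
    finally show ?thesis .
  qed
  have H_le: "t * Ex (\<lambda>\<xi>. sqrt (\<Sum>b\<in>B. \<nu> b * (norm (F \<xi> b - g (\<xi>, b)))\<^sup>2))
      \<le> pair \<Phi>1 (\<lambda>\<xi> b. F \<xi> b - g (\<xi>, b)) + \<eta> * t"
  proof -
    have "t * sqrt (\<Sum>b\<in>B. \<nu> b * (norm (F \<xi> b - g (\<xi>, b)))\<^sup>2)
        \<le> (\<Sum>b\<in>B. \<nu> b * inner (\<Phi>1 \<xi> b) (F \<xi> b - g (\<xi>, b))) + \<eta> * t" for \<xi>
    proof -
      let ?q = "\<Sum>b\<in>B. \<nu> b * (norm (F \<xi> b - g (\<xi>, b)))\<^sup>2"
      have "t * sqrt ?q \<le> t * (?q / s1 \<xi> + \<eta>)"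
        using norm_le_smoothed [of "sqrt ?q" \<eta>] \<eta> t sum_nn by (intro mult_left_mono) (auto simp: s1_def)
      also have "\<dots> = (\<Sum>b\<in>B. \<nu> b * inner (\<Phi>1 \<xi> b) (F \<xi> b - g (\<xi>, b))) + \<eta> * t"
        by (simp add: \<Phi>1_def distrib_left sum_distrib_left sum_divide_distrib power2_norm_eq_inner mult_ac)
      finally show ?thesis .
    qed
    then have "Ex (\<lambda>\<xi>. t * sqrt (\<Sum>b\<in>B. \<nu> b * (norm (F \<xi> b - g (\<xi>, b)))\<^sup>2))
        \<le> Ex (\<lambda>\<xi>. (\<Sum>b\<in>B. \<nu> b * inner (\<Phi>1 \<xi> b) (F \<xi> b - g (\<xi>, b))) + \<eta> * t)"
      by (rule Ex_mono)
    then show ?thesis by (simp add: Ex_mult_left Ex_add pair_def)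
  qed
  have "\<eta> * (\<Sum>b\<in>B. \<nu> b) + \<eta> * t \<le> \<eta> * ((\<Sum>b\<in>B. \<nu> b) + t + 1)"
    using \<eta> by (simp add: algebra_simps)
  also have "\<dots> = \<epsilon>" using pos by (simp add: \<eta>_def)
  finally have total: "Ex (\<lambda>\<xi>. \<Sum>b\<in>B. \<nu> b * norm (g (\<xi>, b)))
      + t * Ex (\<lambda>\<xi>. sqrt (\<Sum>b\<in>B. \<nu> b * (norm (F \<xi> b - g (\<xi>, b)))\<^sup>2))
      \<le> Ex (\<lambda>\<xi>. \<Sum>b\<in>B. \<nu> b * inner (\<Phi> \<xi> b) (F \<xi> b)) + \<epsilon>"
    using G_le H_le split unfolding pair_def by linarith
  have G_pure: "\<forall>S\<subseteq>{..<n}. M < card S \<longrightarrow> (\<forall>b\<in>B. \<forall>\<xi>\<in>X. pure_part S (\<lambda>\<xi>. g (\<xi>, b)) \<xi> = 0)"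
    using gY by (simp add: Y_def)
  show ?thesis
    by (rule that [OF G_pure _ _ _ total]) (use H_pure b0 b1 in blast)+
qed

end

section \<open>The mixed-norm spaces as normed spaces\<close>

lemma Lp_norm_nonneg: "0 \<le> Lp_norm N p h"
  by (simp add: Lp_norm_def)

lemma Lp_norm_1: "Lp_norm N 1 h = (\<integral>s. norm (h s) \<partial>N)"
  by (simp add: Lp_norm_def)

lemma Lp_norm_2: "Lp_norm N 2 h = sqrt (\<integral>s. (norm (h s))\<^sup>2 \<partial>N)"
  by (simp add: Lp_norm_def powr_half_sqrt)

lemma Lp_1_iff: "h \<in> Lp N 1 \<longleftrightarrow> integrable N h"
  unfolding Lp_def by (auto simp: integrable_norm_iff)

lemma Lp_2_iff: "h \<in> Lp N 2 \<longleftrightarrow> h \<in> borel_measurable N \<and> integrable N (\<lambda>s. (norm (h s))\<^sup>2)"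
  unfolding Lp_def by simp

text \<open>
  Minkowski's inequality by convexity of the square, with weights proportional to the two norms. The
  norms are enlarged by \<open>e / 2\<close> because they may vanish.
\<close>

lemma L2_add:
  assumes f: "f \<in> Lp N 2" and g: "g \<in> Lp N 2"
  shows "(\<lambda>s. f s + g s) \<in> Lp N 2 \<and> Lp_norm N 2 (\<lambda>s. f s + g s) \<le> Lp_norm N 2 f + Lp_norm N 2 g"
proof -
  have [measurable]: "f \<in> borel_measurable N" "g \<in> borel_measurable N" using f g by (auto simp: Lp_2_iff)
  have If: "integrable N (\<lambda>s. (norm (f s))\<^sup>2)" and Ig: "integrable N (\<lambda>s. (norm (g s))\<^sup>2)"
    using f g by (auto simp: Lp_2_iff)
  have le: "(norm (f s + g s))\<^sup>2 \<le> (a + b) * ((norm (f s))\<^sup>2 / a + (norm (g s))\<^sup>2 / b)"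
    if "a > 0" "b > 0" for a b s
  proof -
    have "(norm (f s + g s))\<^sup>2 \<le> (norm (f s) + norm (g s))\<^sup>2"
      by (intro power_mono norm_triangle_ineq) auto
    also have "\<dots> = (a + b) * ((norm (f s))\<^sup>2 / a + (norm (g s))\<^sup>2 / b)
        - (b * norm (f s) - a * norm (g s))\<^sup>2 / (a * b)"
      using that by (simp add: field_simps power2_eq_square)
    also have "\<dots> \<le> (a + b) * ((norm (f s))\<^sup>2 / a + (norm (g s))\<^sup>2 / b)"
      using that by simp
    finally show ?thesis .
  qed
  have I: "integrable N (\<lambda>s. (norm (f s + g s))\<^sup>2)"
  proof (rule Bochner_Integration.integrable_bound)
    show "integrable N (\<lambda>s. 2 * ((norm (f s))\<^sup>2 + (norm (g s))\<^sup>2))" using If Ig by simp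
    show "AE s in N. norm ((norm (f s + g s))\<^sup>2) \<le> norm (2 * ((norm (f s))\<^sup>2 + (norm (g s))\<^sup>2))"
      using le [of 1 1] by auto
  qed auto
  have "Lp_norm N 2 (\<lambda>s. f s + g s) \<le> Lp_norm N 2 f + Lp_norm N 2 g + e" if e: "e > 0" for e
  proof -
    define a where "a = Lp_norm N 2 f + e / 2"
    define b where "b = Lp_norm N 2 g + e / 2"
    have ab: "a > 0" "b > 0"
      using e Lp_norm_nonneg [of N 2 f] Lp_norm_nonneg [of N 2 g] by (auto simp: a_def b_def)
    have fa: "(\<integral>s. (norm (f s))\<^sup>2 \<partial>N) \<le> a\<^sup>2" and gb: "(\<integral>s. (norm (g s))\<^sup>2 \<partial>N) \<le> b\<^sup>2"
      using e Lp_norm_nonneg [of N 2 f] Lp_norm_nonneg [of N 2 g]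
      by (auto simp: a_def b_def Lp_norm_2 intro!: sqrt_le_D)
    have "(\<integral>s. (norm (f s + g s))\<^sup>2 \<partial>N) \<le> (\<integral>s. (a + b) * ((norm (f s))\<^sup>2 / a + (norm (g s))\<^sup>2 / b) \<partial>N)"
      using I If Ig le [OF ab] by (intro integral_mono) auto
    also have "\<dots> = (a + b) * ((\<integral>s. (norm (f s))\<^sup>2 \<partial>N) / a + (\<integral>s. (norm (g s))\<^sup>2 \<partial>N) / b)"
      using If Ig by simp
    also have "\<dots> \<le> (a + b) * (a\<^sup>2 / a + b\<^sup>2 / b)"
      using fa gb ab by (intro mult_left_mono add_mono divide_right_mono) auto
    also have "\<dots> = (a + b)\<^sup>2" using ab by (simp add: power2_eq_square)
    finally have "Lp_norm N 2 (\<lambda>s. f s + g s) \<le> a + b"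
      using ab unfolding Lp_norm_2 by (intro real_le_lsqrt) auto
    then show ?thesis by (simp add: a_def b_def)
  qed
  then have "Lp_norm N 2 (\<lambda>s. f s + g s) \<le> Lp_norm N 2 f + Lp_norm N 2 g" by (rule field_le_epsilon)
  then show ?thesis using I by (simp add: Lp_2_iff)
qed

lemma Lp_add:
  assumes p: "p = 1 \<or> p = 2" and f: "f \<in> Lp N p" and g: "g \<in> Lp N p"
  shows "(\<lambda>s. f s + g s) \<in> Lp N p"
    and "Lp_norm N p (\<lambda>s. f s + g s) \<le> Lp_norm N p f + Lp_norm N p g"
proof -
  have "(\<lambda>s. f s + g s) \<in> Lp N p \<and> Lp_norm N p (\<lambda>s. f s + g s) \<le> Lp_norm N p f + Lp_norm N p g"
    using p
  proof
    assume p: "p = 1"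
    then have I: "integrable N f" "integrable N g" using f g by (simp_all add: Lp_1_iff)
    then have "(\<integral>s. norm (f s + g s) \<partial>N) \<le> (\<integral>s. norm (f s) + norm (g s) \<partial>N)"
      by (intro integral_mono) (auto intro: norm_triangle_ineq)
    then show ?thesis using I p by (simp add: Lp_1_iff Lp_norm_1)
  qed (use f g L2_add in auto)
  then show "(\<lambda>s. f s + g s) \<in> Lp N p" "Lp_norm N p (\<lambda>s. f s + g s) \<le> Lp_norm N p f + Lp_norm N p g"
    by auto
qed

lemma Lp_cmult:
  assumes p: "p = 1 \<or> p = 2"
  shows "f \<in> Lp N p \<Longrightarrow> (\<lambda>s. c * f s) \<in> Lp N p"
    and "Lp_norm N p (\<lambda>s. c * f s) = norm c * Lp_norm N p f"
  using p by (auto simp: Lp_def Lp_norm_1 Lp_norm_2 norm_mult power_mult_distrib real_sqrt_mult powr_mult)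

lemma Lp_zero: "(\<lambda>_. 0) \<in> Lp N p"
  by (simp add: Lp_def)

lemma Lp_norm_zero: "Lp_norm N p (\<lambda>_. 0) = 0"
  by (simp add: Lp_norm_def)

lemma Lp_measurable: "f \<in> Lp N p \<Longrightarrow> f \<in> borel_measurable N"
  by (simp add: Lp_def)

lemma Lp_norm_section_measurable:
  fixes f :: "'b \<times> real \<Rightarrow> 'k::{real_normed_field,euclidean_space}"
  assumes [measurable]: "f \<in> borel_measurable (P \<Otimes>\<^sub>M lborel)"
  shows "(\<lambda>x. Lp_norm lborel p (\<lambda>s. f (x, s))) \<in> borel_measurable P"
  unfolding Lp_norm_def by measurable

lemma L1_Lp_measurable: "f \<in> L1_Lp P p \<Longrightarrow> f \<in> borel_measurable (P \<Otimes>\<^sub>M lborel)"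
  by (simp add: L1_Lp_def)

lemma L1_Lp_norm_nonneg: "0 \<le> L1_Lp_norm P p f"
  unfolding L1_Lp_norm_def by (simp add: Lp_norm_nonneg)

lemma L1_Lp_add:
  fixes f g :: "'b \<times> real \<Rightarrow> 'k::{real_normed_field,euclidean_space}"
  assumes p: "p = 1 \<or> p = 2" and f: "f \<in> L1_Lp P p" and g: "g \<in> L1_Lp P p"
  shows "(\<lambda>z. f z + g z) \<in> L1_Lp P p"
    and "L1_Lp_norm P p (\<lambda>z. f z + g z) \<le> L1_Lp_norm P p f + L1_Lp_norm P p g"
proof -
  have [measurable]: "f \<in> borel_measurable (P \<Otimes>\<^sub>M lborel)" "g \<in> borel_measurable (P \<Otimes>\<^sub>M lborel)"
    using f g by (auto simp: L1_Lp_def)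
  have af: "AE x in P. (\<lambda>s. f (x, s)) \<in> Lp lborel p" and ag: "AE x in P. (\<lambda>s. g (x, s)) \<in> Lp lborel p"
    and If: "integrable P (\<lambda>x. Lp_norm lborel p (\<lambda>s. f (x, s)))"
    and Ig: "integrable P (\<lambda>x. Lp_norm lborel p (\<lambda>s. g (x, s)))"
    using f g by (auto simp: L1_Lp_def)
  have mem: "AE x in P. (\<lambda>s. f (x, s) + g (x, s)) \<in> Lp lborel p"
    using af ag by eventually_elim (rule Lp_add [OF p])
  have le: "AE x in P. Lp_norm lborel p (\<lambda>s. f (x, s) + g (x, s))
      \<le> Lp_norm lborel p (\<lambda>s. f (x, s)) + Lp_norm lborel p (\<lambda>s. g (x, s))"
    using af ag by eventually_elim (rule Lp_add [OF p])
  have m: "(\<lambda>x. Lp_norm lborel p (\<lambda>s. f (x, s) + g (x, s))) \<in> borel_measurable P"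
    by (rule Lp_norm_section_measurable [of "\<lambda>z. f z + g z"]) simp
  have I: "integrable P (\<lambda>x. Lp_norm lborel p (\<lambda>s. f (x, s) + g (x, s)))"
  proof (rule Bochner_Integration.integrable_bound [OF _ m])
    show "integrable P (\<lambda>x. Lp_norm lborel p (\<lambda>s. f (x, s)) + Lp_norm lborel p (\<lambda>s. g (x, s)))"
      using If Ig by simp
    show "AE x in P. norm (Lp_norm lborel p (\<lambda>s. f (x, s) + g (x, s)))
        \<le> norm (Lp_norm lborel p (\<lambda>s. f (x, s)) + Lp_norm lborel p (\<lambda>s. g (x, s)))"
      using le by eventually_elim (simp add: Lp_norm_nonneg)
  qed
  show "(\<lambda>z. f z + g z) \<in> L1_Lp P p" using mem I by (simp add: L1_Lp_def)
  show "L1_Lp_norm P p (\<lambda>z. f z + g z) \<le> L1_Lp_norm P p f + L1_Lp_norm P p g"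
    unfolding L1_Lp_norm_def Bochner_Integration.integral_add [OF If Ig, symmetric]
    using I If Ig le by (intro integral_mono_AE) auto
qed

lemma L1_Lp_cmult:
  fixes f :: "'b \<times> real \<Rightarrow> 'k::{real_normed_field,euclidean_space}"
  assumes p: "p = 1 \<or> p = 2"
  shows "f \<in> L1_Lp P p \<Longrightarrow> (\<lambda>z. c * f z) \<in> L1_Lp P p"
    and "L1_Lp_norm P p (\<lambda>z. c * f z) = norm c * L1_Lp_norm P p f"
proof -
  assume f: "f \<in> L1_Lp P p"
  then have [measurable]: "f \<in> borel_measurable (P \<Otimes>\<^sub>M lborel)" by (simp add: L1_Lp_def)
  have "AE x in P. (\<lambda>s. f (x, s)) \<in> Lp lborel p" using f by (simp add: L1_Lp_def)
  then have "AE x in P. (\<lambda>s. c * f (x, s)) \<in> Lp lborel p"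
    by eventually_elim (rule Lp_cmult(1) [OF p])
  then show "(\<lambda>z. c * f z) \<in> L1_Lp P p"
    using f by (simp add: L1_Lp_def Lp_cmult(2) [OF p])
next
  show "L1_Lp_norm P p (\<lambda>z. c * f z) = norm c * L1_Lp_norm P p f"
    by (simp add: L1_Lp_norm_def Lp_cmult(2) [OF p])
qed

lemma L1_Lp_diff:
  fixes f g :: "'b \<times> real \<Rightarrow> 'k::{real_normed_field,euclidean_space}"
  assumes p: "p = 1 \<or> p = 2" and f: "f \<in> L1_Lp P p" and g: "g \<in> L1_Lp P p"
  shows "(\<lambda>z. f z - g z) \<in> L1_Lp P p"
    and "L1_Lp_norm P p (\<lambda>z. f z - g z) \<le> L1_Lp_norm P p f + L1_Lp_norm P p g"
  using L1_Lp_add [OF p f L1_Lp_cmult(1) [OF p g, of "-1"]] L1_Lp_cmult(2) [OF p, of P "-1" g] by auto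

lemma L1_Lp_zero: "(\<lambda>_. 0) \<in> L1_Lp P p"
  by (simp add: L1_Lp_def Lp_zero Lp_norm_zero)

lemma L1_Lp_norm_zero: "L1_Lp_norm P p (\<lambda>_. 0) = 0"
  by (simp add: L1_Lp_norm_def Lp_norm_zero)

lemma L1_Lp_sum:
  fixes f :: "'i \<Rightarrow> 'b \<times> real \<Rightarrow> 'k::{real_normed_field,euclidean_space}"
  assumes p: "p = 1 \<or> p = 2" and "\<And>i. i \<in> I \<Longrightarrow> f i \<in> L1_Lp P p"
  shows "(\<lambda>z. \<Sum>i\<in>I. f i z) \<in> L1_Lp P p"
  using assms(2)
  by (induction I rule: infinite_finite_induct) (auto intro: L1_Lp_zero L1_Lp_add(1) [OF p])

lemma L1_Lp_tensor:
  fixes u :: "'b \<Rightarrow> 'k::{real_normed_field,euclidean_space}"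
  assumes p: "p = 1 \<or> p = 2" and u: "u \<in> Lp P 1" and h: "h \<in> Lp lborel p"
  shows "(\<lambda>(x, s). u x * h s) \<in> L1_Lp P p"
    and "L1_Lp_norm P p (\<lambda>(x, s). u x * h s) = Lp_norm P 1 u * Lp_norm lborel p h"
proof -
  have [measurable]: "u \<in> borel_measurable P" "h \<in> borel_measurable lborel"
    using u h by (auto simp: Lp_def)
  have eq: "Lp_norm lborel p (\<lambda>s. u x * h s) = norm (u x) * Lp_norm lborel p h" for x
    by (rule Lp_cmult(2) [OF p])
  have "integrable P u" using u by (simp add: Lp_1_iff)
  then show "(\<lambda>(x, s). u x * h s) \<in> L1_Lp P p"
    using Lp_cmult(1) [OF p h] by (simp add: L1_Lp_def eq)
  show "L1_Lp_norm P p (\<lambda>(x, s). u x * h s) = Lp_norm P 1 u * Lp_norm lborel p h"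
    by (simp add: L1_Lp_norm_def eq Lp_norm_1)
qed

definition L1_closure :: "'b measure \<Rightarrow> real \<Rightarrow> ('b \<times> real \<Rightarrow> 'k::{real_normed_field,euclidean_space}) set \<Rightarrow> ('b \<times> real \<Rightarrow> 'k) set" where
  "L1_closure P p A = {f \<in> L1_Lp P p. \<forall>\<epsilon>>0. \<exists>g\<in>A. L1_Lp_norm P p (\<lambda>z. f z - g z) < \<epsilon>}"

lemma L1_closure_L1_Lp: "f \<in> L1_closure P p A \<Longrightarrow> f \<in> L1_Lp P p"
  by (simp add: L1_closure_def)

lemma L1_closure_superset: "A \<subseteq> L1_Lp P p \<Longrightarrow> f \<in> A \<Longrightarrow> f \<in> L1_closure P p A"
  by (auto simp: L1_closure_def L1_Lp_norm_zero intro!: bexI [of _ f])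

lemma L1_closure_add:
  assumes p: "p = 1 \<or> p = 2" and A: "A \<subseteq> L1_Lp P p" "\<And>f g. f \<in> A \<Longrightarrow> g \<in> A \<Longrightarrow> (\<lambda>z. f z + g z) \<in> A"
    and f: "f \<in> L1_closure P p A" and g: "g \<in> L1_closure P p A"
  shows "(\<lambda>z. f z + g z) \<in> L1_closure P p A"
  unfolding L1_closure_def
proof (intro CollectI conjI allI impI)
  show "(\<lambda>z. f z + g z) \<in> L1_Lp P p"
    using f g by (intro L1_Lp_add(1) [OF p] L1_closure_L1_Lp)
  fix e :: real assume "e > 0"
  then have "e / 2 > 0" by simp
  then obtain f' g' where f': "f' \<in> A" "L1_Lp_norm P p (\<lambda>z. f z - f' z) < e / 2"
    and g': "g' \<in> A" "L1_Lp_norm P p (\<lambda>z. g z - g' z) < e / 2"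
    using f g unfolding L1_closure_def by blast
  have "f' \<in> L1_Lp P p" "g' \<in> L1_Lp P p" using f' g' A(1) by auto
  then have "L1_Lp_norm P p (\<lambda>z. (f z - f' z) + (g z - g' z)) \<le> L1_Lp_norm P p (\<lambda>z. f z - f' z) + L1_Lp_norm P p (\<lambda>z. g z - g' z)"
    using L1_closure_L1_Lp [OF f] L1_closure_L1_Lp [OF g]
    by (intro L1_Lp_add(2) [OF p] L1_Lp_diff(1) [OF p])
  also have "\<dots> < e" using f' g' by simp
  finally have "L1_Lp_norm P p (\<lambda>z. (f z + g z) - (f' z + g' z)) < e"
    by (simp add: algebra_simps)
  then show "\<exists>h\<in>A. L1_Lp_norm P p (\<lambda>z. f z + g z - h z) < e"
    using A(2) [OF f'(1) g'(1)] by (intro bexI [of _ "\<lambda>z. f' z + g' z"])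
qed

lemma L1_closure_cmult:
  assumes p: "p = 1 \<or> p = 2" and A: "\<And>f c. f \<in> A \<Longrightarrow> (\<lambda>z. c * f z) \<in> A"
    and f: "f \<in> L1_closure P p A"
  shows "(\<lambda>z. c * f z) \<in> L1_closure P p A"
  unfolding L1_closure_def
proof (intro CollectI conjI allI impI)
  show "(\<lambda>z. c * f z) \<in> L1_Lp P p"
    using f by (intro L1_Lp_cmult(1) [OF p] L1_closure_L1_Lp)
  fix e :: real assume "e > 0"
  then have "e / (norm c + 1) > 0" by (simp add: add_nonneg_pos)
  then obtain f' where f': "f' \<in> A" "L1_Lp_norm P p (\<lambda>z. f z - f' z) < e / (norm c + 1)"
    using f unfolding L1_closure_def by blast
  have "L1_Lp_norm P p (\<lambda>z. c * f z - c * f' z) = norm c * L1_Lp_norm P p (\<lambda>z. f z - f' z)"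
    using L1_Lp_cmult(2) [OF p, of P c "\<lambda>z. f z - f' z"] by (simp add: right_diff_distrib)
  also have "\<dots> \<le> (norm c + 1) * L1_Lp_norm P p (\<lambda>z. f z - f' z)"
    by (intro mult_right_mono L1_Lp_norm_nonneg) auto
  also have "\<dots> < e"
    using f'(2) pos_less_divide_eq [of "norm c + 1" _ e] by (simp add: add_nonneg_pos mult.commute)
  finally have "L1_Lp_norm P p (\<lambda>z. c * f z - c * f' z) < e" .
  then show "\<exists>h\<in>A. L1_Lp_norm P p (\<lambda>z. c * f z - h z) < e"
    using A [OF f'(1)] by (intro bexI [of _ "\<lambda>z. c * f' z"])
qed

lemma L1_closure_limit:
  assumes p: "p = 1 \<or> p = 2" and A: "A \<subseteq> L1_Lp P p" and f: "f \<in> L1_Lp P p"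
    and lim: "\<And>e. e > 0 \<Longrightarrow> \<exists>g\<in>L1_closure P p A. L1_Lp_norm P p (\<lambda>z. f z - g z) < e"
  shows "f \<in> L1_closure P p A"
  unfolding L1_closure_def
proof (intro CollectI conjI allI impI f)
  fix \<epsilon> :: real assume "\<epsilon> > 0"
  then have e2: "\<epsilon> / 2 > 0" by simp
  then obtain g where g: "g \<in> L1_closure P p A" "L1_Lp_norm P p (\<lambda>z. f z - g z) < \<epsilon> / 2"
    using lim by blast
  then obtain e where e: "e \<in> A" "L1_Lp_norm P p (\<lambda>z. g z - e z) < \<epsilon> / 2"
    using e2 unfolding L1_closure_def by blast
  have "e \<in> L1_Lp P p" using e A by auto
  then have "L1_Lp_norm P p (\<lambda>z. (f z - g z) + (g z - e z))
      \<le> L1_Lp_norm P p (\<lambda>z. f z - g z) + L1_Lp_norm P p (\<lambda>z. g z - e z)"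
    using f L1_closure_L1_Lp [OF g(1)] by (intro L1_Lp_add(2) [OF p] L1_Lp_diff(1) [OF p])
  then have "L1_Lp_norm P p (\<lambda>z. f z - e z) < \<epsilon>" using g e by simp
  then show "\<exists>e\<in>A. L1_Lp_norm P p (\<lambda>z. f z - e z) < \<epsilon>" using e by blast
qed

section \<open>Density of elementary functions\<close>

lemma Lp_dominated_tendsto:
  fixes h :: "'b \<Rightarrow> 'k::{real_normed_field,euclidean_space}"
  assumes p: "p = 1 \<or> p = 2" and h: "h \<in> Lp N p" and s: "\<And>i. s i \<in> borel_measurable N"
    and lim: "\<And>x. x \<in> space N \<Longrightarrow> (\<lambda>i. s i x) \<longlonglongrightarrow> h x"
    and bound: "\<And>i x. x \<in> space N \<Longrightarrow> norm (s i x) \<le> 2 * norm (h x)"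
    and e: "e > 0"
  shows "\<exists>i. s i \<in> Lp N p \<and> Lp_norm N p (\<lambda>x. h x - s i x) < e"
proof -
  have [measurable]: "h \<in> borel_measurable N" "s i \<in> borel_measurable N" for i
    using h s by (auto simp: Lp_def)
  have p0: "p > 0" using p by auto
  have Ih: "integrable N (\<lambda>x. (3 * norm (h x)) powr p)"
    using h by (simp add: Lp_def powr_mult)
  have b2: "norm (h x - s i x) \<le> 3 * norm (h x)" if "x \<in> space N" for x i
    using norm_triangle_ineq4 [of "h x" "s i x"] bound [OF that, of i] by simp
  have "s i \<in> Lp N p" for i
  proof -
    have "integrable N (\<lambda>x. norm (s i x) powr p)"
    proof (rule Bochner_Integration.integrable_bound [OF Ih])
      show "AE x in N. norm (norm (s i x) powr p) \<le> norm ((3 * norm (h x)) powr p)"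
      proof (rule AE_I2)
        fix x assume "x \<in> space N"
        then have "norm (s i x) \<le> 3 * norm (h x)" using bound [of x i] norm_ge_zero [of "h x"] by linarith
        then show "norm (norm (s i x) powr p) \<le> norm ((3 * norm (h x)) powr p)"
          using p0 by (simp add: powr_mono2)
      qed
    qed auto
    then show ?thesis by (simp add: Lp_def)
  qed
  moreover have "(\<lambda>i. \<integral>x. norm (h x - s i x) powr p \<partial>N) \<longlonglongrightarrow> (\<integral>x. 0 \<partial>N)"
  proof (rule integral_dominated_convergence [OF _ _ Ih])
    show "AE x in N. (\<lambda>i. norm (h x - s i x) powr p) \<longlonglongrightarrow> 0"
    proof (rule AE_I2)
      fix x assume x: "x \<in> space N"
      have "(\<lambda>i. h x - s i x) \<longlonglongrightarrow> 0"
        using tendsto_diff [OF tendsto_const [of "h x"] lim [OF x]] by simp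
      then have "(\<lambda>i. norm (h x - s i x)) \<longlonglongrightarrow> 0" by (rule tendsto_norm_zero)
      then have "(\<lambda>i. norm (h x - s i x) powr p) \<longlonglongrightarrow> 0 powr p"
        using p0 by (intro tendsto_powr2) auto
      then show "(\<lambda>i. norm (h x - s i x) powr p) \<longlonglongrightarrow> 0" by simp
    qed
    show "AE x in N. norm (norm (h x - s i x) powr p) \<le> (3 * norm (h x)) powr p" for i
      using b2 p0 by (intro AE_I2) (simp add: powr_mono2)
  qed auto
  then have "(\<lambda>i. Lp_norm N p (\<lambda>x. h x - s i x)) \<longlonglongrightarrow> 0 powr (1 / p)"
    unfolding Lp_norm_def using p0 by (intro tendsto_powr2) auto
  then have "(\<lambda>i. Lp_norm N p (\<lambda>x. h x - s i x)) \<longlonglongrightarrow> 0" by simp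
  then have "eventually (\<lambda>i. Lp_norm N p (\<lambda>x. h x - s i x) < e) sequentially"
    using e by (rule order_tendstoD)
  then obtain i where "Lp_norm N p (\<lambda>x. h x - s i x) < e"
    by (auto simp: eventually_sequentially)
  ultimately show ?thesis by blast
qed

lemma simple_function_expansion:
  fixes s :: "'b \<Rightarrow> 'k::{real_normed_field,euclidean_space}"
  assumes "simple_function N s" "x \<in> space N"
  shows "s x = (\<Sum>c\<in>s ` space N - {0}. c * of_real (indicator (s -` {c} \<inter> space N) x))"
proof -
  have fin: "finite (s ` space N)" using assms by (simp add: simple_function_def)
  have "(\<Sum>c\<in>s ` space N - {0}. c * of_real (indicator (s -` {c} \<inter> space N) x))
      = (\<Sum>c\<in>s ` space N - {0}. if c = s x then c else 0)"
    using assms(2) by (intro sum.cong) (auto simp: indicator_def)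
  also have "\<dots> = s x" using fin assms(2) by auto
  finally show ?thesis by simp
qed

text \<open>
  The elementary functions are the bridge to finite models: coordinates enter through finitely many
  measurable sets only. Lists of atoms make sums and multiples immediate.
\<close>

type_synonym ('a, 'k) atom = "'k \<times> nat set \<times> (nat \<Rightarrow> 'a set) \<times> real set"

fun atom_fun :: "('a, 'k::{real_normed_field,euclidean_space}) atom \<Rightarrow> (nat \<Rightarrow> 'a) \<times> real \<Rightarrow> 'k" where
  "atom_fun (c, S, A, B) (x, s) = c * of_real ((\<Prod>i\<in>S. indicator (A i) (x i)) * indicator B s)"

fun valid_atom :: "'a measure \<Rightarrow> nat \<Rightarrow> nat \<Rightarrow> ('a, 'k) atom \<Rightarrow> bool" where
  "valid_atom \<mu> n M (c, S, A, B) \<longleftrightarrow> S \<subseteq> {..<n} \<and> card S \<le> M \<and> (\<forall>i\<in>S. A i \<in> sets \<mu>) \<and>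
     B \<in> sets lborel \<and> emeasure lborel B < \<infinity>"

definition elementary :: "'a measure \<Rightarrow> nat \<Rightarrow> nat \<Rightarrow> ((nat \<Rightarrow> 'a) \<times> real \<Rightarrow> 'k::{real_normed_field,euclidean_space}) set" where
  "elementary \<mu> n M = {\<lambda>z. \<Sum>a\<leftarrow>xs. atom_fun a z | xs. \<forall>a\<in>set xs. valid_atom \<mu> n M a}"

lemma elementary_add:
  assumes "f \<in> elementary \<mu> n M" "g \<in> elementary \<mu> n M"
  shows "(\<lambda>z. f z + g z) \<in> elementary \<mu> n M"
proof -
  obtain xs ys where "\<forall>a\<in>set xs. valid_atom \<mu> n M a" "\<forall>a\<in>set ys. valid_atom \<mu> n M a"
    "f = (\<lambda>z. \<Sum>a\<leftarrow>xs. atom_fun a z)" "g = (\<lambda>z. \<Sum>a\<leftarrow>ys. atom_fun a z)"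
    using assms unfolding elementary_def by blast
  then show ?thesis unfolding elementary_def by (intro CollectI exI [of _ "xs @ ys"]) auto
qed

lemma elementary_cmult:
  assumes "f \<in> elementary \<mu> n M"
  shows "(\<lambda>z. c * f z) \<in> elementary \<mu> n M"
proof -
  obtain xs where xs: "\<forall>a\<in>set xs. valid_atom \<mu> n M a" "f = (\<lambda>z. \<Sum>a\<leftarrow>xs. atom_fun a z)"
    using assms unfolding elementary_def by blast
  let ?ys = "map (\<lambda>(d, r). (c * d, r)) xs"
  have "c * f z = (\<Sum>a\<leftarrow>?ys. atom_fun a z)" for z
    unfolding xs(2) by (induction xs) (auto simp: distrib_left mult.assoc, cases z, simp)
  moreover have "\<forall>a\<in>set ?ys. valid_atom \<mu> n M a" using xs(1) by auto
  ultimately show ?thesis unfolding elementary_def by blast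
qed

lemma elementary_zero: "(\<lambda>_. 0) \<in> elementary \<mu> n M"
  unfolding elementary_def by (intro CollectI exI [of _ "[]"]) auto

locale sample_power = prob_space \<mu> for \<mu> :: "'a measure" +
  fixes n M :: nat
begin

sublocale pr: finite_product_prob_space "\<lambda>_. \<mu>" "{..<n}"
  by unfold_locales auto

abbreviation "P \<equiv> prod_pow \<mu> n"

sublocale P: prob_space P
  unfolding prod_pow_def by (rule pr.prob_space_axioms)

sublocale P_line: pair_sigma_finite P lborel
  by unfold_locales

lemma space_P: "space P = (\<Pi>\<^sub>E i\<in>{..<n}. space \<mu>)"
  by (simp add: prod_pow_def space_PiM)

lemma Lp_indicator: "B \<in> sets lborel \<Longrightarrow> emeasure lborel B < \<infinity> \<Longrightarrow>
    (\<lambda>s. of_real (indicator B s) :: 'k::{real_normed_field,euclidean_space}) \<in> Lp lborel p"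
proof -
  assume B [measurable]: "B \<in> sets lborel" and fin: "emeasure lborel B < \<infinity>"
  have "norm (of_real (indicator B s) :: 'k) powr p = indicator B s" for s
    by (auto simp: indicator_def)
  then show ?thesis using B fin by (simp add: Lp_def integrable_real_indicator)
qed

lemma U_span_Lp: "v \<in> U_span \<mu> n M \<Longrightarrow> v \<in> Lp P 1"
  unfolding U_span_def by (auto simp: Lp_1_iff intro!: Bochner_Integration.integrable_sum)

lemma U_span_U1: "v \<in> U_span \<mu> n M \<Longrightarrow> v \<in> U1 \<mu> n M"
  unfolding U1_def using U_span_Lp by (auto intro!: bexI [of _ v] simp: Lp_norm_zero)

lemma few_coordinates_U1:
  assumes "g \<in> Lp P 1" "depends_on_at_most \<mu> n M g"
  shows "g \<in> U1 \<mu> n M"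
proof -
  have "g \<in> U_span \<mu> n M"
    unfolding U_span_def using assms
    by (intro CollectI exI [of _ 1] exI [of _ "\<lambda>_. 1"] exI [of _ "\<lambda>_. g"]) auto
  then show ?thesis by (rule U_span_U1)
qed

lemma U1_Lp_tensor_sum:
  fixes u :: "'i \<Rightarrow> (nat \<Rightarrow> 'a) \<Rightarrow> 'k::{real_normed_field,euclidean_space}"
  assumes "finite I" "\<And>i. i \<in> I \<Longrightarrow> u i \<in> U1 \<mu> n M" "\<And>i. i \<in> I \<Longrightarrow> h i \<in> Lp lborel p"
  shows "(\<lambda>(x, s). \<Sum>i\<in>I. u i x * h i s) \<in> U1_tensor_Lp \<mu> n M p"
proof -
  obtain b where b: "bij_betw b {..<card I} I"
    using ex_bij_betw_nat_finite [OF assms(1)] by (auto simp: atLeast0LessThan)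
  have "(\<lambda>(x, s). \<Sum>i\<in>I. u i x * h i s) = (\<lambda>(x, s). \<Sum>k<card I. u (b k) x * h (b k) s)"
    by (auto simp: fun_eq_iff sum.reindex_bij_betw [OF b, symmetric])
  moreover have "\<forall>k<card I. u (b k) \<in> U1 \<mu> n M \<and> h (b k) \<in> Lp lborel p"
    using assms b by (auto simp: bij_betw_def)
  ultimately show ?thesis
    unfolding U1_tensor_Lp_def
    by (intro CollectI exI [of _ "card I"] exI [of _ "\<lambda>k. u (b k)"] exI [of _ "\<lambda>k. h (b k)"]) auto
qed

lemma U1_tensor_add:
  assumes "f \<in> U1_tensor_Lp \<mu> n M p" "g \<in> U1_tensor_Lp \<mu> n M p"
  shows "(\<lambda>z. f z + g z) \<in> U1_tensor_Lp \<mu> n M p"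
proof -
  from assms(1) obtain m :: nat and u h where f: "f = (\<lambda>(x, s). \<Sum>i<m. u i x * h i s)"
    "\<forall>i<m. u i \<in> U1 \<mu> n M \<and> h i \<in> Lp lborel p"
    unfolding U1_tensor_Lp_def by blast
  from assms(2) obtain m' :: nat and u' h' where g: "g = (\<lambda>(x, s). \<Sum>i<m'. u' i x * h' i s)"
    "\<forall>i<m'. u' i \<in> U1 \<mu> n M \<and> h' i \<in> Lp lborel p"
    unfolding U1_tensor_Lp_def by blast
  define U where "U = case_sum u u'"
  define H where "H = case_sum h h'"
  have "(\<lambda>(x, s). \<Sum>i\<in>{..<m} <+> {..<m'}. U i x * H i s) \<in> U1_tensor_Lp \<mu> n M p"
    using f g by (intro U1_Lp_tensor_sum) (auto simp: U_def H_def)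
  moreover have "(\<lambda>(x, s). \<Sum>i\<in>{..<m} <+> {..<m'}. U i x * H i s) = (\<lambda>z. f z + g z)"
    unfolding f(1) g(1) by (auto simp: fun_eq_iff sum.Plus U_def H_def)
  ultimately show ?thesis by simp
qed

lemma U1_tensor_cmult:
  assumes p: "p = 1 \<or> p = 2" and "f \<in> U1_tensor_Lp \<mu> n M p"
  shows "(\<lambda>z. c * f z) \<in> U1_tensor_Lp \<mu> n M p"
proof -
  from assms(2) obtain m :: nat and u h where f: "f = (\<lambda>(x, s). \<Sum>i<m. u i x * h i s)"
    "\<forall>i<m. u i \<in> U1 \<mu> n M \<and> h i \<in> Lp lborel p"
    unfolding U1_tensor_Lp_def by blast
  have "(\<lambda>(x, s). \<Sum>i<m. u i x * (c * h i s)) \<in> U1_tensor_Lp \<mu> n M p"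
    using f by (intro U1_Lp_tensor_sum) (auto intro: Lp_cmult(1) [OF p])
  moreover have "(\<lambda>(x, s). \<Sum>i<m. u i x * (c * h i s)) = (\<lambda>z. c * f z)"
    unfolding f(1) by (auto simp: fun_eq_iff sum_distrib_left mult_ac)
  ultimately show ?thesis by simp
qed

lemma U1_tensor_L1_Lp:
  assumes p: "p = 1 \<or> p = 2" and "f \<in> U1_tensor_Lp \<mu> n M p"
  shows "f \<in> L1_Lp P p"
proof -
  from assms(2) obtain m :: nat and u h where f: "f = (\<lambda>(x, s). \<Sum>i<m. u i x * h i s)"
    "\<forall>i<m. u i \<in> U1 \<mu> n M \<and> h i \<in> Lp lborel p"
    unfolding U1_tensor_Lp_def by blast
  have "(\<lambda>z. \<Sum>i<m. (\<lambda>(x, s). u i x * h i s) z) \<in> L1_Lp P p"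
    using f by (intro L1_Lp_sum [OF p] L1_Lp_tensor(1) [OF p]) (auto simp: U1_def)
  moreover have "(\<lambda>z. \<Sum>i<m. (\<lambda>(x, s). u i x * h i s) z) = f"
    by (auto simp: fun_eq_iff f(1))
  ultimately show ?thesis by simp
qed

lemma U1_Lp_closure: "U1_Lp \<mu> n M p = L1_closure P p (U1_tensor_Lp \<mu> n M p)"
  by (simp add: U1_Lp_def L1_closure_def)

lemma U1_tensor_U1_Lp: "p = 1 \<or> p = 2 \<Longrightarrow> f \<in> U1_tensor_Lp \<mu> n M p \<Longrightarrow> f \<in> U1_Lp \<mu> n M p"
  unfolding U1_Lp_closure by (intro L1_closure_superset) (auto intro: U1_tensor_L1_Lp)

lemma U1_Lp_L1_Lp: "f \<in> U1_Lp \<mu> n M p \<Longrightarrow> f \<in> L1_Lp P p"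
  by (simp add: U1_Lp_def)

lemma U1_Lp_add:
  "\<lbrakk>p = 1 \<or> p = 2; f \<in> U1_Lp \<mu> n M p; g \<in> U1_Lp \<mu> n M p\<rbrakk> \<Longrightarrow> (\<lambda>z. f z + g z) \<in> U1_Lp \<mu> n M p"
  unfolding U1_Lp_closure by (intro L1_closure_add U1_tensor_add) (auto intro: U1_tensor_L1_Lp)

lemma U1_Lp_cmult:
  "\<lbrakk>p = 1 \<or> p = 2; f \<in> U1_Lp \<mu> n M p\<rbrakk> \<Longrightarrow> (\<lambda>z. c * f z) \<in> U1_Lp \<mu> n M p"
  unfolding U1_Lp_closure by (intro L1_closure_cmult U1_tensor_cmult)

lemma U1_Lp_diff:
  assumes p: "p = 1 \<or> p = 2" and f: "f \<in> U1_Lp \<mu> n M p" and g: "g \<in> U1_Lp \<mu> n M p"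
  shows "(\<lambda>z. f z - g z) \<in> U1_Lp \<mu> n M p"
  using U1_Lp_add [OF p f U1_Lp_cmult [OF p g, of "-1"]] by simp

lemma rectangle_measurable:
  assumes "S \<subseteq> {..<n}" "\<And>i. i \<in> S \<Longrightarrow> A i \<in> sets \<mu>"
  shows "(\<lambda>x. \<Prod>i\<in>S. indicator (A i) (x i) :: real) \<in> borel_measurable P"
  unfolding prod_pow_def
proof (rule borel_measurable_prod)
  fix i assume i: "i \<in> S"
  have [measurable]: "A i \<in> sets \<mu>" "(\<lambda>x. x i) \<in> measurable (Pi\<^sub>M {..<n} (\<lambda>i. \<mu>)) \<mu>"
    using i assms by (auto intro: measurable_component_singleton)
  show "(\<lambda>x. indicator (A i) (x i) :: real) \<in> borel_measurable (Pi\<^sub>M {..<n} (\<lambda>i. \<mu>))"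
    by measurable
qed

lemma bounded_in_Lp_1:
  fixes g :: "(nat \<Rightarrow> 'a) \<Rightarrow> 'k::{real_normed_field,euclidean_space}"
  assumes "g \<in> borel_measurable P" "\<And>x. x \<in> space P \<Longrightarrow> norm (g x) \<le> b"
  shows "g \<in> Lp P 1"
  unfolding Lp_1_iff using assms by (intro P.integrable_const_bound [of _ b]) auto

lemma atom_U1_Lp:
  assumes p: "p = 1 \<or> p = 2" and a: "valid_atom \<mu> n M a"
  shows "(atom_fun a :: _ \<Rightarrow> 'k::{real_normed_field,euclidean_space}) \<in> U1_Lp \<mu> n M p"
proof -
  obtain c S A B where a_eq: "a = (c, S, A, B)" by (cases a)
  have S: "S \<subseteq> {..<n}" "card S \<le> M" and A: "\<And>i. i \<in> S \<Longrightarrow> A i \<in> sets \<mu>"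
    and B: "B \<in> sets lborel" "emeasure lborel B < \<infinity>"
    using a by (auto simp: a_eq)
  define g :: "(nat \<Rightarrow> 'a) \<Rightarrow> 'k" where "g = (\<lambda>x. of_real (\<Prod>i\<in>S. indicator (A i) (x i)))"
  have "g \<in> Lp P 1"
  proof (rule bounded_in_Lp_1)
    show "g \<in> borel_measurable P"
      unfolding g_def using rectangle_measurable [OF S(1) A] by measurable
    show "norm (g x) \<le> 1" for x
      unfolding g_def by (simp add: prod_norm [symmetric]) (intro prod_le_1, auto simp: indicator_def)
  qed
  moreover have "depends_on_at_most \<mu> n M g"
    unfolding depends_on_at_most_def g_def using S
    by (intro exI [of _ S]) (auto intro!: arg_cong [where f = of_real] prod.cong)
  ultimately have "g \<in> U1 \<mu> n M" by (rule few_coordinates_U1)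
  moreover have "(\<lambda>s. c * of_real (indicator B s)) \<in> Lp lborel p"
    by (intro Lp_cmult(1) [OF p] Lp_indicator B)
  ultimately have "(\<lambda>(x, s). \<Sum>i\<in>{0 :: nat}. g x * (c * of_real (indicator B s))) \<in> U1_tensor_Lp \<mu> n M p"
    by (intro U1_Lp_tensor_sum) auto
  moreover have "(\<lambda>(x, s). \<Sum>i\<in>{0 :: nat}. g x * (c * of_real (indicator B s))) = atom_fun a"
    by (auto simp: fun_eq_iff a_eq g_def mult_ac)
  ultimately show ?thesis using U1_tensor_U1_Lp [OF p] by metis
qed

lemma U1_Lp_zero:
  assumes p: "p = 1 \<or> p = 2"
  shows "(\<lambda>_. 0 :: 'k::{real_normed_field,euclidean_space}) \<in> U1_Lp \<mu> n M p"
proof -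
  have "(\<lambda>(x :: nat \<Rightarrow> 'a, s :: real). \<Sum>i\<in>({} :: nat set). 0 * 0 :: 'k) \<in> U1_tensor_Lp \<mu> n M p"
    by (rule U1_Lp_tensor_sum) auto
  moreover have "(\<lambda>(x :: nat \<Rightarrow> 'a, s :: real). \<Sum>i\<in>({} :: nat set). 0 * 0 :: 'k) = (\<lambda>_. 0)" by (auto simp: fun_eq_iff)
  ultimately show ?thesis using U1_tensor_U1_Lp [OF p, of "\<lambda>_. 0 :: 'k"] by simp
qed

lemma elementary_U1_Lp:
  assumes p: "p = 1 \<or> p = 2" and "e \<in> elementary \<mu> n M"
  shows "e \<in> U1_Lp \<mu> n M p"
proof -
  obtain xs where xs: "\<forall>a\<in>set xs. valid_atom \<mu> n M a" "e = (\<lambda>z. \<Sum>a\<leftarrow>xs. atom_fun a z)"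
    using assms(2) unfolding elementary_def by blast
  from xs(1) have "(\<lambda>z. \<Sum>a\<leftarrow>xs. atom_fun a z) \<in> U1_Lp \<mu> n M p"
    by (induction xs) (auto intro: U1_Lp_zero [OF p] U1_Lp_add [OF p] atom_U1_Lp [OF p])
  then show ?thesis by (simp add: xs(2))
qed

end

lemma L1_Lp_cong:
  assumes "\<And>x s. x \<in> space P \<Longrightarrow> f (x, s) = g (x, s)"
  shows "f \<in> L1_Lp P p \<longleftrightarrow> g \<in> L1_Lp P p" and "L1_Lp_norm P p f = L1_Lp_norm P p g"
proof -
  have sec: "(\<lambda>s. f (x, s)) = (\<lambda>s. g (x, s))" if "x \<in> space P" for x
    using assms that by auto
  have "f \<in> borel_measurable (P \<Otimes>\<^sub>M lborel) \<longleftrightarrow> g \<in> borel_measurable (P \<Otimes>\<^sub>M lborel)"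
    by (intro measurable_cong) (auto simp: space_pair_measure assms)
  moreover have "(AE x in P. (\<lambda>s. f (x, s)) \<in> Lp lborel p) \<longleftrightarrow> (AE x in P. (\<lambda>s. g (x, s)) \<in> Lp lborel p)"
    by (intro AE_cong) (simp add: sec)
  moreover have "integrable P (\<lambda>x. Lp_norm lborel p (\<lambda>s. f (x, s))) \<longleftrightarrow> integrable P (\<lambda>x. Lp_norm lborel p (\<lambda>s. g (x, s)))"
    by (intro Bochner_Integration.integrable_cong) (simp_all add: sec)
  ultimately show "f \<in> L1_Lp P p \<longleftrightarrow> g \<in> L1_Lp P p" by (simp add: L1_Lp_def)
  show "L1_Lp_norm P p f = L1_Lp_norm P p g"
    unfolding L1_Lp_norm_def by (intro Bochner_Integration.integral_cong) (simp_all add: sec)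
qed

lemma emeasure_level_set_finite:
  fixes h :: "real \<Rightarrow> 'k::{real_normed_field,euclidean_space}"
  assumes h: "h \<in> Lp lborel p" and p: "p > 0" and c: "c \<noteq> 0"
  shows "emeasure lborel (h -` {c} \<inter> space lborel) < \<infinity>"
proof -
  have [measurable]: "h \<in> borel_measurable lborel" using h by (simp add: Lp_def)
  let ?B = "h -` {c} \<inter> space lborel"
  have B [measurable]: "?B \<in> sets lborel" by measurable
  have cp: "norm c powr p > 0" using c by simp
  have "integrable lborel (\<lambda>s. norm (h s) powr p / norm c powr p)"
    using h by (simp add: Lp_def)
  then have "integrable lborel (indicator ?B :: real \<Rightarrow> real)"
    by (rule Bochner_Integration.integrable_bound) (use cp in \<open>auto simp: indicator_def\<close>)
  then show ?thesis by (simp add: integrable_indicator_iff)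
qed

context sample_power
begin

abbreviation approximable :: "real \<Rightarrow> ((nat \<Rightarrow> 'a) \<times> real \<Rightarrow> 'k::{real_normed_field,euclidean_space}) set" where
  "approximable p \<equiv> L1_closure P p (elementary \<mu> n M)"

lemma elementary_L1_Lp: "p = 1 \<or> p = 2 \<Longrightarrow> e \<in> elementary \<mu> n M \<Longrightarrow> e \<in> L1_Lp P p"
  by (intro U1_Lp_L1_Lp elementary_U1_Lp)

lemma elementary_approximable:
  "p = 1 \<or> p = 2 \<Longrightarrow> e \<in> elementary \<mu> n M \<Longrightarrow> e \<in> approximable p"
  by (intro L1_closure_superset) (auto intro: elementary_L1_Lp)

lemma approximable_cong:
  assumes "\<And>x s. x \<in> space P \<Longrightarrow> f (x, s) = g (x, s)" "g \<in> approximable p"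
  shows "f \<in> approximable p"
proof -
  have "L1_Lp_norm P p (\<lambda>z. f z - e z) = L1_Lp_norm P p (\<lambda>z. g z - e z)" for e
    by (rule L1_Lp_cong(2)) (simp add: assms(1))
  then show ?thesis
    using assms(2) L1_Lp_cong(1) [of P f g p] assms(1) unfolding L1_closure_def by auto
qed

lemma approximable_limit:
  "\<lbrakk>p = 1 \<or> p = 2; f \<in> L1_Lp P p;
    \<And>e. e > 0 \<Longrightarrow> \<exists>g\<in>approximable p. L1_Lp_norm P p (\<lambda>z. f z - g z) < e\<rbrakk> \<Longrightarrow> f \<in> approximable p"
  by (intro L1_closure_limit) (auto intro: elementary_L1_Lp)

lemma approximable_add:
  "\<lbrakk>p = 1 \<or> p = 2; f \<in> approximable p; g \<in> approximable p\<rbrakk> \<Longrightarrow> (\<lambda>z. f z + g z) \<in> approximable p"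
  by (intro L1_closure_add elementary_add) (auto intro: elementary_L1_Lp)

lemma approximable_cmult:
  "\<lbrakk>p = 1 \<or> p = 2; f \<in> approximable p\<rbrakk> \<Longrightarrow> (\<lambda>z. c * f z) \<in> approximable p"
  by (intro L1_closure_cmult elementary_cmult)

lemma approximable_sum:
  assumes p: "p = 1 \<or> p = 2" and "\<And>i. i \<in> I \<Longrightarrow> f i \<in> approximable p"
  shows "(\<lambda>z. \<Sum>i\<in>I. f i z) \<in> approximable p"
  using assms(2)
  by (induction I rule: infinite_finite_induct)
    (auto intro: elementary_approximable [OF p elementary_zero] approximable_add [OF p])

lemma approximable_tensor_limit_left:
  fixes u :: "(nat \<Rightarrow> 'a) \<Rightarrow> 'k::{real_normed_field,euclidean_space}"
  assumes p: "p = 1 \<or> p = 2" and u: "u \<in> Lp P 1" and h: "h \<in> Lp lborel p"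
    and lim: "\<And>e. e > 0 \<Longrightarrow> \<exists>u'\<in>Lp P 1. (\<lambda>(x, s). u' x * h s) \<in> approximable p \<and> Lp_norm P 1 (\<lambda>x. u x - u' x) < e"
  shows "(\<lambda>(x, s). u x * h s) \<in> approximable p"
proof (rule approximable_limit [OF p L1_Lp_tensor(1) [OF p u h]])
  fix e :: real assume e: "e > 0"
  let ?H = "Lp_norm lborel p h + 1"
  have H: "?H > 0" using Lp_norm_nonneg [of lborel p h] by simp
  then have "e / ?H > 0" using e by simp
  then obtain u' where u': "u' \<in> Lp P 1" "(\<lambda>(x, s). u' x * h s) \<in> approximable p"
    "Lp_norm P 1 (\<lambda>x. u x - u' x) < e / ?H"
    using lim by blast
  have "(\<lambda>x. u x - u' x) \<in> Lp P 1"
    using Lp_add(1) [of 1 u P "\<lambda>x. -1 * u' x"] Lp_cmult(1) [of 1 u' P "-1"] u u' by simp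
  then have "L1_Lp_norm P p (\<lambda>(x, s). (u x - u' x) * h s) = Lp_norm P 1 (\<lambda>x. u x - u' x) * Lp_norm lborel p h"
    by (rule L1_Lp_tensor(2) [OF p _ h])
  also have "\<dots> \<le> Lp_norm P 1 (\<lambda>x. u x - u' x) * ?H"
    by (intro mult_left_mono Lp_norm_nonneg) auto
  also have "\<dots> < e" using u'(3) H by (simp add: pos_less_divide_eq)
  also have "(\<lambda>(x, s). (u x - u' x) * h s) = (\<lambda>z. (\<lambda>(x, s). u x * h s) z - (\<lambda>(x, s). u' x * h s) z)"
    by (auto simp: fun_eq_iff left_diff_distrib)
  finally have "L1_Lp_norm P p (\<lambda>z. (\<lambda>(x, s). u x * h s) z - (\<lambda>(x, s). u' x * h s) z) < e" .
  then show "\<exists>g\<in>approximable p. L1_Lp_norm P p (\<lambda>z. (\<lambda>(x, s). u x * h s) z - g z) < e"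
    using u'(2) by blast
qed

lemma rectangle_bounds:
  "norm (of_real (\<Prod>i\<in>S. indicator (A i) (x i)) :: 'k::{real_normed_field,euclidean_space}) \<le> 1"
  by (simp add: prod_norm [symmetric]) (intro prod_le_1, auto simp: indicator_def)

lemma approximable_rectangle:
  fixes h :: "real \<Rightarrow> 'k::{real_normed_field,euclidean_space}"
  assumes p: "p = 1 \<or> p = 2" and h: "h \<in> Lp lborel p"
    and S: "S \<subseteq> {..<n}" "card S \<le> M" and A: "\<And>i. i \<in> S \<Longrightarrow> A i \<in> sets \<mu>"
  shows "(\<lambda>(x, s). of_real (\<Prod>i\<in>S. indicator (A i) (x i)) * h s) \<in> approximable p"
proof -
  define u :: "(nat \<Rightarrow> 'a) \<Rightarrow> 'k" where "u = (\<lambda>x. of_real (\<Prod>i\<in>S. indicator (A i) (x i)))"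
  have u: "u \<in> Lp P 1"
  proof (rule bounded_in_Lp_1)
    show "u \<in> borel_measurable P"
      unfolding u_def using rectangle_measurable [OF S(1) A] by measurable
  qed (unfold u_def, rule rectangle_bounds)
  have p0: "p > 0" using p by auto
  have [measurable]: "h \<in> borel_measurable lborel" using h by (simp add: Lp_def)
  obtain F where F: "\<And>i. simple_function lborel (F i)" "\<And>x. (\<lambda>i. F i x) \<longlonglongrightarrow> h x"
    "\<And>i x. norm (F i x) \<le> 2 * norm (h x)"
    using borel_measurable_implies_sequence_metric [of h lborel 0] by (auto simp: dist_norm)
  have "(\<lambda>(x, s). u x * h s) \<in> approximable p"
  proof (rule approximable_limit [OF p L1_Lp_tensor(1) [OF p u h]])
    fix e :: real assume e: "e > 0"
    let ?U = "Lp_norm P 1 u + 1"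
    have U: "?U > 0" using Lp_norm_nonneg [of P 1 u] by simp
    then have "e / ?U > 0" using e by simp
    then obtain i where i: "F i \<in> Lp lborel p" "Lp_norm lborel p (\<lambda>s. h s - F i s) < e / ?U"
      using Lp_dominated_tendsto [OF p h, of F "e / ?U"] F borel_measurable_simple_function by blast
    let ?C = "F i ` space lborel - {0}"
    define B where "B = (\<lambda>c. F i -` {c} \<inter> space lborel)"
    have "(\<lambda>z. \<Sum>c\<in>?C. atom_fun (c, S, A, B c) z) \<in> approximable p"
    proof (rule approximable_sum [OF p])
      fix c assume c: "c \<in> ?C"
      have "B c \<in> sets lborel" unfolding B_def by (rule simple_functionD(2) [OF F(1)])
      moreover have "emeasure lborel (B c) < \<infinity>"
        unfolding B_def using i(1) p0 c by (intro emeasure_level_set_finite) auto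
      ultimately have "valid_atom \<mu> n M (c, S, A, B c)" using S A by simp
      then have "(\<lambda>z. \<Sum>a\<leftarrow>[(c, S, A, B c)]. atom_fun a z) \<in> elementary \<mu> n M"
        unfolding elementary_def by (intro CollectI exI [of _ "[(c, S, A, B c)]"]) auto
      then show "atom_fun (c, S, A, B c) \<in> approximable p"
        using elementary_approximable [OF p] by simp
    qed
    moreover have "(\<lambda>z. \<Sum>c\<in>?C. atom_fun (c, S, A, B c) z) = (\<lambda>(x, s). u x * F i s)"
    proof (rule ext, clarify)
      fix x s
      have "F i s = (\<Sum>c\<in>?C. c * of_real (indicator (B c) s))"
        unfolding B_def by (rule simple_function_expansion [OF F(1)]) simp
      then show "(\<Sum>c\<in>?C. atom_fun (c, S, A, B c) (x, s)) = u x * F i s"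
        by (simp add: u_def sum_distrib_left mult_ac)
    qed
    ultimately have app: "(\<lambda>(x, s). u x * F i s) \<in> approximable p" by simp
    have "(\<lambda>s. h s - F i s) \<in> Lp lborel p"
      using Lp_add(1) [OF p h Lp_cmult(1) [OF p i(1), of "-1"]] by simp
    then have "L1_Lp_norm P p (\<lambda>(x, s). u x * (h s - F i s)) = Lp_norm P 1 u * Lp_norm lborel p (\<lambda>s. h s - F i s)"
      by (rule L1_Lp_tensor(2) [OF p u])
    also have "\<dots> \<le> ?U * Lp_norm lborel p (\<lambda>s. h s - F i s)"
      by (intro mult_right_mono Lp_norm_nonneg) auto
    also have "\<dots> < e" using i(2) U by (simp add: pos_less_divide_eq mult.commute)
    also have "(\<lambda>(x, s). u x * (h s - F i s)) = (\<lambda>z. (\<lambda>(x, s). u x * h s) z - (\<lambda>(x, s). u x * F i s) z)"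
      by (auto simp: fun_eq_iff right_diff_distrib)
    finally have "L1_Lp_norm P p (\<lambda>z. (\<lambda>(x, s). u x * h s) z - (\<lambda>(x, s). u x * F i s) z) < e" .
    then show "\<exists>g\<in>approximable p. L1_Lp_norm P p (\<lambda>z. (\<lambda>(x, s). u x * h s) z - g z) < e"
      using app by blast
  qed
  then show ?thesis by (simp add: u_def)
qed

lemma restrict_measurable: "S \<subseteq> {..<n} \<Longrightarrow> (\<lambda>x. restrict x S) \<in> measurable P (\<Pi>\<^sub>M i\<in>S. \<mu>)"
  unfolding prod_pow_def by (rule measurable_restrict_subset)

text \<open>
  The sets \<open>E\<close> with this property contain the rectangles, which form an intersection-stable generator,
  and are closed under complements and countable disjoint unions.
\<close>

lemma approximable_cylinder:
  fixes h :: "real \<Rightarrow> 'k::{real_normed_field,euclidean_space}"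
  assumes p: "p = 1 \<or> p = 2" and h: "h \<in> Lp lborel p"
    and S: "S \<subseteq> {..<n}" "card S \<le> M" and E: "E \<in> sets (\<Pi>\<^sub>M i\<in>S. \<mu>)"
  shows "(\<lambda>(x, s). of_real (indicator E (restrict x S)) * h s) \<in> approximable p"
proof -
  have fS: "finite S" using S finite_subset by blast
  let ?\<Omega> = "\<Pi>\<^sub>E i\<in>S. space \<mu>"
  have E': "E \<in> sigma_sets ?\<Omega> (prod_algebra S (\<lambda>_. \<mu>))" using E by (simp add: sets_PiM)
  have \<Omega>: "restrict x S \<in> ?\<Omega>" if "x \<in> space P" for x
    using that S by (auto simp: space_P)
  have meas: "(\<lambda>x. of_real (indicator E (restrict x S)) :: 'k) \<in> Lp P 1"
    if "E \<in> sigma_sets ?\<Omega> (prod_algebra S (\<lambda>_. \<mu>))" for E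
  proof (rule bounded_in_Lp_1)
    have [measurable]: "E \<in> sets (\<Pi>\<^sub>M i\<in>S. \<mu>)" using that by (simp add: sets_PiM)
    note [measurable] = restrict_measurable [OF S(1)]
    show "(\<lambda>x. of_real (indicator E (restrict x S)) :: 'k) \<in> borel_measurable P" by measurable
    show "norm (of_real (indicator E (restrict x S)) :: 'k) \<le> 1" for x by (simp add: indicator_def)
  qed
  from Int_stable_prod_algebra prod_algebra_sets_into_space E' show ?thesis
  proof (induction rule: sigma_sets_induct_disjoint)
    case (basic E)
    then obtain A where A: "E = (\<Pi>\<^sub>E i\<in>S. A i)" "\<And>i. i \<in> S \<Longrightarrow> A i \<in> sets \<mu>"
      by (auto simp: prod_algebra_eq_finite [OF fS])
    have eq: "indicator E (restrict x S) = (\<Prod>i\<in>S. indicator (A i) (x i) :: real)" for x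
    proof (cases "\<forall>i\<in>S. x i \<in> A i")
      case True then show ?thesis by (auto simp: A(1) indicator_def)
    next
      case False
      then obtain i where i: "i \<in> S" "x i \<notin> A i" by blast
      then have "(\<Prod>i\<in>S. indicator (A i) (x i) :: real) = 0"
        using fS by (auto intro!: prod_zero bexI [of _ i])
      then show ?thesis using i by (auto simp: A(1) indicator_def PiE_iff)
    qed
    show ?case unfolding eq by (rule approximable_rectangle [OF p h S A(2)])
  next
    case empty
    then show ?case using elementary_approximable [OF p elementary_zero] by (simp add: case_prod_beta)
  next
    case (compl E)
    have one: "(\<lambda>(x, s). h s) \<in> approximable p"
      using approximable_rectangle [OF p h, of "{}" "\<lambda>_. {}"] by simp
    have "(\<lambda>z. (\<lambda>(x, s). h s) z + (-1) * (\<lambda>(x, s). of_real (indicator E (restrict x S)) * h s) z) \<in> approximable p"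
      by (intro approximable_add [OF p] approximable_cmult [OF p] compl one)
    then show ?case
    proof (rule approximable_cong [rotated])
      fix x s assume x: "x \<in> space P"
      have "indicator (?\<Omega> - E) y = (1 - indicator E y :: real)" if "y \<in> ?\<Omega>" for y
        using that by (cases "y \<in> E") auto
      from this [OF \<Omega> [OF x]]
      show "(\<lambda>(x, s). of_real (indicator (?\<Omega> - E) (restrict x S)) * h s) (x, s)
          = (\<lambda>(x, s). h s) (x, s) + (-1) * (\<lambda>(x, s). of_real (indicator E (restrict x S)) * h s) (x, s)"
        by (simp only: prod.case of_real_diff of_real_1) (simp only: left_diff_distrib, simp)
    qed
  next
    case (union A)
    have UN: "(\<Union>i. A i) \<in> sigma_sets ?\<Omega> (prod_algebra S (\<lambda>_. \<mu>))"
      using union by (intro sigma_sets.Union) auto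
    show ?case
    proof (rule approximable_tensor_limit_left [OF p meas [OF UN] h])
      fix e :: real assume e: "e > 0"
      define v :: "nat \<Rightarrow> (nat \<Rightarrow> 'a) \<Rightarrow> 'k" where
        "v = (\<lambda>k x. \<Sum>i<k. of_real (indicator (A i) (restrict x S)))"
      have v_eq: "v k x = of_real (indicator (\<Union>i<k. A i) (restrict x S))" for k x
        using union(1) unfolding v_def of_real_sum [symmetric]
        by (subst indicator_UN_disjoint) (auto simp: disjoint_family_on_def)
      have "v k \<in> borel_measurable P" for k
        unfolding v_def using union(2) by (intro borel_measurable_sum Lp_measurable [OF meas]) auto
      moreover have "(\<lambda>k. v k x) \<longlonglongrightarrow> of_real (indicator (\<Union>i. A i) (restrict x S))" for x
      proof -
        have "(\<lambda>i. indicator (A i) (restrict x S) :: real) sums indicator (\<Union>i. A i) (restrict x S)"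
          using union(1) by (intro indicator_sums) (auto simp: disjoint_family_on_def)
        then show ?thesis unfolding v_def sums_def of_real_sum [symmetric] by (intro tendsto_of_real)
      qed
      moreover have "norm (v k x) \<le> 2 * norm (of_real (indicator (\<Union>i. A i) (restrict x S)) :: 'k)" for k x
        by (auto simp: v_eq indicator_def)
      ultimately obtain k where k: "v k \<in> Lp P 1"
        "Lp_norm P 1 (\<lambda>x. of_real (indicator (\<Union>i. A i) (restrict x S)) - v k x) < e"
        using Lp_dominated_tendsto [OF _ meas [OF UN] _ _ _ e, of v] by blast
      have "(\<lambda>z. \<Sum>i<k. (\<lambda>(x, s). of_real (indicator (A i) (restrict x S)) * h s) z) \<in> approximable p"
        by (intro approximable_sum [OF p] union)
      moreover have "(\<lambda>z. \<Sum>i<k. (\<lambda>(x, s). of_real (indicator (A i) (restrict x S)) * h s) z) = (\<lambda>(x, s). v k x * h s)"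
        by (auto simp: v_def sum_distrib_right)
      ultimately show "\<exists>u'\<in>Lp P 1. (\<lambda>(x, s). u' x * h s) \<in> approximable p \<and>
          Lp_norm P 1 (\<lambda>x. of_real (indicator (\<Union>i. A i) (restrict x S)) - u' x) < e"
        using k by auto
    qed
  qed
qed

text \<open>
  Freezing the coordinates outside \<open>S\<close> turns \<open>g\<close> into a function on the product over \<open>S\<close>; the level
  sets of its simple approximants are then cylinders over \<open>S\<close>.
\<close>

lemma approximable_few_coordinates:
  fixes g :: "(nat \<Rightarrow> 'a) \<Rightarrow> 'k::{real_normed_field,euclidean_space}"
  assumes p: "p = 1 \<or> p = 2" and h: "h \<in> Lp lborel p"
    and g: "g \<in> Lp P 1" "depends_on_at_most \<mu> n M g"
  shows "(\<lambda>(x, s). g x * h s) \<in> approximable p"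
proof -
  obtain S where S: "S \<subseteq> {..<n}" "card S \<le> M"
    and dep: "\<And>x y. \<lbrakk>x \<in> space P; y \<in> space P; \<forall>i\<in>S. x i = y i\<rbrakk> \<Longrightarrow> g x = g y"
    using g(2) unfolding depends_on_at_most_def by blast
  have [measurable]: "g \<in> borel_measurable P" using g(1) by (rule Lp_measurable)
  obtain x0 where x0: "x0 \<in> space P" using P.not_empty by blast
  let ?PS = "\<Pi>\<^sub>M i\<in>S. \<mu>"
  define ext where "ext = (\<lambda>y. \<lambda>i\<in>{..<n}. if i \<in> S then y i else x0 i)"
  have ext_meas [measurable]: "ext \<in> measurable ?PS P"
    unfolding ext_def prod_pow_def
  proof (rule measurable_restrict)
    fix i assume i: "i \<in> {..<n}"
    have "x0 i \<in> space \<mu>" using x0 i by (auto simp: space_P)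
    then show "(\<lambda>y. if i \<in> S then y i else x0 i) \<in> measurable ?PS \<mu>"
      by (cases "i \<in> S") auto
  qed
  define G where "G = (\<lambda>y. g (ext y))"
  have G [measurable]: "G \<in> borel_measurable ?PS" unfolding G_def by measurable
  have rS: "restrict x S \<in> space ?PS" if "x \<in> space P" for x
    using that S by (auto simp: space_P space_PiM)
  have G_eq: "G (restrict x S) = g x" if "x \<in> space P" for x
    unfolding G_def
  proof (rule dep)
    show "ext (restrict x S) \<in> space P" using rS [OF that] ext_meas by (rule measurable_space [rotated])
    show "\<forall>i\<in>S. ext (restrict x S) i = x i" using S by (auto simp: ext_def)
  qed fact
  obtain F where F': "\<forall>i. simple_function ?PS (F i)" "\<forall>y\<in>space ?PS. (\<lambda>i. F i y) \<longlonglongrightarrow> G y"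
    "\<forall>i. \<forall>y\<in>space ?PS. norm (F i y) \<le> 2 * norm (G y)"
    using borel_measurable_implies_sequence_metric [OF G, of 0] unfolding dist_norm diff_zero by blast
  then have F: "\<And>i. simple_function ?PS (F i)" "\<And>y. y \<in> space ?PS \<Longrightarrow> (\<lambda>i. F i y) \<longlonglongrightarrow> G y"
    "\<And>i y. y \<in> space ?PS \<Longrightarrow> norm (F i y) \<le> 2 * norm (G y)"
    by auto
  show ?thesis
  proof (rule approximable_tensor_limit_left [OF p g(1) h])
    fix e :: real assume e: "e > 0"
    define v where "v = (\<lambda>i x. F i (restrict x S))"
    have "v i \<in> borel_measurable P" for i
      unfolding v_def using measurable_compose [OF restrict_measurable [OF S(1)] borel_measurable_simple_function [OF F(1)]]
      by simp
    moreover have "(\<lambda>i. v i x) \<longlonglongrightarrow> g x" "norm (v i x) \<le> 2 * norm (g x)" if "x \<in> space P" for x i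
      using F(2,3) [OF rS [OF that]] G_eq [OF that] by (auto simp: v_def)
    ultimately obtain i where i: "v i \<in> Lp P 1" "Lp_norm P 1 (\<lambda>x. g x - v i x) < e"
      using Lp_dominated_tendsto [OF _ g(1) _ _ _ e, of v] by blast
    let ?C = "F i ` space ?PS - {0}"
    define B where "B = (\<lambda>c. F i -` {c} \<inter> space ?PS)"
    have "(\<lambda>z. \<Sum>c\<in>?C. c * (\<lambda>(x, s). of_real (indicator (B c) (restrict x S)) * h s) z) \<in> approximable p"
      unfolding B_def
      by (intro approximable_sum [OF p] approximable_cmult [OF p] approximable_cylinder [OF p h S]
          simple_functionD(2) [OF F(1)])
    then have "(\<lambda>(x, s). v i x * h s) \<in> approximable p"
    proof (rule approximable_cong [rotated])
      fix x s assume "x \<in> space P"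
      then have "v i x = (\<Sum>c\<in>?C. c * of_real (indicator (B c) (restrict x S)))"
        unfolding B_def v_def by (intro simple_function_expansion [OF F(1)] rS)
      then show "(\<lambda>(x, s). v i x * h s) (x, s)
          = (\<Sum>c\<in>?C. c * (\<lambda>(x, s). of_real (indicator (B c) (restrict x S)) * h s) (x, s))"
        by (simp add: sum_distrib_right mult.assoc)
    qed
    then show "\<exists>u'\<in>Lp P 1. (\<lambda>(x, s). u' x * h s) \<in> approximable p \<and> Lp_norm P 1 (\<lambda>x. g x - u' x) < e"
      using i by blast
  qed
qed

lemma approximable_U1:
  fixes u :: "(nat \<Rightarrow> 'a) \<Rightarrow> 'k::{real_normed_field,euclidean_space}"
  assumes p: "p = 1 \<or> p = 2" and h: "h \<in> Lp lborel p" and u: "u \<in> U1 \<mu> n M"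
  shows "(\<lambda>(x, s). u x * h s) \<in> approximable p"
proof (rule approximable_tensor_limit_left [OF p _ h])
  show "u \<in> Lp P 1" using u by (simp add: U1_def)
  fix e :: real assume "e > 0"
  then obtain v where v: "v \<in> U_span \<mu> n M" "Lp_norm P 1 (\<lambda>x. u x - v x) < e"
    using u by (auto simp: U1_def)
  from v(1) obtain m :: nat and c g where v_eq: "v = (\<lambda>x. \<Sum>i<m. c i * g i x)"
    and g: "\<forall>i<m. g i \<in> Lp P 1 \<and> depends_on_at_most \<mu> n M (g i)"
    unfolding U_span_def by blast
  have "(\<lambda>z. \<Sum>i<m. c i * (\<lambda>(x, s). g i x * h s) z) \<in> approximable p"
    using g by (intro approximable_sum [OF p] approximable_cmult [OF p] approximable_few_coordinates [OF p h]) auto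
  moreover have "(\<lambda>z. \<Sum>i<m. c i * (\<lambda>(x, s). g i x * h s) z) = (\<lambda>(x, s). v x * h s)"
    by (auto simp: v_eq sum_distrib_right mult.assoc)
  ultimately show "\<exists>u'\<in>Lp P 1. (\<lambda>(x, s). u' x * h s) \<in> approximable p \<and> Lp_norm P 1 (\<lambda>x. u x - u' x) < e"
    using v U_span_Lp [OF v(1)] by auto
qed

lemma U1_Lp_approximable:
  fixes f :: "(nat \<Rightarrow> 'a) \<times> real \<Rightarrow> 'k::{real_normed_field,euclidean_space}"
  assumes p: "p = 1 \<or> p = 2" and f: "f \<in> U1_Lp \<mu> n M p"
  shows "f \<in> approximable p"
proof (rule approximable_limit [OF p U1_Lp_L1_Lp [OF f]])
  fix e :: real assume "e > 0"
  then obtain g where g: "g \<in> U1_tensor_Lp \<mu> n M p" "L1_Lp_norm P p (\<lambda>z. f z - g z) < e"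
    using f by (auto simp: U1_Lp_def)
  from g(1) obtain m :: nat and u h where g_eq: "g = (\<lambda>(x, s). \<Sum>i<m. u i x * h i s)"
    and uh: "\<forall>i<m. u i \<in> U1 \<mu> n M \<and> h i \<in> Lp lborel p"
    unfolding U1_tensor_Lp_def by blast
  have "(\<lambda>z. \<Sum>i<m. (\<lambda>(x, s). u i x * h i s) z) \<in> approximable p"
    using uh by (intro approximable_sum [OF p] approximable_U1 [OF p]) auto
  moreover have "(\<lambda>z. \<Sum>i<m. (\<lambda>(x, s). u i x * h i s) z) = g"
    by (auto simp: g_eq)
  ultimately have "g \<in> approximable p" by (simp only:)
  then show "\<exists>g\<in>approximable p. L1_Lp_norm P p (\<lambda>z. f z - g z) < e" using g(2) by blast
qed

end

section \<open>Pairing with bounded functions\<close>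

lemma pairing_section_1:
  fixes \<Psi> h :: "real \<Rightarrow> 'k::{real_normed_field,euclidean_space}"
  assumes [measurable]: "\<Psi> \<in> borel_measurable lborel" and \<Psi>: "\<And>s. norm (\<Psi> s) \<le> c" and h: "h \<in> Lp lborel 1"
  shows "integrable lborel (\<lambda>s. norm (\<Psi> s) * norm (h s))"
    and "(\<integral>s. norm (\<Psi> s) * norm (h s) \<partial>lborel) \<le> c * Lp_norm lborel 1 h"
proof -
  have [measurable]: "h \<in> borel_measurable lborel" using h by (rule Lp_measurable)
  have Ih: "integrable lborel (\<lambda>s. c * norm (h s))" using h by (simp add: Lp_1_iff)
  have le: "norm (\<Psi> s) * norm (h s) \<le> c * norm (h s)" for s
    using \<Psi> by (intro mult_right_mono) auto
  have c: "0 \<le> c" using \<Psi> [of 0] norm_ge_zero order_trans by blast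
  show I: "integrable lborel (\<lambda>s. norm (\<Psi> s) * norm (h s))"
    by (rule Bochner_Integration.integrable_bound [OF Ih]) (use le c in auto)
  have "(\<integral>s. norm (\<Psi> s) * norm (h s) \<partial>lborel) \<le> (\<integral>s. c * norm (h s) \<partial>lborel)"
    using I Ih le by (intro integral_mono) auto
  then show "(\<integral>s. norm (\<Psi> s) * norm (h s) \<partial>lborel) \<le> c * Lp_norm lborel 1 h"
    by (simp add: Lp_norm_1)
qed

text \<open>
  The Cauchy-Schwarz inequality, by the arithmetic-geometric mean inequality with a weight adapted to the
  two norms; the norm of \<open>h\<close> is enlarged because it may vanish.
\<close>

lemma pairing_section_2:
  fixes \<Psi> h :: "real \<Rightarrow> 'k::{real_normed_field,euclidean_space}"
  assumes [measurable]: "\<Psi> \<in> borel_measurable lborel" and c: "c > 0"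
    and I\<Psi>: "integrable lborel (\<lambda>s. (norm (\<Psi> s))\<^sup>2)" and \<Psi>: "(\<integral>s. (norm (\<Psi> s))\<^sup>2 \<partial>lborel) \<le> c\<^sup>2"
    and h: "h \<in> Lp lborel 2"
  shows "integrable lborel (\<lambda>s. norm (\<Psi> s) * norm (h s))"
    and "(\<integral>s. norm (\<Psi> s) * norm (h s) \<partial>lborel) \<le> c * Lp_norm lborel 2 h"
proof -
  have [measurable]: "h \<in> borel_measurable lborel" using h by (rule Lp_measurable)
  have Ih: "integrable lborel (\<lambda>s. (norm (h s))\<^sup>2)" using h by (simp add: Lp_2_iff)
  have le: "norm (\<Psi> s) * norm (h s) \<le> (l * (norm (\<Psi> s))\<^sup>2 + (norm (h s))\<^sup>2 / l) / 2" if "l > 0" for l s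
  proof -
    have "(l * (norm (\<Psi> s))\<^sup>2 + (norm (h s))\<^sup>2 / l) / 2 - norm (\<Psi> s) * norm (h s)
        = (l * norm (\<Psi> s) - norm (h s))\<^sup>2 / (2 * l)"
      using that by (simp add: field_simps power2_eq_square)
    moreover have "0 \<le> (l * norm (\<Psi> s) - norm (h s))\<^sup>2 / (2 * l)" using that by simp
    ultimately show ?thesis by linarith
  qed
  have J: "integrable lborel (\<lambda>s. (l * (norm (\<Psi> s))\<^sup>2 + (norm (h s))\<^sup>2 / l) / 2)" for l
    using I\<Psi> Ih by simp
  show I: "integrable lborel (\<lambda>s. norm (\<Psi> s) * norm (h s))"
    by (rule Bochner_Integration.integrable_bound [OF J [of 1]]) (use le [of 1] in auto)
  have "(\<integral>s. norm (\<Psi> s) * norm (h s) \<partial>lborel) \<le> c * Lp_norm lborel 2 h + e" if e: "e > 0" for e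
  proof -
    define a where "a = Lp_norm lborel 2 h + e / c"
    have a: "a > 0" using Lp_norm_nonneg [of lborel 2 h] e c by (simp add: a_def add_nonneg_pos)
    have h2: "(\<integral>s. (norm (h s))\<^sup>2 \<partial>lborel) \<le> a\<^sup>2"
      using e c by (intro sqrt_le_D) (simp add: a_def Lp_norm_2)
    have "(\<integral>s. norm (\<Psi> s) * norm (h s) \<partial>lborel)
        \<le> (\<integral>s. ((a / c) * (norm (\<Psi> s))\<^sup>2 + (norm (h s))\<^sup>2 / (a / c)) / 2 \<partial>lborel)"
      by (rule integral_mono [OF I J le]) (use a c in auto)
    also have "\<dots> = ((a / c) * (\<integral>s. (norm (\<Psi> s))\<^sup>2 \<partial>lborel) + (\<integral>s. (norm (h s))\<^sup>2 \<partial>lborel) / (a / c)) / 2"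
      using I\<Psi> Ih by simp
    also have "\<dots> \<le> ((a / c) * c\<^sup>2 + a\<^sup>2 / (a / c)) / 2"
      using \<Psi> h2 a c by (intro divide_right_mono add_mono mult_left_mono) auto
    also have "\<dots> = c * a" using a c by (simp add: power2_eq_square)
    also have "\<dots> = c * Lp_norm lborel 2 h + e" using c by (simp add: a_def distrib_left)
    finally show ?thesis .
  qed
  then show "(\<integral>s. norm (\<Psi> s) * norm (h s) \<partial>lborel) \<le> c * Lp_norm lborel 2 h"
    by (rule field_le_epsilon)
qed

context sample_power
begin

text \<open>
  The sectionwise Hoelder bounds are integrated over the first factor. Integrability on the product has
  to be established first, since the assumptions concern almost all sections.
\<close>

lemma pairing_bound:
  fixes \<Psi> a :: "(nat \<Rightarrow> 'a) \<times> real \<Rightarrow> 'k::{real_normed_field,euclidean_space}"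
  assumes \<Psi> [measurable]: "\<Psi> \<in> borel_measurable (P \<Otimes>\<^sub>M lborel)" and a: "a \<in> L1_Lp P p" and c: "c \<ge> 0"
    and int: "\<And>x h. x \<in> space P \<Longrightarrow> (h :: real \<Rightarrow> 'k) \<in> Lp lborel p \<Longrightarrow> integrable lborel (\<lambda>s. norm (\<Psi> (x, s)) * norm (h s))"
    and le: "\<And>x h. x \<in> space P \<Longrightarrow> (h :: real \<Rightarrow> 'k) \<in> Lp lborel p \<Longrightarrow>
      (\<integral>s. norm (\<Psi> (x, s)) * norm (h s) \<partial>lborel) \<le> c * Lp_norm lborel p h"
  shows "integrable (P \<Otimes>\<^sub>M lborel) (\<lambda>z. inner (\<Psi> z) (a z))"
    and "(\<integral>z. inner (\<Psi> z) (a z) \<partial>(P \<Otimes>\<^sub>M lborel)) \<le> c * L1_Lp_norm P p a"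
proof -
  have [measurable]: "a \<in> borel_measurable (P \<Otimes>\<^sub>M lborel)" using a by (rule L1_Lp_measurable)
  define g where "g = (\<lambda>z. inner (\<Psi> z) (a z))"
  have g_meas [measurable]: "g \<in> borel_measurable (P \<Otimes>\<^sub>M lborel)" unfolding g_def by measurable
  have aL: "AE x in P. (\<lambda>s. a (x, s)) \<in> Lp lborel p" and aI: "integrable P (\<lambda>x. Lp_norm lborel p (\<lambda>s. a (x, s)))"
    using a by (auto simp: L1_Lp_def)
  have g_le: "norm (g (x, s)) \<le> norm (\<Psi> (x, s)) * norm (a (x, s))" for x s
    unfolding g_def by (simp add: Cauchy_Schwarz_ineq2)
  have sec: "AE x in P. integrable lborel (\<lambda>s. g (x, s)) \<and>
      (\<integral>s. norm (g (x, s)) \<partial>lborel) \<le> c * Lp_norm lborel p (\<lambda>s. a (x, s))"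
    using aL AE_space
  proof eventually_elim
    case (elim x)
    have [measurable]: "(\<lambda>s. g (x, s)) \<in> borel_measurable lborel"
      using measurable_compose [OF measurable_Pair1' [OF elim(2)] g_meas] by simp
    have I: "integrable lborel (\<lambda>s. g (x, s))"
      by (rule Bochner_Integration.integrable_bound [OF int [OF elim(2,1)]]) (use g_le in auto)
    moreover have "(\<integral>s. norm (g (x, s)) \<partial>lborel) \<le> (\<integral>s. norm (\<Psi> (x, s)) * norm (a (x, s)) \<partial>lborel)"
      using I int [OF elim(2,1)] g_le by (intro integral_mono) auto
    ultimately show ?case using le [OF elim(2,1)] by linarith
  qed
  have norm_meas: "(\<lambda>x. \<integral>s. norm (g (x, s)) \<partial>lborel) \<in> borel_measurable P" by measurable
  have b: "integrable P (\<lambda>x. \<integral>s. norm (g (x, s)) \<partial>lborel)"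
  proof (rule Bochner_Integration.integrable_bound [OF _ norm_meas])
    show "integrable P (\<lambda>x. c * Lp_norm lborel p (\<lambda>s. a (x, s)))" using aI by simp
    show "AE x in P. norm (\<integral>s. norm (g (x, s)) \<partial>lborel) \<le> norm (c * Lp_norm lborel p (\<lambda>s. a (x, s)))"
      using sec
    proof eventually_elim
      case (elim x)
      have "norm (\<integral>s. norm (g (x, s)) \<partial>lborel) = (\<integral>s. norm (g (x, s)) \<partial>lborel)" by simp
      also have "\<dots> \<le> c * Lp_norm lborel p (\<lambda>s. a (x, s))" using elim by simp
      finally show ?case using abs_ge_self order_trans unfolding real_norm_def by blast
    qed
  qed
  have I: "integrable (P \<Otimes>\<^sub>M lborel) g"
  proof (rule P_line.Fubini_integrable [OF g_meas b])
    show "AE x in P. integrable lborel (\<lambda>s. g (x, s))" using sec by eventually_elim simp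
  qed
  then show "integrable (P \<Otimes>\<^sub>M lborel) (\<lambda>z. inner (\<Psi> z) (a z))" by (simp add: g_def)
  have "(\<integral>z. g z \<partial>(P \<Otimes>\<^sub>M lborel)) = (\<integral>x. \<integral>s. g (x, s) \<partial>lborel \<partial>P)"
    by (rule P_line.integral_fst' [OF I, symmetric])
  also have "\<dots> \<le> (\<integral>x. c * Lp_norm lborel p (\<lambda>s. a (x, s)) \<partial>P)"
  proof (rule integral_mono_AE [OF P_line.integrable_fst' [OF I]])
    show "integrable P (\<lambda>x. c * Lp_norm lborel p (\<lambda>s. a (x, s)))" using aI by simp
    show "AE x in P. (\<integral>s. g (x, s) \<partial>lborel) \<le> c * Lp_norm lborel p (\<lambda>s. a (x, s))"
      using sec
    proof eventually_elim
      case (elim x)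
      have "(\<integral>s. g (x, s) \<partial>lborel) \<le> norm (\<integral>s. g (x, s) \<partial>lborel)" by simp
      also have "\<dots> \<le> (\<integral>s. norm (g (x, s)) \<partial>lborel)" by (rule integral_norm_bound)
      finally show ?case using elim by linarith
    qed
  qed
  also have "\<dots> = c * L1_Lp_norm P p a" by (simp add: L1_Lp_norm_def)
  finally show "(\<integral>z. inner (\<Psi> z) (a z) \<partial>(P \<Otimes>\<^sub>M lborel)) \<le> c * L1_Lp_norm P p a" by (simp add: g_def)
qed

end

section \<open>Finite models of elementary functions\<close>

definition cell :: "nat set \<Rightarrow> (nat \<Rightarrow> 'b set) \<Rightarrow> 'b \<Rightarrow> nat" where
  "cell I A x = set_encode {i \<in> I. x \<in> A i}"

lemma cell_mem: "finite I \<Longrightarrow> i \<in> I \<Longrightarrow> i \<in> set_decode (cell I A x) \<longleftrightarrow> x \<in> A i"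
  by (simp add: cell_def set_encode_inverse)

lemma simple_function_cell:
  assumes "finite I" "\<And>i. i \<in> I \<Longrightarrow> A i \<in> sets N"
  shows "simple_function N (cell I A)"
proof -
  have "cell I A = (\<lambda>x. \<Sum>i\<in>I. if x \<in> A i then 2 ^ i else 0)"
    using assms(1) by (simp add: fun_eq_iff cell_def set_encode_def sum.inter_filter)
  moreover have "simple_function N (\<lambda>x. \<Sum>i\<in>I. if x \<in> A i then 2 ^ i else 0 :: nat)"
    using assms(2) by (intro simple_function_sum simple_function_If_set) auto
  ultimately show ?thesis by (simp only:)
qed

text \<open>
  The two maps send points to their cells. The cell \<open>0\<close> of the line stands for the
  points outside all the sets of an elementary function; it is the only cell that may have infinite measure. Cells of measure zero are
  dropped in \<open>Q\<close> and \<open>BB\<close>, because the minimisation uses positive weights.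
\<close>

locale cell_model = sample_power \<mu> n M for \<mu> :: "'a measure" and n M :: nat +
  fixes q :: "'a \<Rightarrow> nat" and r :: "real \<Rightarrow> nat"
  assumes simple_q: "simple_function \<mu> q" and simple_r: "simple_function lborel r"
    and finite_r: "b \<noteq> 0 \<Longrightarrow> emeasure lborel {s. r s = b} < \<infinity>"
begin

definition w :: "nat \<Rightarrow> real" where
  "w y = measure \<mu> (q -` {y} \<inter> space \<mu>)"

definition Q :: "nat set" where
  "Q = {y \<in> q ` space \<mu>. w y > 0}"

definition \<nu> :: "nat \<Rightarrow> real" where
  "\<nu> b = measure lborel {s. r s = b}"

definition BB :: "nat set" where
  "BB = {b \<in> range r. b \<noteq> 0 \<and> \<nu> b > 0}"

definition qx :: "(nat \<Rightarrow> 'a) \<Rightarrow> nat \<Rightarrow> nat" where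
  "qx x = (\<lambda>i\<in>{..<n}. q (x i))"

lemma q_sets [measurable]: "q -` {y} \<inter> space \<mu> \<in> sets \<mu>"
  by (rule simple_functionD(2) [OF simple_q])

lemma r_sets [measurable]: "{s. r s = b} \<in> sets lborel"
proof -
  have "r -` {b} \<inter> space lborel \<in> sets lborel" by (rule simple_functionD(2) [OF simple_r])
  moreover have "r -` {b} \<inter> space lborel = {s. r s = b}" by auto
  ultimately show ?thesis by simp
qed

lemma finite_BB: "finite BB"
  using simple_functionD(1) [OF simple_r] by (simp add: BB_def)

lemma \<nu>_pos: "b \<in> BB \<Longrightarrow> \<nu> b > 0"
  by (simp add: BB_def)

lemma finite_range_q: "finite (q ` space \<mu>)"
  by (rule simple_functionD(1) [OF simple_q])

lemma sum_w: "(\<Sum>y\<in>Q. w y) = 1"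
proof -
  have "(\<Sum>y\<in>Q. w y) = (\<Sum>y\<in>q ` space \<mu>. w y)"
  proof (rule sum.mono_neutral_left [OF finite_range_q])
    show "\<forall>y\<in>q ` space \<mu> - Q. w y = 0"
      using measure_nonneg by (auto simp: Q_def w_def not_less order.antisym)
  qed (auto simp: Q_def)
  also have "\<dots> = measure \<mu> (\<Union>y\<in>q ` space \<mu>. q -` {y} \<inter> space \<mu>)"
    unfolding w_def using finite_range_q
    by (intro finite_measure_finite_Union [symmetric]) (auto simp: disjoint_family_on_def)
  also have "(\<Union>y\<in>q ` space \<mu>. q -` {y} \<inter> space \<mu>) = space \<mu>" by auto
  finally show ?thesis by (simp add: prob_space)
qed

sublocale fp: finite_power n Q w
  by unfold_locales (use finite_range_q sum_w in \<open>auto simp: Q_def\<close>)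

lemma AE_q: "AE \<omega> in \<mu>. q \<omega> \<in> Q"
proof -
  have "AE \<omega> in \<mu>. \<forall>y\<in>q ` space \<mu> - Q. \<omega> \<notin> q -` {y} \<inter> space \<mu>"
  proof (rule AE_finite_allI)
    show "finite (q ` space \<mu> - Q)" using finite_range_q by simp
    fix y assume "y \<in> q ` space \<mu> - Q"
    then have "w y = 0" using measure_nonneg [of \<mu> "q -` {y} \<inter> space \<mu>"] by (auto simp: Q_def w_def)
    then have "q -` {y} \<inter> space \<mu> \<in> null_sets \<mu>"
      by (simp add: null_sets_def w_def emeasure_eq_measure)
    then show "AE \<omega> in \<mu>. \<omega> \<notin> q -` {y} \<inter> space \<mu>" by (rule AE_not_in)
  qed
  then show ?thesis using AE_space by eventually_elim auto
qed

lemma AE_qx: "AE x in P. qx x \<in> fp.X"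
proof -
  have "AE x in P. q (x i) \<in> Q" if "i \<in> {..<n}" for i
    unfolding prod_pow_def using that AE_q by (intro AE_PiM_component) (auto intro: prob_space_axioms)
  then have "AE x in P. \<forall>i\<in>{..<n}. q (x i) \<in> Q" by (intro AE_finite_allI) auto
  then show ?thesis by eventually_elim (auto simp: fp.X_def qx_def)
qed

lemma qx_level:
  assumes "\<xi> \<in> extensional {..<n}"
  shows "qx -` {\<xi>} \<inter> space P = (\<Pi>\<^sub>E i\<in>{..<n}. q -` {\<xi> i} \<inter> space \<mu>)"
  using assms by (auto simp: space_P qx_def PiE_iff extensional_def fun_eq_iff)

lemma simple_qx: "simple_function P qx"
  unfolding simple_function_def
proof (intro conjI ballI)
  have "qx ` space P \<subseteq> (\<Pi>\<^sub>E i\<in>{..<n}. q ` space \<mu>)" by (auto simp: space_P qx_def)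
  moreover have "finite (\<Pi>\<^sub>E i\<in>{..<n}. q ` space \<mu>)" using finite_range_q by (intro finite_PiE) auto
  ultimately show "finite (qx ` space P)" by (rule finite_subset)
  fix \<xi> assume "\<xi> \<in> qx ` space P"
  then have "\<xi> \<in> extensional {..<n}" by (auto simp: qx_def)
  moreover have "(\<Pi>\<^sub>E i\<in>{..<n}. q -` {\<xi> i} \<inter> space \<mu>) \<in> sets P"
    unfolding prod_pow_def by (intro sets_PiM_I_finite q_sets) simp
  ultimately show "qx -` {\<xi>} \<inter> space P \<in> sets P" by (simp only: qx_level)
qed

lemma qx_measurable: "(\<lambda>x. \<psi> (qx x)) \<in> borel_measurable P" for \<psi> :: "_ \<Rightarrow> 'v::real_normed_vector"
  by (rule borel_measurable_simple_function) (rule simple_function_compose1 [OF simple_qx])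

lemma integral_qx:
  fixes \<psi> :: "(nat \<Rightarrow> nat) \<Rightarrow> real"
  shows "(\<integral>x. \<psi> (qx x) \<partial>P) = fp.Ex \<psi>"
proof -
  have prob: "measure P (qx -` {\<xi>} \<inter> space P) = fp.pw \<xi>" if "\<xi> \<in> fp.X" for \<xi>
  proof -
    have "\<xi> \<in> extensional {..<n}" using that by (auto simp: fp.X_def PiE_iff)
    then have "measure P (qx -` {\<xi>} \<inter> space P) = measure P (\<Pi>\<^sub>E i\<in>{..<n}. q -` {\<xi> i} \<inter> space \<mu>)"
      by (simp only: qx_level)
    also have "\<dots> = (\<Prod>i<n. measure \<mu> (q -` {\<xi> i} \<inter> space \<mu>))"
      unfolding prod_pow_def by (intro pr.prob_times q_sets)
    finally show ?thesis by (simp add: fp.pw_def w_def)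
  qed
  have sets: "qx -` {\<xi>} \<inter> space P \<in> sets P" for \<xi>
    by (rule simple_functionD(2) [OF simple_qx])
  have "(\<integral>x. \<psi> (qx x) \<partial>P) = (\<integral>x. (\<Sum>\<xi>\<in>fp.X. \<psi> \<xi> * indicator (qx -` {\<xi>} \<inter> space P) x) \<partial>P)"
  proof (rule integral_cong_AE)
    show "AE x in P. \<psi> (qx x) = (\<Sum>\<xi>\<in>fp.X. \<psi> \<xi> * indicator (qx -` {\<xi>} \<inter> space P) x)"
      using AE_qx AE_space
    proof eventually_elim
      case (elim x)
      have "(\<Sum>\<xi>\<in>fp.X. \<psi> \<xi> * indicator (qx -` {\<xi>} \<inter> space P) x) = (\<Sum>\<xi>\<in>fp.X. if \<xi> = qx x then \<psi> \<xi> else 0)"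
        using elim(2) by (intro sum.cong) (auto simp: indicator_def)
      then show ?case using elim(1) by simp
    qed
    show "(\<lambda>x. \<psi> (qx x)) \<in> borel_measurable P" by (rule qx_measurable)
    show "(\<lambda>x. \<Sum>\<xi>\<in>fp.X. \<psi> \<xi> * indicator (qx -` {\<xi>} \<inter> space P) x) \<in> borel_measurable P"
      using sets by (intro borel_measurable_sum borel_measurable_times borel_measurable_indicator) auto
  qed
  also have "\<dots> = (\<Sum>\<xi>\<in>fp.X. \<psi> \<xi> * measure P (qx -` {\<xi>} \<inter> space P))"
  proof (subst Bochner_Integration.integral_sum)
    show "integrable P (\<lambda>x. \<psi> \<xi> * indicator (qx -` {\<xi>} \<inter> space P) x)" for \<xi>
      using sets by (intro integrable_mult_right integrable_real_indicator) (auto simp: P.emeasure_eq_measure)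
  qed simp
  also have "\<dots> = fp.Ex \<psi>"
    unfolding fp.Ex_def by (intro sum.cong) (auto simp: prob)
  finally show ?thesis .
qed

definition step :: "(nat \<Rightarrow> 'k::{real_normed_field,euclidean_space}) \<Rightarrow> real \<Rightarrow> 'k" where
  "step d s = (\<Sum>b\<in>BB. d b * of_real (indicator {s. r s = b} s))"

lemma sum_BB_indicator:
  fixes f :: "nat \<Rightarrow> 'k::real_normed_field"
  shows "(\<Sum>b\<in>BB. f b * of_real (indicator {s. r s = b} s)) = (if r s \<in> BB then f (r s) else 0)"
proof -
  have "(\<Sum>b\<in>BB. f b * of_real (indicator {s. r s = b} s)) = (\<Sum>b\<in>BB. if b = r s then f b else 0)"
    by (intro sum.cong) auto
  then show ?thesis using finite_BB by simp
qed

lemma step_eq: "step d s = (if r s \<in> BB then d (r s) else 0)"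
  unfolding step_def by (rule sum_BB_indicator)

lemma integral_step:
  fixes f :: "nat \<Rightarrow> real"
  shows "integrable lborel (\<lambda>s. \<Sum>b\<in>BB. f b * indicator {s. r s = b} s)"
    and "(\<integral>s. (\<Sum>b\<in>BB. f b * indicator {s. r s = b} s) \<partial>lborel) = (\<Sum>b\<in>BB. \<nu> b * f b)"
proof -
  have I: "integrable lborel (\<lambda>s. f b * indicator {s. r s = b} s)" if "b \<in> BB" for b
    using finite_r [of b] r_sets [of b] that by (intro integrable_mult_right integrable_real_indicator) (auto simp: BB_def)
  then show "integrable lborel (\<lambda>s. \<Sum>b\<in>BB. f b * indicator {s. r s = b} s)"
    by (intro Bochner_Integration.integrable_sum)
  show "(\<integral>s. (\<Sum>b\<in>BB. f b * indicator {s. r s = b} s) \<partial>lborel) = (\<Sum>b\<in>BB. \<nu> b * f b)"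
    using I by (subst Bochner_Integration.integral_sum) (auto simp: \<nu>_def mult.commute intro!: sum.cong)
qed

lemma norm_step_powr:
  "p > 0 \<Longrightarrow> norm (step d s) powr p = (\<Sum>b\<in>BB. (norm (d b) powr p) * indicator {s. r s = b} s)"
  using sum_BB_indicator [of "\<lambda>b. norm (d b) powr p" s] by (simp add: step_eq)

lemma step_measurable: "step d \<in> borel_measurable lborel"
  unfolding step_def using r_sets by (intro borel_measurable_sum borel_measurable_times) auto

lemma Lp_norm_step: "p > 0 \<Longrightarrow> Lp_norm lborel p (step d) = (\<Sum>b\<in>BB. \<nu> b * norm (d b) powr p) powr (1 / p)"
  unfolding Lp_norm_def by (simp add: norm_step_powr integral_step(2))

definition few_sets :: "nat set set" where
  "few_sets = {S. S \<subseteq> {..<n} \<and> card S \<le> M}"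

lemma finite_few_sets: "finite few_sets"
  unfolding few_sets_def by (rule finite_subset [of _ "Pow {..<n}"]) auto

text \<open>
  The function on the original spaces that a function of finitely many cells stands for. It is
  written through its pure parts, so that it lies in the span of the functions of few coordinates.
\<close>

definition lift :: "((nat \<Rightarrow> nat) \<Rightarrow> nat \<Rightarrow> 'k::{real_normed_field,euclidean_space}) \<Rightarrow> (nat \<Rightarrow> 'a) \<times> real \<Rightarrow> 'k" where
  "lift D = (\<lambda>(x, s). \<Sum>S\<in>few_sets. step (\<lambda>b. fp.pure_part S (\<lambda>\<xi>. D \<xi> b) (qx x)) s)"

lemma lift_U1_Lp:
  assumes p: "p = 1 \<or> p = 2"
  shows "lift D \<in> U1_Lp \<mu> n M p"
proof -
  have "(\<lambda>(x, s). \<Sum>i\<in>few_sets \<times> BB. fp.pure_part (fst i) (\<lambda>\<xi>. D \<xi> (snd i)) (qx x)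
      * of_real (indicator {s. r s = snd i} s)) \<in> U1_tensor_Lp \<mu> n M p"
  proof (rule U1_Lp_tensor_sum)
    show "finite (few_sets \<times> BB)" using finite_few_sets finite_BB by simp
    fix i assume i: "i \<in> few_sets \<times> BB"
    let ?u = "\<lambda>x. fp.pure_part (fst i) (\<lambda>\<xi>. D \<xi> (snd i)) (qx x)"
    have "?u \<in> Lp P 1"
    proof (rule bounded_in_Lp_1)
      show "?u \<in> borel_measurable P" by (rule qx_measurable)
      let ?b = "\<Sum>\<xi>\<in>qx ` space P. norm (fp.pure_part (fst i) (\<lambda>\<xi>. D \<xi> (snd i)) \<xi>)"
      show "norm (?u x) \<le> ?b" if "x \<in> space P" for x
        using that simple_functionD(1) [OF simple_qx]
        by (intro member_le_sum [where f = "\<lambda>\<xi>. norm (fp.pure_part (fst i) (\<lambda>\<xi>. D \<xi> (snd i)) \<xi>)"]) auto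
    qed
    moreover have "depends_on_at_most \<mu> n M ?u"
      unfolding depends_on_at_most_def
    proof (intro exI [of _ "fst i"] conjI ballI impI)
      show "fst i \<subseteq> {..<n}" "card (fst i) \<le> M" using i by (auto simp: few_sets_def)
      fix x y assume "x \<in> space P" "y \<in> space P" and xy: "\<forall>j\<in>fst i. x j = y j"
      show "?u x = ?u y"
        using xy \<open>fst i \<subseteq> {..<n}\<close> by (intro fp.pure_part_cong_coords) (auto simp: qx_def)
    qed
    ultimately show "?u \<in> U1 \<mu> n M" by (rule few_coordinates_U1)
    show "(\<lambda>s. of_real (indicator {s. r s = snd i} s)) \<in> Lp lborel p"
      using i finite_r [of "snd i"] r_sets by (intro Lp_indicator) (auto simp: BB_def)
  qed
  moreover have "lift D = (\<lambda>(x, s). \<Sum>i\<in>few_sets \<times> BB. fp.pure_part (fst i) (\<lambda>\<xi>. D \<xi> (snd i)) (qx x)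
      * of_real (indicator {s. r s = snd i} s))"
    by (auto simp: lift_def step_def fun_eq_iff sum.cartesian_product case_prod_beta)
  ultimately show ?thesis using U1_tensor_U1_Lp [OF p] by metis
qed

text \<open>
  The pure parts over large \<open>S\<close>, which \<open>lift\<close> leaves out, vanish; the others add up to \<open>D\<close>.
\<close>

lemma lift_eq:
  assumes pure: "\<And>S b \<xi>. \<lbrakk>S \<subseteq> {..<n}; M < card S; b \<in> BB; \<xi> \<in> fp.X\<rbrakk> \<Longrightarrow> fp.pure_part S (\<lambda>\<xi>. D \<xi> b) \<xi> = 0"
    and x: "qx x \<in> fp.X"
  shows "lift D (x, s) = step (D (qx x)) s"
proof -
  have "(\<Sum>S\<in>few_sets. fp.pure_part S (\<lambda>\<xi>. D \<xi> b) (qx x)) = D (qx x) b" if b: "b \<in> BB" for b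
  proof -
    have "(\<Sum>S\<in>few_sets. fp.pure_part S (\<lambda>\<xi>. D \<xi> b) (qx x)) = (\<Sum>S\<in>Pow {..<n}. fp.pure_part S (\<lambda>\<xi>. D \<xi> b) (qx x))"
      using pure [OF _ _ b x] by (intro sum.mono_neutral_left) (auto simp: few_sets_def not_le)
    then show ?thesis using fp.sum_pure_part [OF x] by simp
  qed
  then show ?thesis by (simp add: lift_def step_eq)
qed

lemma L1_Lp_norm_lift:
  assumes pure: "\<And>S b \<xi>. \<lbrakk>S \<subseteq> {..<n}; M < card S; b \<in> BB; \<xi> \<in> fp.X\<rbrakk> \<Longrightarrow> fp.pure_part S (\<lambda>\<xi>. D \<xi> b) \<xi> = 0"
    and p: "p = 1 \<or> p = 2"
  shows "L1_Lp_norm P p (lift D) = fp.Ex (\<lambda>\<xi>. (\<Sum>b\<in>BB. \<nu> b * norm (D \<xi> b) powr p) powr (1 / p))"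
proof -
  have p0: "p > 0" using p by auto
  have "L1_Lp_norm P p (lift D) = (\<integral>x. (\<Sum>b\<in>BB. \<nu> b * norm (D (qx x) b) powr p) powr (1 / p) \<partial>P)"
    unfolding L1_Lp_norm_def
  proof (rule integral_cong_AE)
    show "(\<lambda>x. Lp_norm lborel p (\<lambda>s. lift D (x, s))) \<in> borel_measurable P"
      using lift_U1_Lp [OF p, of D] by (intro Lp_norm_section_measurable L1_Lp_measurable U1_Lp_L1_Lp)
    show "(\<lambda>x. (\<Sum>b\<in>BB. \<nu> b * norm (D (qx x) b) powr p) powr (1 / p)) \<in> borel_measurable P"
      by (rule qx_measurable)
    show "AE x in P. Lp_norm lborel p (\<lambda>s. lift D (x, s)) = (\<Sum>b\<in>BB. \<nu> b * norm (D (qx x) b) powr p) powr (1 / p)"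
      using AE_qx
    proof eventually_elim
      case (elim x)
      have "(\<lambda>s. lift D (x, s)) = step (D (qx x))" using lift_eq [OF pure elim] by auto
      then show ?case using Lp_norm_step [OF p0] by simp
    qed
  qed
  also have "\<dots> = fp.Ex (\<lambda>\<xi>. (\<Sum>b\<in>BB. \<nu> b * norm (D \<xi> b) powr p) powr (1 / p))"
    by (rule integral_qx)
  finally show ?thesis .
qed

lemma AE_r: "AE s in lborel. r s \<in> BB \<or> r s = 0"
proof -
  have "AE s in lborel. \<forall>b\<in>range r - BB - {0}. s \<notin> {s. r s = b}"
  proof (rule AE_finite_allI)
    show "finite (range r - BB - {0})" using simple_functionD(1) [OF simple_r] by simp
    fix b assume b: "b \<in> range r - BB - {0}"
    then have "\<nu> b = 0" using measure_nonneg [of lborel "{s. r s = b}"] by (auto simp: BB_def \<nu>_def)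
    moreover have "emeasure lborel {s. r s = b} = ennreal (\<nu> b)"
      unfolding \<nu>_def using finite_r [of b] b by (intro emeasure_eq_ennreal_measure) auto
    ultimately have "{s. r s = b} \<in> null_sets lborel" using r_sets [of b] by (simp add: null_sets_def)
    then show "AE s in lborel. s \<notin> {s. r s = b}" by (rule AE_not_in)
  qed
  then show ?thesis by eventually_elim auto
qed

end

section \<open>The decomposition\<close>

context sample_power
begin

text \<open>
  A decomposition of \<open>e\<close> inside the subspaces whose norm is certified, up to \<open>\<epsilon>\<close>, by a functional \<open>\<Psi>\<close>
  that is bounded on both of the large spaces. The certificate \<open>\<Psi>\<close> limits what an arbitrary
  decomposition of \<open>e\<close> can achieve.
\<close>

definition dual_decomposition :: "real \<Rightarrow> real \<Rightarrow> ((nat \<Rightarrow> 'a) \<times> real \<Rightarrow> 'k::{real_normed_field,euclidean_space}) \<Rightarrow> bool" where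
  "dual_decomposition t \<epsilon> e \<longleftrightarrow> (\<exists>g0\<in>U1_Lp \<mu> n M 1. \<exists>g1\<in>U1_Lp \<mu> n M 2. \<exists>\<Psi>.
      (AE z in P \<Otimes>\<^sub>M lborel. e z = g0 z + g1 z) \<and>
      (\<forall>a\<in>L1_Lp P 1. integrable (P \<Otimes>\<^sub>M lborel) (\<lambda>z. inner (\<Psi> z) (a z)) \<and>
        (\<integral>z. inner (\<Psi> z) (a z) \<partial>(P \<Otimes>\<^sub>M lborel)) \<le> sqrt (full_const M 2) * L1_Lp_norm P 1 a) \<and>
      (\<forall>a\<in>L1_Lp P 2. integrable (P \<Otimes>\<^sub>M lborel) (\<lambda>z. inner (\<Psi> z) (a z)) \<and>
        (\<integral>z. inner (\<Psi> z) (a z) \<partial>(P \<Otimes>\<^sub>M lborel)) \<le> sqrt (full_const M 2) * t * L1_Lp_norm P 2 a) \<and>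
      L1_Lp_norm P 1 g0 + t * L1_Lp_norm P 2 g1 \<le> (\<integral>z. inner (\<Psi> z) (e z) \<partial>(P \<Otimes>\<^sub>M lborel)) + \<epsilon>)"

end

context cell_model
begin

lemma cell_duality:
  fixes F :: "(nat \<Rightarrow> nat) \<Rightarrow> nat \<Rightarrow> 'k::{real_normed_field,euclidean_space}"
  assumes t: "t > 0" and \<epsilon>: "\<epsilon> > 0"
    and F: "\<And>\<xi> b. \<lbrakk>\<xi> \<in> fp.X; b \<in> BB\<rbrakk> \<Longrightarrow> F \<xi> b = (\<Sum>k\<in>L. u k \<xi> *\<^sub>R \<beta> k b)"
    and L: "\<And>k. k \<in> L \<Longrightarrow> fp.few_coords M (u k)"
    and F0: "\<And>\<xi>. F \<xi> 0 = 0"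
    and e: "e \<in> L1_Lp P 1" and e_eq: "\<And>x s. e (x, s) = F (qx x) (r s)"
  shows "dual_decomposition t \<epsilon> e"
proof -
  define C where "C = full_const M 2"
  have C: "C > 0" using full_const_pos by (simp add: C_def)
  obtain G \<Phi> where
    G: "\<forall>S\<subseteq>{..<n}. M < card S \<longrightarrow> (\<forall>b\<in>BB. \<forall>\<xi>\<in>fp.X. fp.pure_part S (\<lambda>\<xi>. G \<xi> b) \<xi> = 0)"
    and H: "\<forall>S\<subseteq>{..<n}. M < card S \<longrightarrow> (\<forall>b\<in>BB. \<forall>\<xi>\<in>fp.X. fp.pure_part S (\<lambda>\<xi>. F \<xi> b - G \<xi> b) \<xi> = 0)"
    and \<Phi>0: "\<forall>\<xi>\<in>fp.X. \<forall>b\<in>BB. (norm (\<Phi> \<xi> b))\<^sup>2 \<le> full_const M 2"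
    and \<Phi>2: "\<forall>\<xi>\<in>fp.X. (\<Sum>b\<in>BB. \<nu> b * (norm (\<Phi> \<xi> b))\<^sup>2) \<le> full_const M 2 * t\<^sup>2"
    and main: "fp.Ex (\<lambda>\<xi>. \<Sum>b\<in>BB. \<nu> b * norm (G \<xi> b))
        + t * fp.Ex (\<lambda>\<xi>. sqrt (\<Sum>b\<in>BB. \<nu> b * (norm (F \<xi> b - G \<xi> b))\<^sup>2))
      \<le> fp.Ex (\<lambda>\<xi>. \<Sum>b\<in>BB. \<nu> b * inner (\<Phi> \<xi> b) (F \<xi> b)) + \<epsilon>"
    by (rule fp.finite_duality [OF finite_BB \<nu>_pos t \<epsilon> F L]) (assumption | rule that)+
  note \<Phi>0 = \<Phi>0 [folded C_def] and \<Phi>2 = \<Phi>2 [folded C_def]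
  define H' where "H' = (\<lambda>\<xi> b. F \<xi> b - G \<xi> b)"
  have pureG: "fp.pure_part S (\<lambda>\<xi>. G \<xi> b) \<xi> = 0"
    and pureH: "fp.pure_part S (\<lambda>\<xi>. H' \<xi> b) \<xi> = 0"
    if "S \<subseteq> {..<n}" "M < card S" "b \<in> BB" "\<xi> \<in> fp.X" for S b \<xi>
    using G H that by (auto simp: H'_def)
  define g0 where "g0 = lift G"
  define g1 where "g1 = lift H'"
  have g0U: "g0 \<in> U1_Lp \<mu> n M 1" and g1U: "g1 \<in> U1_Lp \<mu> n M 2"
    unfolding g0_def g1_def by (auto intro: lift_U1_Lp)
  have nn: "0 \<le> (\<Sum>b\<in>BB. \<nu> b * f b)" if "\<And>b. 0 \<le> f b" for f
    using \<nu>_pos that by (intro sum_nonneg mult_nonneg_nonneg) (auto simp: less_imp_le)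
  have g0_norm: "L1_Lp_norm P 1 g0 = fp.Ex (\<lambda>\<xi>. \<Sum>b\<in>BB. \<nu> b * norm (G \<xi> b))"
    unfolding g0_def using L1_Lp_norm_lift [of G 1, OF pureG] by (simp add: nn)
  have g1_norm: "L1_Lp_norm P 2 g1 = fp.Ex (\<lambda>\<xi>. sqrt (\<Sum>b\<in>BB. \<nu> b * (norm (F \<xi> b - G \<xi> b))\<^sup>2))"
    unfolding g1_def using L1_Lp_norm_lift [of H' 2, OF pureH]
    by (simp add: powr_half_sqrt nn H'_def)
  have e_meas [measurable]: "e \<in> borel_measurable (P \<Otimes>\<^sub>M lborel)" using e by (rule L1_Lp_measurable)
  have [measurable]: "g0 \<in> borel_measurable (P \<Otimes>\<^sub>M lborel)" "g1 \<in> borel_measurable (P \<Otimes>\<^sub>M lborel)"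
    using g0U g1U by (auto intro: L1_Lp_measurable U1_Lp_L1_Lp)
  have ae: "AE z in P \<Otimes>\<^sub>M lborel. e z = g0 z + g1 z"
  proof (rule P_line.AE_pair_measure)
    show "{z \<in> space (P \<Otimes>\<^sub>M lborel). e z = g0 z + g1 z} \<in> sets (P \<Otimes>\<^sub>M lborel)" by measurable
    show "AE x in P. AE s in lborel. e (x, s) = g0 (x, s) + g1 (x, s)"
      using AE_qx
    proof eventually_elim
      case (elim x)
      show ?case using AE_r
      proof eventually_elim
        case (elim s)
        have "g0 (x, s) + g1 (x, s) = step (G (qx x)) s + step (H' (qx x)) s"
          unfolding g0_def g1_def using lift_eq [OF pureG \<open>qx x \<in> fp.X\<close>] lift_eq [OF pureH \<open>qx x \<in> fp.X\<close>] by simp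
        also have "\<dots> = F (qx x) (r s)" using elim F0 by (auto simp: step_eq H'_def BB_def)
        finally show ?case by (simp add: e_eq)
      qed
    qed
  qed
  define \<phi> where "\<phi> = (\<lambda>\<xi> b. if \<xi> \<in> fp.X then \<Phi> \<xi> b else 0)"
  define \<Psi> where "\<Psi> = (\<lambda>(x, s). step (\<phi> (qx x)) s)"
  have \<Psi>_meas [measurable]: "\<Psi> \<in> borel_measurable (P \<Otimes>\<^sub>M lborel)"
  proof -
    have [measurable]: "(\<lambda>z. \<phi> (qx (fst z)) b) \<in> borel_measurable (P \<Otimes>\<^sub>M lborel)" for b
      by (rule measurable_compose [OF measurable_fst qx_measurable])
    have [measurable]: "{s. r s = b} \<in> sets lborel" for b by (rule r_sets)
    have "\<Psi> = (\<lambda>z. \<Sum>b\<in>BB. \<phi> (qx (fst z)) b * of_real (indicator {s. r s = b} (snd z)))"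
      by (auto simp: \<Psi>_def step_def fun_eq_iff)
    moreover have "(\<lambda>z. \<Sum>b\<in>BB. \<phi> (qx (fst z)) b * of_real (indicator {s. r s = b} (snd z)))
        \<in> borel_measurable (P \<Otimes>\<^sub>M lborel)" by measurable
    ultimately show ?thesis by simp
  qed
  have sec: "(\<lambda>s. \<Psi> (x, s)) = step (\<phi> (qx x))" for x by (simp add: \<Psi>_def fun_eq_iff)
  have \<Psi>_sup: "norm (\<Psi> (x, s)) \<le> sqrt C" for x s
    using \<Phi>0 C by (auto simp: \<Psi>_def step_eq \<phi>_def intro!: real_le_rsqrt)
  have \<Psi>_sq: "(norm (step d s))\<^sup>2 = (\<Sum>b\<in>BB. (norm (d b))\<^sup>2 * indicator {s. r s = b} s)" for d :: "nat \<Rightarrow> 'k" and s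
    using norm_step_powr [of 2 d s] by simp
  have I2: "integrable lborel (\<lambda>s. (norm (\<Psi> (x, s)))\<^sup>2)" for x
    using integral_step(1) by (simp add: \<Psi>_def \<Psi>_sq)
  have le2: "(\<integral>s. (norm (\<Psi> (x, s)))\<^sup>2 \<partial>lborel) \<le> (sqrt C * t)\<^sup>2" for x
  proof -
    have "(\<integral>s. (norm (\<Psi> (x, s)))\<^sup>2 \<partial>lborel) = (\<Sum>b\<in>BB. \<nu> b * (norm (\<phi> (qx x) b))\<^sup>2)"
      using integral_step(2) by (simp add: \<Psi>_def \<Psi>_sq)
    also have "\<dots> \<le> C * t\<^sup>2"
      using \<Phi>2 C by (cases "qx x \<in> fp.X") (simp_all add: \<phi>_def)
    finally show ?thesis using C by (simp add: power_mult_distrib)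
  qed
  have ct: "sqrt C * t > 0" using C t by simp
  have pair1: "integrable (P \<Otimes>\<^sub>M lborel) (\<lambda>z. inner (\<Psi> z) (a z)) \<and>
      (\<integral>z. inner (\<Psi> z) (a z) \<partial>(P \<Otimes>\<^sub>M lborel)) \<le> sqrt C * L1_Lp_norm P 1 a" if a: "a \<in> L1_Lp P 1" for a
  proof -
    have "step (\<phi> (qx x)) \<in> borel_measurable lborel" for x by (rule step_measurable)
    moreover have "norm (step (\<phi> (qx x)) s) \<le> sqrt C" for x s using \<Psi>_sup [of x s] by (simp add: \<Psi>_def)
    ultimately have "integrable lborel (\<lambda>s. norm (\<Psi> (x, s)) * norm (h s))"
      "(\<integral>s. norm (\<Psi> (x, s)) * norm (h s) \<partial>lborel) \<le> sqrt C * Lp_norm lborel 1 h"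
      if "h \<in> Lp lborel 1" for x and h :: "real \<Rightarrow> 'k"
      using pairing_section_1 [of "step (\<phi> (qx x))" "sqrt C" h] that by (simp_all add: \<Psi>_def)
    then show ?thesis using C by (intro conjI pairing_bound [where c = "sqrt C", OF \<Psi>_meas a]) auto
  qed
  have pair2: "integrable (P \<Otimes>\<^sub>M lborel) (\<lambda>z. inner (\<Psi> z) (a z)) \<and>
      (\<integral>z. inner (\<Psi> z) (a z) \<partial>(P \<Otimes>\<^sub>M lborel)) \<le> sqrt C * t * L1_Lp_norm P 2 a" if a: "a \<in> L1_Lp P 2" for a
  proof -
    have "integrable lborel (\<lambda>s. norm (\<Psi> (x, s)) * norm (h s))"
      "(\<integral>s. norm (\<Psi> (x, s)) * norm (h s) \<partial>lborel) \<le> sqrt C * t * Lp_norm lborel 2 h"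
      if "h \<in> Lp lborel 2" for x and h :: "real \<Rightarrow> 'k"
      using pairing_section_2 [OF _ ct I2 le2 that, of x] step_measurable [of "\<phi> (qx x)"] by (simp_all add: sec)
    then show ?thesis using ct by (intro conjI pairing_bound [where c = "sqrt C * t", OF \<Psi>_meas a]) auto
  qed
  have "(\<integral>z. inner (\<Psi> z) (e z) \<partial>(P \<Otimes>\<^sub>M lborel)) = (\<integral>x. \<integral>s. inner (\<Psi> (x, s)) (e (x, s)) \<partial>lborel \<partial>P)"
    using pair1 [OF e] by (intro P_line.integral_fst' [symmetric]) simp
  also have "\<dots> = (\<integral>x. (\<Sum>b\<in>BB. \<nu> b * inner (\<phi> (qx x) b) (F (qx x) b)) \<partial>P)"
  proof -
    have "inner (\<Psi> (x, s)) (e (x, s)) = (\<Sum>b\<in>BB. inner (\<phi> (qx x) b) (F (qx x) b) * indicator {s. r s = b} s)" for x s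
      using sum_BB_indicator [of "\<lambda>b. inner (\<phi> (qx x) b) (F (qx x) b)" s] by (simp add: \<Psi>_def step_eq e_eq)
    then show ?thesis by (simp add: integral_step(2))
  qed
  also have "\<dots> = fp.Ex (\<lambda>\<xi>. \<Sum>b\<in>BB. \<nu> b * inner (\<phi> \<xi> b) (F \<xi> b))" by (rule integral_qx)
  also have "\<dots> = fp.Ex (\<lambda>\<xi>. \<Sum>b\<in>BB. \<nu> b * inner (\<Phi> \<xi> b) (F \<xi> b))"
    by (intro fp.Ex_cong) (simp add: \<phi>_def)
  finally have "L1_Lp_norm P 1 g0 + t * L1_Lp_norm P 2 g1 \<le> (\<integral>z. inner (\<Psi> z) (e z) \<partial>(P \<Otimes>\<^sub>M lborel)) + \<epsilon>"
    using main g0_norm g1_norm by simp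
  then show ?thesis
    using g0U g1U ae pair1 pair2 unfolding dual_decomposition_def C_def by blast
qed

end

context sample_power
begin

text \<open>
  Each factor of each atom gets its own bit in the cell of a coordinate, and each atom its own bit in the
  cell of the line; the atoms are then products of functions of these cells.
\<close>

lemma elementary_duality:
  fixes e :: "(nat \<Rightarrow> 'a) \<times> real \<Rightarrow> 'k::{real_normed_field,euclidean_space}"
  assumes t: "t > 0" and \<epsilon>: "\<epsilon> > 0" and e: "e \<in> elementary \<mu> n M"
  shows "dual_decomposition t \<epsilon> e"
proof -
  obtain xs where xs: "\<forall>a\<in>set xs. valid_atom \<mu> n M a" and e_xs: "e = (\<lambda>z. \<Sum>a\<leftarrow>xs. atom_fun a z)"
    using e unfolding elementary_def by blast
  define m where "m = length xs"
  define c where "c = (\<lambda>k. fst (xs ! k))"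
  define S where "S = (\<lambda>k. fst (snd (xs ! k)))"
  define A where "A = (\<lambda>k. fst (snd (snd (xs ! k))))"
  define B where "B = (\<lambda>k. snd (snd (snd (xs ! k))))"
  have xs_k: "xs ! k = (c k, S k, A k, B k)" for k by (simp add: c_def S_def A_def B_def)
  have valid: "S k \<subseteq> {..<n}" "card (S k) \<le> M" "\<And>i. i \<in> S k \<Longrightarrow> A k i \<in> sets \<mu>"
    "B k \<in> sets lborel" "emeasure lborel (B k) < \<infinity>" if "k < m" for k
  proof -
    have "valid_atom \<mu> n M (c k, S k, A k, B k)"
      using xs nth_mem [of k xs] that unfolding m_def xs_k [symmetric] by blast
    then show "S k \<subseteq> {..<n}" "card (S k) \<le> M" "\<And>i. i \<in> S k \<Longrightarrow> A k i \<in> sets \<mu>"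
      "B k \<in> sets lborel" "emeasure lborel (B k) < \<infinity>" by auto
  qed
  define I where "I = prod_encode ` (SIGMA k:{..<m}. S k)"
  define AA where "AA = (\<lambda>j. A (fst (prod_decode j)) (snd (prod_decode j)))"
  have fI: "finite I"
    unfolding I_def using finite_subset [OF valid(1) finite_lessThan]
    by (intro finite_imageI finite_SigmaI) auto
  define q where "q = cell I AA"
  define r where "r = cell {..<m} B"
  interpret cm: cell_model \<mu> n M q r
  proof
    show "simple_function \<mu> q"
      unfolding q_def using fI valid(3) by (intro simple_function_cell) (auto simp: I_def AA_def)
    show "simple_function lborel r"
      unfolding r_def using valid(4) by (intro simple_function_cell) auto
    fix b :: nat assume "b \<noteq> 0"
    show "emeasure lborel {s. r s = b} < \<infinity>"
    proof (cases "\<exists>k<m. k \<in> set_decode b")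
      case True
      then obtain k where k: "k < m" "k \<in> set_decode b" by blast
      have "{s. r s = b} \<subseteq> B k" using k by (auto simp: r_def cell_mem)
      then have "emeasure lborel {s. r s = b} \<le> emeasure lborel (B k)"
        using valid(4) [OF k(1)] by (rule emeasure_mono)
      then show ?thesis using valid(5) [OF k(1)] by (rule order_le_less_trans)
    next
      case False
      have "r s \<noteq> b" for s
      proof
        assume rs: "r s = b"
        have "set_decode (r s) = {k \<in> {..<m}. s \<in> B k}"
          unfolding r_def cell_def by (rule set_encode_inverse) simp
        then have "set_decode b = {}" using False rs by auto
        then have "b = 0" by (metis set_decode_inverse set_encode_empty)
        then show False using \<open>b \<noteq> 0\<close> by simp
      qed
      then show ?thesis by simp
    qed
  qed
  define v where "v = (\<lambda>k i y. if prod_encode (k, i) \<in> set_decode y then 1 else 0 :: real)"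
  define u where "u = (\<lambda>k \<xi>. \<Prod>i\<in>S k. v k i (\<xi> i))"
  define \<beta> where "\<beta> = (\<lambda>k b. if k \<in> set_decode b then c k else 0)"
  define F where "F = (\<lambda>\<xi> b. \<Sum>k<m. u k \<xi> *\<^sub>R \<beta> k b)"
  show ?thesis
  proof (rule cm.cell_duality [OF t \<epsilon>])
    show "F \<xi> b = (\<Sum>k<m. u k \<xi> *\<^sub>R \<beta> k b)" for \<xi> b by (simp add: F_def)
    show "cm.fp.few_coords M (u k)" if "k \<in> {..<m}" for k
      unfolding cm.fp.few_coords_def u_def using valid(1,2) [of k] that by blast
    show "F \<xi> 0 = 0" for \<xi> by (simp add: F_def \<beta>_def)
    show "e \<in> L1_Lp P 1" using e by (intro elementary_L1_Lp) auto
    show "e (x, s) = F (cm.qx x) (r s)" for x s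
    proof -
      have "e (x, s) = (\<Sum>k<m. atom_fun (xs ! k) (x, s))"
        unfolding e_xs m_def by (simp add: sum_list_sum_nth atLeast0LessThan)
      also have "\<dots> = F (cm.qx x) (r s)"
        unfolding F_def
      proof (rule sum.cong [OF refl])
        fix k assume k: "k \<in> {..<m}"
        have "v k i (cm.qx x i) = indicator (A k i) (x i)" if i: "i \<in> S k" for i
        proof -
          have "prod_encode (k, i) \<in> I" using i k by (auto simp: I_def)
          then have "prod_encode (k, i) \<in> set_decode (q (x i)) \<longleftrightarrow> x i \<in> A k i"
            unfolding q_def by (subst cell_mem [OF fI]) (auto simp: AA_def)
          moreover have "i < n" using i valid(1) k by auto
          ultimately show ?thesis by (simp add: v_def cm.qx_def indicator_def)
        qed
        then have "u k (cm.qx x) = (\<Prod>i\<in>S k. indicator (A k i) (x i))"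
          unfolding u_def by (intro prod.cong) auto
        moreover have "\<beta> k (r s) = of_real (indicator (B k) s) * c k"
          using k by (simp add: \<beta>_def r_def cell_mem indicator_def)
        ultimately show "atom_fun (xs ! k) (x, s) = u k (cm.qx x) *\<^sub>R \<beta> k (r s)"
          by (simp add: xs_k scaleR_conv_of_real mult_ac)
      qed
      finally show ?thesis .
    qed
  qed
qed

text \<open>
  The elementary function \<open>e\<close> is close to \<open>f\<close> by way of small elements \<open>d0\<close> and \<open>d1\<close> of the two
  subspaces. Removing them from the given decomposition of \<open>f\<close> gives one of \<open>e\<close>, to which the
  certificate applies; adding them to the certified decomposition of \<open>e\<close> gives the result for \<open>f\<close>.
\<close>

lemma U1_decomposition:
  fixes f f0 f1 a0 a1 :: "(nat \<Rightarrow> 'a) \<times> real \<Rightarrow> 'k::{real_normed_field,euclidean_space}"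
  assumes t: "t > 0" and \<epsilon>: "\<epsilon> > 0"
    and f0: "f0 \<in> U1_Lp \<mu> n M 1" and f1: "f1 \<in> U1_Lp \<mu> n M 2"
    and f: "AE z in P \<Otimes>\<^sub>M lborel. f z = f0 z + f1 z"
    and a0: "a0 \<in> L1_Lp P 1" and a1: "a1 \<in> L1_Lp P 2"
    and fa: "AE z in P \<Otimes>\<^sub>M lborel. f z = a0 z + a1 z"
  shows "\<exists>h0\<in>U1_Lp \<mu> n M 1. \<exists>h1\<in>U1_Lp \<mu> n M 2. (AE z in P \<Otimes>\<^sub>M lborel. f z = h0 z + h1 z) \<and>
    L1_Lp_norm P 1 h0 + t * L1_Lp_norm P 2 h1
      \<le> sqrt (full_const M 2) * (L1_Lp_norm P 1 a0 + t * L1_Lp_norm P 2 a1) + \<epsilon>"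
proof -
  let ?N = "P \<Otimes>\<^sub>M lborel"
  define C where "C = sqrt (full_const M 2)"
  have C: "C > 0" using full_const_pos by (simp add: C_def)
  define \<delta> where "\<delta> = \<epsilon> / (1 + t + C + C * t + 1)"
  have den: "1 + t + C + C * t + 1 > 0" using t C by (intro add_pos_pos) auto
  then have \<delta>: "\<delta> > 0" using \<epsilon> by (simp add: \<delta>_def)
  obtain e0 where e0: "e0 \<in> elementary \<mu> n M" "L1_Lp_norm P 1 (\<lambda>z. f0 z - e0 z) < \<delta>"
    using U1_Lp_approximable [OF _ f0] \<delta> unfolding L1_closure_def by auto
  obtain e1 where e1: "e1 \<in> elementary \<mu> n M" "L1_Lp_norm P 2 (\<lambda>z. f1 z - e1 z) < \<delta>"
    using U1_Lp_approximable [OF _ f1] \<delta> unfolding L1_closure_def by auto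
  define d0 where "d0 = (\<lambda>z. f0 z - e0 z)"
  define d1 where "d1 = (\<lambda>z. f1 z - e1 z)"
  have d0: "d0 \<in> U1_Lp \<mu> n M 1"
    unfolding d0_def by (rule U1_Lp_diff [OF _ f0 elementary_U1_Lp [OF _ e0(1)]]) auto
  have d1: "d1 \<in> U1_Lp \<mu> n M 2"
    unfolding d1_def by (rule U1_Lp_diff [OF _ f1 elementary_U1_Lp [OF _ e1(1)]]) auto
  define e where "e = (\<lambda>z. e0 z + e1 z)"
  have e: "e \<in> elementary \<mu> n M" unfolding e_def using e0 e1 by (intro elementary_add)
  obtain g0 g1 \<Psi> where g0: "g0 \<in> U1_Lp \<mu> n M 1" and g1: "g1 \<in> U1_Lp \<mu> n M 2"
    and eg: "AE z in ?N. e z = g0 z + g1 z"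
    and p1: "\<And>a. a \<in> L1_Lp P 1 \<Longrightarrow> integrable ?N (\<lambda>z. inner (\<Psi> z) (a z)) \<and>
      (\<integral>z. inner (\<Psi> z) (a z) \<partial>?N) \<le> C * L1_Lp_norm P 1 a"
    and p2: "\<And>a. a \<in> L1_Lp P 2 \<Longrightarrow> integrable ?N (\<lambda>z. inner (\<Psi> z) (a z)) \<and>
      (\<integral>z. inner (\<Psi> z) (a z) \<partial>?N) \<le> C * t * L1_Lp_norm P 2 a"
    and g_le: "L1_Lp_norm P 1 g0 + t * L1_Lp_norm P 2 g1 \<le> (\<integral>z. inner (\<Psi> z) (e z) \<partial>?N) + \<delta>"
    using elementary_duality [OF t \<delta> e] unfolding dual_decomposition_def C_def [symmetric] by blast
  define b0 where "b0 = (\<lambda>z. a0 z - d0 z)"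
  define b1 where "b1 = (\<lambda>z. a1 z - d1 z)"
  have b0: "b0 \<in> L1_Lp P 1" "L1_Lp_norm P 1 b0 \<le> L1_Lp_norm P 1 a0 + \<delta>"
    unfolding b0_def using L1_Lp_diff [of 1 a0 P d0] a0 U1_Lp_L1_Lp [OF d0] e0(2) by (auto simp: d0_def)
  have b1: "b1 \<in> L1_Lp P 2" "L1_Lp_norm P 2 b1 \<le> L1_Lp_norm P 2 a1 + \<delta>"
    unfolding b1_def using L1_Lp_diff [of 2 a1 P d1] a1 U1_Lp_L1_Lp [OF d1] e1(2) by (auto simp: d1_def)
  have eb: "AE z in ?N. e z = b0 z + b1 z"
    using f fa by eventually_elim (simp add: e_def b0_def b1_def d0_def d1_def algebra_simps)
  have "(\<integral>z. inner (\<Psi> z) (e z) \<partial>?N) = (\<integral>z. inner (\<Psi> z) (b0 z) + inner (\<Psi> z) (b1 z) \<partial>?N)"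
  proof (rule integral_cong_AE)
    have "e \<in> L1_Lp P 1" using e by (intro elementary_L1_Lp) auto
    then show "(\<lambda>z. inner (\<Psi> z) (e z)) \<in> borel_measurable ?N"
      using p1 borel_measurable_integrable by blast
    show "(\<lambda>z. inner (\<Psi> z) (b0 z) + inner (\<Psi> z) (b1 z)) \<in> borel_measurable ?N"
      using p1 [OF b0(1)] p2 [OF b1(1)] by (intro borel_measurable_add) auto
    show "AE z in ?N. inner (\<Psi> z) (e z) = inner (\<Psi> z) (b0 z) + inner (\<Psi> z) (b1 z)"
      using eb by eventually_elim (simp add: inner_add_right)
  qed
  also have "\<dots> = (\<integral>z. inner (\<Psi> z) (b0 z) \<partial>?N) + (\<integral>z. inner (\<Psi> z) (b1 z) \<partial>?N)"
    using p1 [OF b0(1)] p2 [OF b1(1)] by (intro Bochner_Integration.integral_add) auto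
  also have "\<dots> \<le> C * L1_Lp_norm P 1 b0 + C * t * L1_Lp_norm P 2 b1"
    using p1 [OF b0(1)] p2 [OF b1(1)] by (intro add_mono) auto
  also have "\<dots> \<le> C * (L1_Lp_norm P 1 a0 + \<delta>) + C * t * (L1_Lp_norm P 2 a1 + \<delta>)"
    using b0(2) b1(2) C t by (intro add_mono mult_left_mono) auto
  finally have pair_le: "(\<integral>z. inner (\<Psi> z) (e z) \<partial>?N)
      \<le> C * (L1_Lp_norm P 1 a0 + \<delta>) + C * t * (L1_Lp_norm P 2 a1 + \<delta>)" .
  define h0 where "h0 = (\<lambda>z. d0 z + g0 z)"
  define h1 where "h1 = (\<lambda>z. d1 z + g1 z)"
  have h0: "h0 \<in> U1_Lp \<mu> n M 1"
    unfolding h0_def by (rule U1_Lp_add [OF _ d0 g0]) simp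
  have h1: "h1 \<in> U1_Lp \<mu> n M 2"
    unfolding h1_def by (rule U1_Lp_add [OF _ d1 g1]) simp
  have h0_le: "L1_Lp_norm P 1 h0 \<le> \<delta> + L1_Lp_norm P 1 g0"
    unfolding h0_def using L1_Lp_add(2) [of 1 d0 P g0] U1_Lp_L1_Lp [OF d0] U1_Lp_L1_Lp [OF g0] e0(2)
    by (auto simp: d0_def)
  have "L1_Lp_norm P 2 h1 \<le> \<delta> + L1_Lp_norm P 2 g1"
    unfolding h1_def using L1_Lp_add(2) [of 2 d1 P g1] U1_Lp_L1_Lp [OF d1] U1_Lp_L1_Lp [OF g1] e1(2)
    by (auto simp: d1_def)
  then have "t * L1_Lp_norm P 2 h1 \<le> t * (\<delta> + L1_Lp_norm P 2 g1)" using t by (intro mult_left_mono) auto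
  then have "L1_Lp_norm P 1 h0 + t * L1_Lp_norm P 2 h1
      \<le> C * (L1_Lp_norm P 1 a0 + t * L1_Lp_norm P 2 a1) + \<delta> * (1 + t + C + C * t + 1)"
    using h0_le g_le pair_le by (simp add: algebra_simps)
  also have "\<delta> * (1 + t + C + C * t + 1) = \<epsilon>" using den by (simp add: \<delta>_def)
  finally have "L1_Lp_norm P 1 h0 + t * L1_Lp_norm P 2 h1
      \<le> C * (L1_Lp_norm P 1 a0 + t * L1_Lp_norm P 2 a1) + \<epsilon>" .
  moreover have "AE z in ?N. f z = h0 z + h1 z"
    using f eg by eventually_elim (simp add: h0_def h1_def d0_def d1_def e_def algebra_simps)
  ultimately show ?thesis using h0 h1 unfolding C_def by blast
qed

lemma K_closed_U1_Lp:
  "K_closed (sqrt (full_const M 2)) (P \<Otimes>\<^sub>M lborel)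
    (U1_Lp \<mu> n M 1 :: ((nat \<Rightarrow> 'a) \<times> real \<Rightarrow> 'k::{real_normed_field,euclidean_space}) set) (U1_Lp \<mu> n M 2)
    (L1_Lp P 1) (L1_Lp_norm P 1) (L1_Lp P 2) (L1_Lp_norm P 2)"
  unfolding K_closed_def
proof (intro ballI allI impI)
  let ?N = "P \<Otimes>\<^sub>M lborel" and ?C = "sqrt (full_const M 2)"
  fix f :: "(nat \<Rightarrow> 'a) \<times> real \<Rightarrow> 'k" and t :: real
  assume f: "f \<in> sum_space ?N (U1_Lp \<mu> n M 1) (U1_Lp \<mu> n M 2)" and t: "0 < t"
  let ?DY = "decompositions ?N (U1_Lp \<mu> n M 1) (U1_Lp \<mu> n M 2) f"
  let ?DX = "decompositions ?N (L1_Lp P 1) (L1_Lp P 2) f"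
  let ?KY = "K_functional ?N (U1_Lp \<mu> n M 1) (L1_Lp_norm P 1) (U1_Lp \<mu> n M 2) (L1_Lp_norm P 2) f t"
  let ?KX = "K_functional ?N (L1_Lp P 1) (L1_Lp_norm P 1) (L1_Lp P 2) (L1_Lp_norm P 2) f t"
  let ?v = "\<lambda>(f0, f1). L1_Lp_norm P 1 f0 + t * L1_Lp_norm P 2 f1"
  have C: "?C > 0" using full_const_pos by simp
  obtain f0 f1 where f01: "f0 \<in> U1_Lp \<mu> n M 1" "f1 \<in> U1_Lp \<mu> n M 2" "AE z in ?N. f z = f0 z + f1 z"
    using f by (auto simp: sum_space_def decompositions_def)
  have DX: "(f0, f1) \<in> ?DX" using f01 U1_Lp_L1_Lp by (auto simp: decompositions_def)
  have bdd: "bdd_below (?v ` ?DY)"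
    using t by (intro bdd_belowI [of _ 0]) (auto intro!: add_nonneg_nonneg mult_nonneg_nonneg L1_Lp_norm_nonneg)
  have K_le: "?KY / ?C \<le> ?v a"
    if a: "a \<in> ?DX" for a
  proof -
    obtain a0 a1 where a_eq: "a = (a0, a1)" and a01: "a0 \<in> L1_Lp P 1" "a1 \<in> L1_Lp P 2" "AE z in ?N. f z = a0 z + a1 z"
      using a by (auto simp: decompositions_def)
    have "?KY \<le> ?C * ?v a"
    proof (rule field_le_epsilon)
      fix \<epsilon> :: real assume "\<epsilon> > 0"
      then obtain h0 h1 where h: "h0 \<in> U1_Lp \<mu> n M 1" "h1 \<in> U1_Lp \<mu> n M 2" "AE z in ?N. f z = h0 z + h1 z"
        "L1_Lp_norm P 1 h0 + t * L1_Lp_norm P 2 h1 \<le> ?C * (L1_Lp_norm P 1 a0 + t * L1_Lp_norm P 2 a1) + \<epsilon>"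
        using U1_decomposition [OF t _ f01 a01] by blast
      have "?KY \<le> ?v (h0, h1)"
        unfolding K_functional_def using h by (intro cINF_lower bdd) (auto simp: decompositions_def)
      then show "?KY \<le> ?C * ?v a + \<epsilon>"
        using h(4) by (simp add: a_eq)
    qed
    then show ?thesis using C by (simp add: pos_divide_le_eq mult.commute)
  qed
  have "?KY / ?C
      \<le> ?KX"
    unfolding K_functional_def [of ?N "L1_Lp P 1"]
    by (rule cINF_greatest) (use DX K_le in auto)
  then show "?KY
      \<le> ?C * ?KX"
    using C by (simp add: pos_divide_le_eq mult.commute)
qed

end

theorem theorem5p5:
  fixes \<mu> :: "'a measure" and M :: nat
  assumes "prob_space \<mu>"
  shows "\<exists>C::real. \<forall>n::nat.
    K_closed C (prod_pow \<mu> n \<Otimes>\<^sub>M lborel)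
      (U1_Lp \<mu> n M 1 :: ((nat \<Rightarrow> 'a) \<times> real \<Rightarrow> 'k::{real_normed_field,euclidean_space}) set)
      (U1_Lp \<mu> n M 2)
      (L1_Lp (prod_pow \<mu> n) 1) (L1_Lp_norm (prod_pow \<mu> n) 1)
      (L1_Lp (prod_pow \<mu> n) 2) (L1_Lp_norm (prod_pow \<mu> n) 2)"
proof (intro exI allI)
  fix n
  interpret sample_power \<mu> n M
    using assms by (simp add: sample_power_def)
  show "K_closed (sqrt (full_const M 2)) (prod_pow \<mu> n \<Otimes>\<^sub>M lborel)
      (U1_Lp \<mu> n M 1 :: ((nat \<Rightarrow> 'a) \<times> real \<Rightarrow> 'k) set)
      (U1_Lp \<mu> n M 2)
      (L1_Lp (prod_pow \<mu> n) 1) (L1_Lp_norm (prod_pow \<mu> n) 1)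
      (L1_Lp (prod_pow \<mu> n) 2) (L1_Lp_norm (prod_pow \<mu> n) 2)"
    by (rule K_closed_U1_Lp)
qed

end
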